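(* For any closed set $N\subset H$, $$\limsup_{\mu\to0}\ \inf_{x\in N}V_\mu(x)\le\inf_{x\in N}V(x).$$
   Context: Spaces. Let $d\ge 1$, let $D\subset\mathbb R^d$ be a bounded regular open domain, $H=L^2(D)$, and let $A$ be the realization in $H$ of the Laplacian with Dirichlet boundary conditions. Let $\{e_k\}$ be a complete orthonormal basis of $H$ with $Ae_k=-\alpha_ke_k$, $0<\alpha_1\le\alpha_k\le\alpha_{k+1}$; $D$ is regular enough that $\alpha_k\sim k^{2/d}$. For $\delta\in\mathbb R$, $H^\delta$ is the Hilbert space obtained by completing $\mathrm{span}\{e_k\}$ in the norm $|x|_{H^\delta}^2=\sum_k\alpha_k^\delta\langle x,e_k\rangle_H^2$ (so $H^0=H$). Set $\mathcal H_\delta=H^\delta\times H^{\delta-1}$ with the product norm and $\mathcal H=\mathcal H_0$. Assumptions. $Q$ is a bounded linear operator on $H$ with $Qe_k=\lambda_ke_k$ and $\frac1c\alpha_k^{-\beta}\le\lambda_k\le c\,\alpha_k^{-\beta}$ for all $k$, for some $c>0$ and $\beta>(d-2)/4$. For every $\delta\in[0,1+2\beta]$ the map $B:H^\delta\to H^\delta$ is Lipschitz with Lipschitz constant $\gamma_\delta<\alpha_1$; $B(0)=0$; $B$ is differentiable in $H^{2\beta}$ with $\sup_{x\in H^{2\beta}}\|DB(x)\|_{\mathcal L(H^{2\beta})}=\gamma_{2\beta}$. Operators. For $\mu>0$, $S_\mu(t)$, $t\ge0$, is the semigroup on $\mathcal H_\delta$ generated by $A_\mu(u,v)=\left(v,\frac1\mu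 Au-\frac1\mu v\right)$, $D(A_\mu)=\mathcal H_{1+\delta}$. Put $B_\mu(u,v)=\frac1\mu(0,B(u))$ and $Q_\mu u=\frac1\mu(0,Qu)$. Quasi-potentials ($\inf\emptyset=+\infty$). For $T>0$ and $z\in C([0,T];\mathcal H)$, $I^\mu_{0,T}(z)=\frac12\inf|\psi|^2_{L^2((0,T);H)}$ over all $\psi\in L^2((0,T);H)$ with $z(t)=S_\mu(t)z(0)+\int_0^tS_\mu(t-s)B_\mu(z(s))ds+\int_0^tS_\mu(t-s)Q_\mu\psi(s)ds$ on $[0,T]$. For $\varphi\in C([0,T];H)$, $I_{0,T}(\varphi)=\frac12\inf|\psi|^2_{L^2((0,T);H)}$ over all $\psi\in L^2((0,T);H)$ with $\varphi(t)=e^{tA}\varphi(0)+\int_0^te^{(t-s)A}B(\varphi(s))ds+\int_0^te^{(t-s)A}Q\psi(s)ds$ on $[0,T]$. Then $V^\mu(x,y)=\inf\{I^\mu_{0,T}(z): T>0,\ z\in C([0,T];\mathcal H),\ z(0)=0,\ z(T)=(x,y)\}$ for $(x,y)\in\mathcal H$; $V_\mu(x)=\inf_{y\in H^{-1}}V^\mu(x,y)$ for $x\in H$; and $V(x)=\inf\{I_{0,T}(\varphi): T\ge0,\ \varphi\in C([0,T];H),\ \varphi(0)=0,\ \varphi(T)=x\}$ for $x\in H$. *)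

theory Defs
  imports "HOL-Analysis.Analysis" "HOL-Library.Landau_Symbols"
begin

section \<open>The space of square integrable functions and the Dirichlet Laplacian\<close>

definition L2_fun :: "'n::euclidean_space set \<Rightarrow> ('n \<Rightarrow> real) set" where
  "L2_fun D = {f. set_borel_measurable lborel D f \<and> set_integrable lborel D (\<lambda>x. (f x)\<^sup>2)}"

text \<open>A type cannot depend on the set \<open>D\<close>. The Hilbert space \<open>L\<^sup>2(D)\<close> is therefore a type \<open>'h\<close>
  together with the map \<open>J\<close> that sends a square integrable function to its class modulo equality
  almost everywhere: \<open>J\<close> is linear, onto, and turns the integral pairing into the inner product
  (so \<open>J f = J g\<close> iff \<open>f = g\<close> almost everywhere on \<open>D\<close>).\<close>

definition is_L2 :: "'n::euclidean_space set \<Rightarrow> (('n \<Rightarrow> real) \<Rightarrow> 'h::real_inner) \<Rightarrow> bool" where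
  "is_L2 D J \<longleftrightarrow>
     J ` L2_fun D = UNIV \<and>
     (\<forall>f\<in>L2_fun D. \<forall>g\<in>L2_fun D. \<forall>a b. J (\<lambda>x. a * f x + b * g x) = a *\<^sub>R J f + b *\<^sub>R J g) \<and>
     (\<forall>f\<in>L2_fun D. \<forall>g\<in>L2_fun D. inner (J f) (J g) = (LINT x:D|lborel. f x * g x))"

definition partial_deriv :: "'n::euclidean_space \<Rightarrow> ('n \<Rightarrow> real) \<Rightarrow> 'n \<Rightarrow> real" where
  "partial_deriv i f x = frechet_derivative f (at x) i"

primrec Ck :: "nat \<Rightarrow> ('n::euclidean_space \<Rightarrow> real) \<Rightarrow> bool" where
  "Ck 0 f \<longleftrightarrow> continuous_on UNIV f"
| "Ck (Suc k) f \<longleftrightarrow> (\<forall>x. f differentiable (at x)) \<and> (\<forall>i\<in>Basis. Ck k (partial_deriv i f))"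

text \<open>The space \<open>C\<^sub>c\<^sup>\<infinity>(D)\<close>.\<close>

definition test_fun :: "'n::euclidean_space set \<Rightarrow> ('n \<Rightarrow> real) set" where
  "test_fun D = {\<phi>. (\<forall>k. Ck k \<phi>) \<and> (\<exists>K. compact K \<and> K \<subseteq> D \<and> (\<forall>x. x \<notin> K \<longrightarrow> \<phi> x = 0))}"

definition laplacian :: "('n::euclidean_space \<Rightarrow> real) \<Rightarrow> 'n \<Rightarrow> real" where
  "laplacian \<phi> x = (\<Sum>i\<in>Basis. partial_deriv i (partial_deriv i \<phi>) x)"

text \<open>The Sobolev space with zero trace, as the closure of the test functions in the
  \<open>W\<^sup>1\<^sup>,\<^sup>2\<close>-norm; the \<open>g i\<close> are the weak partial derivatives of \<open>u\<close>.\<close>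

definition sobolev_zero :: "'n::euclidean_space set \<Rightarrow> ('n \<Rightarrow> real) set" where
  "sobolev_zero D = {u \<in> L2_fun D. \<exists>\<phi> :: nat \<Rightarrow> 'n \<Rightarrow> real. \<exists>g.
     (\<forall>n. \<phi> n \<in> test_fun D) \<and>
     (\<lambda>n. LINT x:D|lborel. (\<phi> n x - u x)\<^sup>2) \<longlonglongrightarrow> 0 \<and>
     (\<forall>i\<in>Basis. g i \<in> L2_fun D \<and>
        (\<lambda>n. LINT x:D|lborel. (partial_deriv i (\<phi> n) x - g i x)\<^sup>2) \<longlonglongrightarrow> 0)}"

text \<open>Unbounded operators are given by their graphs. A pair \<open>(u, f)\<close> is in the graph of the Dirichlet
  Laplacian iff \<open>u\<close> vanishes on the boundary in the Sobolev sense and its distributional Laplacian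
  in \<open>D\<close> is the square integrable function \<open>f\<close>.\<close>

definition dirichlet_laplacian ::
    "'n::euclidean_space set \<Rightarrow> (('n \<Rightarrow> real) \<Rightarrow> 'h) \<Rightarrow> ('h \<times> 'h) set" where
  "dirichlet_laplacian D J = {(J u, J f) | u f. u \<in> sobolev_zero D \<and> f \<in> L2_fun D \<and>
     (\<forall>\<phi>\<in>test_fun D. (LINT x:D|lborel. u x * laplacian \<phi> x) = (LINT x:D|lborel. f x * \<phi> x))}"

section \<open>The scale of Hilbert spaces\<close>

definition orthonormal_basis :: "(nat \<Rightarrow> 'h::real_inner) \<Rightarrow> bool" where
  "orthonormal_basis e \<longleftrightarrow>
     (\<forall>i k. inner (e i) (e k) = (if i = k then 1 else 0)) \<and> closure (span (range e)) = UNIV"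

text \<open>For \<open>\<delta> \<ge> 0\<close> (and eigenvalues bounded below by a positive number) the completion of
  \<open>span (range e)\<close> in \<open>hnorm \<alpha> e \<delta>\<close> is the following subspace of \<open>H\<close>.
  It is only meant to be used for \<open>\<delta> \<ge> 0\<close>.\<close>

definition hspace :: "(nat \<Rightarrow> real) \<Rightarrow> (nat \<Rightarrow> 'h::real_inner) \<Rightarrow> real \<Rightarrow> 'h set" where
  "hspace \<alpha> e \<delta> = {x. summable (\<lambda>k. \<alpha> k powr \<delta> * (inner x (e k))\<^sup>2)}"

definition hnorm :: "(nat \<Rightarrow> real) \<Rightarrow> (nat \<Rightarrow> 'h::real_inner) \<Rightarrow> real \<Rightarrow> 'h \<Rightarrow> real" where
  "hnorm \<alpha> e \<delta> x = sqrt (\<Sum>k. \<alpha> k powr \<delta> * (inner x (e k))\<^sup>2)"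

text \<open>The space \<open>H\<^sup>-\<^sup>1\<close> is not contained in \<open>H\<close>; it is a complete space \<open>'g\<close>
  with an embedding \<open>\<iota>\<close> of \<open>H\<close> that is isometric for the norm of exponent \<open>-1\<close> and maps
  \<open>span (range e)\<close> onto a dense subspace.\<close>

definition is_H_minus_1 ::
    "(nat \<Rightarrow> real) \<Rightarrow> (nat \<Rightarrow> 'h::real_inner) \<Rightarrow> ('h \<Rightarrow> 'g::{real_inner, banach}) \<Rightarrow> bool" where
  "is_H_minus_1 \<alpha> e \<iota> \<longleftrightarrow>
     linear \<iota> \<and> (\<forall>x. norm (\<iota> x) = hnorm \<alpha> e (-1) x) \<and> closure (\<iota> ` span (range e)) = UNIV"

section \<open>Differentiability in the spaces of the scale\<close>

definition bounded_linear_in ::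
    "(nat \<Rightarrow> real) \<Rightarrow> (nat \<Rightarrow> 'h::real_inner) \<Rightarrow> real \<Rightarrow> ('h \<Rightarrow> 'h) \<Rightarrow> bool" where
  "bounded_linear_in \<alpha> e \<delta> L \<longleftrightarrow>
     L ` hspace \<alpha> e \<delta> \<subseteq> hspace \<alpha> e \<delta> \<and>
     (\<forall>h\<in>hspace \<alpha> e \<delta>. \<forall>k\<in>hspace \<alpha> e \<delta>. \<forall>a b. L (a *\<^sub>R h + b *\<^sub>R k) = a *\<^sub>R L h + b *\<^sub>R L k) \<and>
     (\<exists>C. \<forall>h\<in>hspace \<alpha> e \<delta>. hnorm \<alpha> e \<delta> (L h) \<le> C * hnorm \<alpha> e \<delta> h)"

definition op_norm_in ::
    "(nat \<Rightarrow> real) \<Rightarrow> (nat \<Rightarrow> 'h::real_inner) \<Rightarrow> real \<Rightarrow> ('h \<Rightarrow> 'h) \<Rightarrow> real" where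
  "op_norm_in \<alpha> e \<delta> L = Sup {hnorm \<alpha> e \<delta> (L h) | h. h \<in> hspace \<alpha> e \<delta> \<and> hnorm \<alpha> e \<delta> h \<le> 1}"

definition has_derivative_in ::
    "(nat \<Rightarrow> real) \<Rightarrow> (nat \<Rightarrow> 'h::real_inner) \<Rightarrow> real \<Rightarrow> ('h \<Rightarrow> 'h) \<Rightarrow> ('h \<Rightarrow> 'h) \<Rightarrow> 'h \<Rightarrow> bool" where
  "has_derivative_in \<alpha> e \<delta> F L x \<longleftrightarrow>
     bounded_linear_in \<alpha> e \<delta> L \<and>
     (\<forall>\<epsilon>>0. \<exists>\<eta>>0. \<forall>h\<in>hspace \<alpha> e \<delta>. hnorm \<alpha> e \<delta> h < \<eta> \<longrightarrow>
        hnorm \<alpha> e \<delta> (F (x + h) - F x - L h) \<le> \<epsilon> * hnorm \<alpha> e \<delta> h)"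

section \<open>Semigroups\<close>

definition C0_semigroup :: "(real \<Rightarrow> 'a::banach \<Rightarrow> 'a) \<Rightarrow> bool" where
  "C0_semigroup S \<longleftrightarrow>
     (\<forall>t\<ge>0. bounded_linear (S t)) \<and> S 0 = id \<and>
     (\<forall>s\<ge>0. \<forall>t\<ge>0. S (s + t) = S s \<circ> S t) \<and>
     (\<forall>x. ((\<lambda>t. S t x) \<longlongrightarrow> x) (at_right 0))"

definition generator :: "(real \<Rightarrow> 'a::banach \<Rightarrow> 'a) \<Rightarrow> ('a \<times> 'a) set" where
  "generator S = {(x, y). ((\<lambda>t. (1 / t) *\<^sub>R (S t x - x)) \<longlongrightarrow> y) (at_right 0)}"

text \<open>The extension of the Laplacian to an operator from \<open>H\<^sup>1\<close> to \<open>H\<^sup>-\<^sup>1\<close>.\<close>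

definition A_ext :: "(nat \<Rightarrow> real) \<Rightarrow> (nat \<Rightarrow> 'h::real_inner) \<Rightarrow> ('h \<Rightarrow> 'g::banach) \<Rightarrow> 'h \<Rightarrow> 'g" where
  "A_ext \<alpha> e \<iota> u = (\<Sum>k. (- \<alpha> k * inner u (e k)) *\<^sub>R \<iota> (e k))"

text \<open>The graph of \<open>A\<^sub>\<mu>\<close> on \<open>H \<times> H\<^sup>-\<^sup>1\<close>, with domain \<open>H\<^sup>1 \<times> H\<close>. An element \<open>v\<close> of \<open>H\<close>
  appears as \<open>\<iota> v\<close> where it is regarded as an element of \<open>H\<^sup>-\<^sup>1\<close>.\<close>

definition A_mu :: "(nat \<Rightarrow> real) \<Rightarrow> (nat \<Rightarrow> 'h::real_inner) \<Rightarrow> ('h \<Rightarrow> 'g::banach) \<Rightarrow> real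
    \<Rightarrow> (('h \<times> 'g) \<times> ('h \<times> 'g)) set" where
  "A_mu \<alpha> e \<iota> \<mu> =
     {((u, \<iota> v), (v, (1 / \<mu>) *\<^sub>R A_ext \<alpha> e \<iota> u - (1 / \<mu>) *\<^sub>R \<iota> v)) | u v. u \<in> hspace \<alpha> e 1}"

definition B_mu :: "('h \<Rightarrow> 'g::real_vector) \<Rightarrow> ('h \<Rightarrow> 'h) \<Rightarrow> real \<Rightarrow> 'h \<times> 'g \<Rightarrow> 'h::real_vector \<times> 'g" where
  "B_mu \<iota> B \<mu> z = (1 / \<mu>) *\<^sub>R (0, \<iota> (B (fst z)))"

definition Q_mu :: "('h \<Rightarrow> 'g::real_vector) \<Rightarrow> ('h \<Rightarrow> 'h) \<Rightarrow> real \<Rightarrow> 'h \<Rightarrow> 'h::real_vector \<times> 'g" where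
  "Q_mu \<iota> Q \<mu> u = (1 / \<mu>) *\<^sub>R (0, \<iota> (Q u))"

section \<open>Action functionals and quasi-potentials\<close>

definition L2_time :: "real \<Rightarrow> (real \<Rightarrow> 'h::{banach, second_countable_topology}) set" where
  "L2_time T = {\<psi>. set_borel_measurable lborel {0<..<T} \<psi> \<and>
     set_integrable lborel {0<..<T} (\<lambda>s. (norm (\<psi> s))\<^sup>2)}"

text \<open>If \<open>S\<close> is a strongly continuous semigroup, \<open>F\<close> is Lipschitz continuous, \<open>G\<close> is bounded and linear,
  \<open>z\<close> is continuous and \<open>\<psi>\<close> is in \<open>L2_time T\<close>, both integrands are Bochner integrable.\<close>

definition mild_solution :: "(real \<Rightarrow> 'b \<Rightarrow> 'b) \<Rightarrow> ('b \<Rightarrow> 'b) \<Rightarrow> ('h \<Rightarrow> 'b) \<Rightarrow> real \<Rightarrow> (real \<Rightarrow> 'h)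
    \<Rightarrow> (real \<Rightarrow> 'b::{banach, second_countable_topology}) \<Rightarrow> bool" where
  "mild_solution S F G T \<psi> z \<longleftrightarrow> (\<forall>t\<in>{0..T}. z t =
     S t (z 0) + (LINT s:{0<..<t}|lborel. S (t - s) (F (z s)))
       + (LINT s:{0<..<t}|lborel. S (t - s) (G (\<psi> s))))"

definition action :: "(real \<Rightarrow> 'b \<Rightarrow> 'b) \<Rightarrow> ('b \<Rightarrow> 'b)
    \<Rightarrow> ('h::{banach, second_countable_topology} \<Rightarrow> 'b) \<Rightarrow> real
    \<Rightarrow> (real \<Rightarrow> 'b::{banach, second_countable_topology}) \<Rightarrow> ereal" where
  "action S F G T z = Inf {ereal (1/2 * (LINT s:{0<..<T}|lborel. (norm (\<psi> s))\<^sup>2)) | \<psi>.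
     \<psi> \<in> L2_time T \<and> mild_solution S F G T \<psi> z}"

text \<open>In the next two definitions \<open>S\<close> is the semigroup generated by \<open>A\<^sub>\<mu>\<close>,
  in the third one \<open>E\<close> is the semigroup generated by the Dirichlet Laplacian.\<close>

definition V_pair :: "('h \<Rightarrow> 'g) \<Rightarrow> ('h \<Rightarrow> 'h) \<Rightarrow> ('h \<Rightarrow> 'h) \<Rightarrow> (real \<Rightarrow> 'h \<times> 'g \<Rightarrow> 'h \<times> 'g) \<Rightarrow> real
    \<Rightarrow> 'h::{banach, second_countable_topology} \<Rightarrow> 'g::{banach, second_countable_topology} \<Rightarrow> ereal" where
  "V_pair \<iota> B Q S \<mu> x y = Inf {action S (B_mu \<iota> B \<mu>) (Q_mu \<iota> Q \<mu>) T z | T z.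
     T > 0 \<and> continuous_on {0..T} z \<and> z 0 = 0 \<and> z T = (x, y)}"

definition V_mu :: "('h \<Rightarrow> 'g) \<Rightarrow> ('h \<Rightarrow> 'h) \<Rightarrow> ('h \<Rightarrow> 'h)
    \<Rightarrow> (real \<Rightarrow> 'h \<times> 'g::{banach, second_countable_topology} \<Rightarrow> 'h \<times> 'g) \<Rightarrow> real
    \<Rightarrow> 'h::{banach, second_countable_topology} \<Rightarrow> ereal" where
  "V_mu \<iota> B Q S \<mu> x = (INF y. V_pair \<iota> B Q S \<mu> x y)"

definition V_limit :: "('h \<Rightarrow> 'h) \<Rightarrow> ('h \<Rightarrow> 'h) \<Rightarrow> (real \<Rightarrow> 'h \<Rightarrow> 'h)
    \<Rightarrow> 'h::{banach, second_countable_topology} \<Rightarrow> ereal" where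
  "V_limit B Q E x = Inf {action E B Q T \<phi> | T \<phi>.
     T \<ge> 0 \<and> continuous_on {0..T} \<phi> \<and> \<phi> 0 = 0 \<and> \<phi> T = x}"

end

theory Submission
  imports Defs
begin

text \<open>
Let \<open>x = \<phi> T\<close> be reached by the parabolic equation with control \<open>\<psi>\<close> along the path \<open>\<phi>\<close>. It is enough
to drive the wave equation, for every small \<open>\<mu>\<close>, from rest at \<open>0\<close> to the same position \<open>x\<close> at a cost
that exceeds the cost of \<open>\<psi>\<close> by an arbitrarily small amount: this bounds the upper limit of
\<open>V_mu\<close> at \<open>x\<close> by \<open>V_limit\<close> at \<open>x\<close>, and the assertion about a set \<open>N\<close> follows by taking infima.

A path \<open>U\<close> with two time derivatives follows the wave equation if the control is
\<open>Q\<^sup>-\<^sup>1 (\<mu> U'' + U' - A U - B(U))\<close>, so \<open>\<phi>\<close> has to be replaced by such a path for which this is close to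
\<open>\<psi>\<close>. Two things go wrong for \<open>\<phi>\<close> itself: its time derivative is merely square integrable in each
mode, and \<open>x\<close> is in general no smoother than \<open>H\<^sup>1\<^sup>+\<^sup>2\<^sup>\<beta>\<close>, so that no path independent of \<open>\<mu>\<close> will do
near the final time. The path \<open>U\<close> is therefore a sum of two parts.

The first part consists of the modes \<open>k < n\<close>. There \<open>\<phi>\<^sub>k\<close> is replaced by the solution of
\<open>\<mu> u'' + u' = \<phi>\<^sub>k'\<close> that starts at rest. The inertial term is then accounted for exactly, and what is
left over is the difference \<open>\<phi>\<^sub>k - u\<close>, called the lag, which is of order \<open>\<surd>\<mu>\<close> for fixed \<open>n\<close>
(\<open>bounded_sums_lag\<close>). Omitting the modes \<open>k \<ge> n\<close> is harmless because paths of finite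
action are bounded in \<open>H\<^sup>1\<^sup>+\<^sup>2\<^sup>\<beta>\<close> (\<open>parabolic_regularity\<close>), one derivative more than the
domain \<open>H\<^sup>2\<^sup>\<beta>\<close> of \<open>Q\<^sup>-\<^sup>1\<close>, on which \<open>B\<close> is Lipschitz.

The second part moves from \<open>0\<close> to the error of the first part at the final time, an element of
small norm in \<open>H\<^sup>1\<^sup>+\<^sup>2\<^sup>\<beta>\<close>. In each mode it is an explicit motion of the damped oscillator
\<open>\<mu> w'' + w' + a w\<close>, essentially a free motion run backwards, whose cost is at most \<open>K * a\<close> with \<open>K\<close>
independent of \<open>\<mu>\<close> and of the mode (\<open>oscillator_steering\<close>). Summed over the modes, the cost is the
squared norm of the error in \<open>H\<^sup>1\<^sup>+\<^sup>2\<^sup>\<beta>\<close>, up to a constant. Choosing first \<open>n\<close> large and then \<open>\<mu>\<close>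
small makes all error terms small (\<open>regularized_control\<close>).

It remains to recognise \<open>U\<close> as a mild solution for the semigroup of the wave equation, of which only
the generator is known. The two vectors that span a mode lie in its domain, so each
mode can be integrated by parts against their orbits, and the modes are summed by dominated
convergence (\<open>mild_solution_from_modes\<close>). The domination needs the local boundedness of a strongly
continuous semigroup, a consequence of the theorem of Baire.
\<close>

section \<open>Strongly continuous semigroups\<close>

lemma C0_bounded_linear: "C0_semigroup S \<Longrightarrow> 0 \<le> t \<Longrightarrow> bounded_linear (S t)"
  by (simp add: C0_semigroup_def)

lemma C0_add: "C0_semigroup S \<Longrightarrow> 0 \<le> s \<Longrightarrow> 0 \<le> t \<Longrightarrow> S (s + t) x = S s (S t x)"
  by (simp add: C0_semigroup_def)

lemma C0_zero: "C0_semigroup S \<Longrightarrow> S 0 x = x"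
  by (simp add: C0_semigroup_def)

text \<open>The sets of points whose orbits stay below \<open>n + 1\<close> up to time \<open>1 / (n + 1)\<close> are closed and, by
  continuity at time \<open>0\<close>, cover the space. By Baire's theorem one of them contains a ball, and
  linearity turns a bound on a ball into a bound on the operators.\<close>

lemma C0_bounded_near_zero:
  assumes S: "C0_semigroup (S :: real \<Rightarrow> 'a::banach \<Rightarrow> 'a)"
  shows "\<exists>d>0. \<exists>K\<ge>1. \<forall>t\<in>{0..d}. \<forall>x. norm (S t x) \<le> K * norm x"
proof -
  define C where "C n = {x. \<forall>t\<in>{0..1 / real (Suc n)}. norm (S t x) \<le> real (Suc n)}" for n
  have closed: "closed (C n)" for n
  proof -
    have "C n = (\<Inter>t\<in>{0..1 / real (Suc n)}. {x. norm (S t x) \<le> real (Suc n)})"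
      by (auto simp: C_def)
    moreover have "closed {x. norm (S t x) \<le> real (Suc n)}" if "t \<in> {0..1 / real (Suc n)}" for t
    proof -
      have "continuous_on UNIV (S t)"
        using C0_bounded_linear[OF S, of t] that by (intro linear_continuous_on) auto
      then show ?thesis by (intro closed_Collect_le continuous_on_norm continuous_on_const)
    qed
    ultimately show ?thesis by (simp add: closed_INT del: of_nat_Suc)
  qed
  have cover: "\<exists>n. x \<in> C n" for x
  proof -
    have "((\<lambda>t. S t x) \<longlongrightarrow> x) (at_right 0)" using S by (simp add: C0_semigroup_def)
    then have "((\<lambda>t. norm (S t x)) \<longlongrightarrow> norm x) (at_right 0)" by (rule tendsto_norm)
    then have "eventually (\<lambda>t. norm (S t x) < norm x + 1) (at_right 0)"
      by (rule order_tendstoD) simp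
    then obtain b where b: "b > 0" "\<And>t. 0 < t \<Longrightarrow> t < b \<Longrightarrow> norm (S t x) < norm x + 1"
      by (auto simp: eventually_at_right_field)
    obtain n where n: "real n > max (1 / b) (norm x + 1)" using reals_Archimedean2 by blast
    then have "1 / b < real (Suc n)" by simp
    then have "1 / real (Suc n) < b" using b(1) by (simp add: field_simps)
    then have "norm (S t x) \<le> real (Suc n)" if "t \<in> {0..1 / real (Suc n)}" for t
    proof (cases "t = 0")
      case True then show ?thesis using C0_zero[OF S, of x] n by simp
    next
      case False
      then have "norm (S t x) < norm x + 1" using that \<open>1 / real (Suc n) < b\<close> by (intro b(2)) auto
      then show ?thesis using n by simp
    qed
    then have "x \<in> C n" by (simp add: C_def)
    then show ?thesis ..
  qed
  have "\<exists>n. interior (C n) \<noteq> {}"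
  proof (rule ccontr)
    assume "\<nexists>n. interior (C n) \<noteq> {}"
    then have "Met_TC.mtopology interior_of (\<Union>(range C)) = {}"
      using closed
      by (intro Met_TC.metric_Baire_category_alt)
         (auto simp: mcomplete_iff_complete complete_UNIV simp del: mtopology_is_euclidean, auto)
    moreover have "\<Union>(range C) = UNIV" using cover by blast
    ultimately show False by simp
  qed
  then obtain n x0 r where r: "r > 0" "ball x0 r \<subseteq> C n" by (meson mem_interior all_not_in_conv)
  define N where "N = real (Suc n)"
  have N: "N \<ge> 1" by (simp add: N_def)
  have "norm (S t x) \<le> (4 * N / r + 1) * norm x" if t: "t \<in> {0..1 / N}" for t x
  proof (cases "x = 0")
    case True
    then show ?thesis using C0_bounded_linear[OF S, of t] t by (simp add: linear_simps)
  next
    case False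
    interpret bounded_linear "S t" using C0_bounded_linear[OF S, of t] t by simp
    define k where "k = r / (2 * norm x)"
    have k: "k > 0" using r False by (simp add: k_def)
    have "x0 \<in> C n" "x0 + k *\<^sub>R x \<in> C n"
      using r False by (auto simp: k_def dist_norm intro!: subsetD[OF r(2)])
    then have "norm (S t x0) \<le> N" "norm (S t (x0 + k *\<^sub>R x)) \<le> N"
      using t by (auto simp: C_def N_def)
    moreover have "k *\<^sub>R S t x = S t (x0 + k *\<^sub>R x) - S t x0" by (simp add: add scaleR)
    then have "norm (k *\<^sub>R S t x) \<le> norm (S t (x0 + k *\<^sub>R x)) + norm (S t x0)"
      by (metis norm_triangle_ineq4)
    ultimately have "k * norm (S t x) \<le> 2 * N" using k by simp
    then have "norm (S t x) \<le> 2 * N / k" using k by (simp add: field_simps)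
    also have "\<dots> = 4 * N / r * norm x" using r False by (simp add: k_def field_simps)
    also have "\<dots> \<le> (4 * N / r + 1) * norm x" by (simp add: distrib_right)
    finally show ?thesis .
  qed
  then show ?thesis using N r
    by (intro exI[of _ "1 / N"] conjI exI[of _ "4 * N / r + 1"]) auto
qed

lemma C0_bounded_on_compact:
  assumes S: "C0_semigroup (S :: real \<Rightarrow> 'a::banach \<Rightarrow> 'a)"
  shows "\<exists>K\<ge>0. \<forall>t\<in>{0..T}. \<forall>x. norm (S t x) \<le> K * norm x"
proof -
  obtain d K where d: "d > 0" and K: "K \<ge> 1" "\<And>t x. t \<in> {0..d} \<Longrightarrow> norm (S t x) \<le> K * norm x"
    using C0_bounded_near_zero[OF S] by blast
  have *: "\<forall>t\<in>{0..real n * d}. \<forall>x. norm (S t x) \<le> K ^ n * norm x" for n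
  proof (induction n)
    case 0 then show ?case using C0_zero[OF S] by auto
  next
    case (Suc n)
    have "norm (S t x) \<le> K ^ Suc n * norm x" if t: "t \<in> {0..real (Suc n) * d}" for t x
    proof (cases "t \<le> d")
      case True
      then have "norm (S t x) \<le> K * norm x" using t K by auto
      also have "\<dots> \<le> K ^ Suc n * norm x" using K(1) by (intro mult_right_mono) (auto simp: self_le_power)
      finally show ?thesis .
    next
      case False
      then have "S t x = S d (S (t - d) x)" using C0_add[OF S, of d "t - d" x] d by simp
      then have "norm (S t x) \<le> K * norm (S (t - d) x)" using K(2)[of d "S (t - d) x"] d by simp
      also have "\<dots> \<le> K * (K ^ n * norm x)"
        using Suc t False K(1) by (intro mult_left_mono) (auto simp: algebra_simps)
      finally show ?thesis by (simp add: mult.assoc)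
    qed
    then show ?case by blast
  qed
  obtain n where "real n > T / d" using reals_Archimedean2 by blast
  then have "T \<le> real n * d" using d by (simp add: field_simps)
  then have "\<forall>t\<in>{0..T}. \<forall>x. norm (S t x) \<le> K ^ n * norm x" using *[of n] by auto
  moreover have "K ^ n \<ge> 0" using K(1) by simp
  ultimately show ?thesis by blast
qed

lemma C0_continuous_on:
  assumes S: "C0_semigroup (S :: real \<Rightarrow> 'a::banach \<Rightarrow> 'a)"
  shows "continuous_on {0..} (\<lambda>t. S t x)"
proof -
  have "\<exists>d>0. \<forall>s\<in>{0..}. dist s t < d \<longrightarrow> dist (S s x) (S t x) \<le> e" if t: "t \<ge> 0" and e: "e > 0" for t e
  proof -
    obtain K where K: "K \<ge> 0" "\<And>s x. s \<in> {0..t + 1} \<Longrightarrow> norm (S s x) \<le> K * norm x"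
      using C0_bounded_on_compact[OF S, of "t + 1"] by blast
    have "((\<lambda>t. S t x) \<longlongrightarrow> x) (at_right 0)" using S by (simp add: C0_semigroup_def)
    then have "eventually (\<lambda>h. dist (S h x) x < e / (K + 1)) (at_right 0)"
      using e K by (intro tendstoD) auto
    then obtain b where b: "b > 0" "\<And>h. 0 < h \<Longrightarrow> h < b \<Longrightarrow> dist (S h x) x < e / (K + 1)"
      by (auto simp: eventually_at_right_field)
    have *: "dist (S (s + h) x) (S s x) \<le> e" if "s \<in> {0..t + 1}" "0 \<le> h" "h < b" for s h
    proof (cases "h = 0")
      case False
      interpret bounded_linear "S s" using C0_bounded_linear[OF S, of s] that by simp
      have "dist (S (s + h) x) (S s x) = norm (S s (S h x - x))"
        using C0_add[OF S, of s h x] that by (simp add: dist_norm diff)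
      also have "\<dots> \<le> K * norm (S h x - x)" using K that by simp
      also have "\<dots> \<le> K * (e / (K + 1))"
        using b(2)[of h] that False K(1) by (intro mult_left_mono) (auto simp: dist_norm)
      also have "\<dots> \<le> e" using K(1) e by (simp add: field_simps)
      finally show ?thesis .
    qed (use e in simp)
    show ?thesis
    proof (intro exI[of _ b] conjI ballI impI)
      fix s assume "s \<in> {0..}" "dist s t < b"
      then show "dist (S s x) (S t x) \<le> e"
        using *[of t "s - t"] *[of s "t - s"] t
        by (cases "t \<le> s") (auto simp: dist_real_def dist_commute)
    qed fact
  qed
  then show ?thesis unfolding continuous_on_iff
    by (meson atLeast_iff dense le_less_trans)
qed

text \<open>The derivative from the right comes from the semigroup law. The derivative from the
  left uses \<open>S t = S s \<circ> S (t - s)\<close> with \<open>s\<close> tending to \<open>t\<close>, where local boundedness controls the operators \<open>S s\<close>.\<close>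

lemma C0_generator_derivative:
  assumes S: "C0_semigroup (S :: real \<Rightarrow> 'a::banach \<Rightarrow> 'a)" and xy: "(x, y) \<in> generator S" and t: "t \<ge> 0"
  shows "((\<lambda>t. S t x) has_vector_derivative S t y) (at t within {0..})"
proof -
  obtain K where K: "K \<ge> 0" "\<And>s x. s \<in> {0..t + 1} \<Longrightarrow> norm (S s x) \<le> K * norm x"
    using C0_bounded_on_compact[OF S, of "t + 1"] by blast
  define q where "q h = (1 / h) *\<^sub>R (S h x - x)" for h
  have q: "(q \<longlongrightarrow> y) (at_right 0)" using xy by (simp add: generator_def q_def[abs_def])
  have key: "((\<lambda>s. (1 / (s - t)) *\<^sub>R (S s x - S t x)) \<longlongrightarrow> S t y) (at t within {0..})"
  proof (rule tendstoI)
    fix e :: real assume e: "e > 0"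
    have "eventually (\<lambda>h. dist (q h) y < e / (2 * (K + 1))) (at_right 0)"
      using e K by (intro tendstoD q) auto
    then obtain b where b: "b > 0" "\<And>h. 0 < h \<Longrightarrow> h < b \<Longrightarrow> dist (q h) y < e / (2 * (K + 1))"
      by (auto simp: eventually_at_right_field)
    have *: "dist (S r (q h)) (S r y) < e / 2" if "r \<in> {0..t + 1}" "0 < h" "h < b" for r h
    proof -
      interpret bounded_linear "S r" using C0_bounded_linear[OF S, of r] that by simp
      have "dist (S r (q h)) (S r y) = norm (S r (q h - y))" by (simp add: dist_norm diff)
      also have "\<dots> \<le> K * norm (q h - y)" using K that by simp
      also have "\<dots> \<le> K * (e / (2 * (K + 1)))"
        using b(2)[of h] that K(1) by (intro mult_left_mono) (auto simp: dist_norm)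
      also have "\<dots> < e / 2" using K(1) e by (simp add: field_simps)
      finally show ?thesis .
    qed
    have **: "(1 / h) *\<^sub>R (S (r + h) x - S r x) = S r (q h)" if "r \<ge> 0" "h > 0" for r h
    proof -
      interpret bounded_linear "S r" using C0_bounded_linear[OF S, of r] that by simp
      show ?thesis using C0_add[OF S, of r h x] that by (simp add: q_def diff scaleR)
    qed
    have "((\<lambda>s. S s y) \<longlongrightarrow> S t y) (at t within {0..})"
      using C0_continuous_on[OF S, of y] t by (simp add: continuous_on_def)
    then have "eventually (\<lambda>s. dist (S s y) (S t y) < e / 2) (at t within {0..})"
      using e by (intro tendstoD) auto
    moreover have "eventually (\<lambda>s. dist s t < b) (at t within {0..})"
      using b(1) by (auto simp: eventually_at)
    moreover have "eventually (\<lambda>s. s \<in> {0..} \<and> s \<noteq> t) (at t within {0..})"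
      by (auto simp: eventually_at_filter)
    ultimately show "eventually (\<lambda>s. dist ((1 / (s - t)) *\<^sub>R (S s x - S t x)) (S t y) < e) (at t within {0..})"
    proof eventually_elim
      case (elim s)
      show ?case
      proof (cases "t < s")
        case True
        then have "(1 / (s - t)) *\<^sub>R (S s x - S t x) = S t (q (s - t))"
          using **[of t "s - t"] t by simp
        then show ?thesis using *[of t "s - t"] True elim t e by (auto simp: dist_real_def)
      next
        case False
        then have "(1 / (t - s)) *\<^sub>R (S t x - S s x) = S s (q (t - s))"
          using **[of s "t - s"] elim by simp
        moreover have "(1 / (s - t)) *\<^sub>R (S s x - S t x) = (1 / (t - s)) *\<^sub>R (S t x - S s x)"
        proof -
          have "1 / (s - t) = - (1 / (t - s))" by (metis minus_diff_eq minus_divide_right)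
          then show ?thesis by (simp only:) (simp add: scaleR_diff_right)
        qed
        ultimately have "dist ((1 / (s - t)) *\<^sub>R (S s x - S t x)) (S s y) < e / 2"
          using *[of s "t - s"] False elim t by (auto simp: dist_real_def)
        moreover have "dist ((1 / (s - t)) *\<^sub>R (S s x - S t x)) (S t y)
            \<le> dist ((1 / (s - t)) *\<^sub>R (S s x - S t x)) (S s y) + dist (S s y) (S t y)"
          by (rule dist_triangle)
        ultimately show ?thesis using elim(1) by linarith
      qed
    qed
  qed
  have "((\<lambda>s. (1 / (s - t)) *\<^sub>R (S s x - S t x) - S t y) \<longlongrightarrow> 0) (at t within {0..})"
    using key by (simp add: LIM_zero_iff)
  then have "((\<lambda>s. norm ((1 / (s - t)) *\<^sub>R (S s x - S t x) - S t y)) \<longlongrightarrow> 0) (at t within {0..})"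
    by (rule tendsto_norm_zero)
  moreover have "norm ((1 / (s - t)) *\<^sub>R (S s x - S t x) - S t y) =
      norm ((S s x - S t x) - (s - t) *\<^sub>R S t y) / norm (s - t)" if "s \<noteq> t" for s
  proof -
    have "(1 / (s - t)) *\<^sub>R (S s x - S t x) - S t y =
        (1 / (s - t)) *\<^sub>R ((S s x - S t x) - (s - t) *\<^sub>R S t y)"
      using that by (simp add: scaleR_diff_right)
    then show ?thesis using that by (simp add: divide_inverse mult.commute)
  qed
  then have "eventually (\<lambda>s. norm ((1 / (s - t)) *\<^sub>R (S s x - S t x) - S t y) =
      norm ((S s x - S t x) - (s - t) *\<^sub>R S t y) / norm (s - t)) (at t within {0..})"
    by (auto simp: eventually_at_filter)
  ultimately have "((\<lambda>s. norm ((S s x - S t x) - (s - t) *\<^sub>R S t y) / norm (s - t)) \<longlongrightarrow> 0)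
      (at t within {0..})"
    using tendsto_cong by fast
  then show ?thesis
    by (simp add: has_vector_derivative_def has_derivative_iff_norm bounded_linear_scaleR_left)
qed

section \<open>Integrals over bounded intervals\<close>

lemma set_integrable_continuous_Ioo:
  fixes f :: "real \<Rightarrow> 'a::{banach, second_countable_topology}"
  assumes "continuous_on {a..b} f"
  shows "set_integrable lborel {a<..<b} f"
  by (rule set_integrable_subset[OF borel_integrable_atLeastAtMost'[OF assms]]) auto

lemma set_lebesgue_integral_Icc_eq_Ioo:
  fixes f :: "real \<Rightarrow> 'a::{banach, second_countable_topology}"
  shows "(LINT x:{a..b}|lborel. f x) = (LINT x:{a<..<b}|lborel. f x)"
  by (rule set_integral_discrete_difference[of "{a, b}"]) auto

lemma set_borel_measurable_norm:
  fixes f :: "real \<Rightarrow> 'a::real_normed_vector"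
  assumes "set_borel_measurable lborel A f"
  shows "set_borel_measurable lborel A (\<lambda>s. norm (f s))"
proof -
  have "(\<lambda>s. norm (indicator A s *\<^sub>R f s)) \<in> borel_measurable lborel"
    using assms unfolding set_borel_measurable_def by (rule measurable_compose) simp
  moreover have "(\<lambda>s. norm (indicator A s *\<^sub>R f s)) = (\<lambda>s. indicator A s *\<^sub>R norm (f s))"
    by (auto simp: indicator_def)
  ultimately show ?thesis by (simp add: set_borel_measurable_def)
qed

lemma set_lebesgue_integral_scaleR_left:
  fixes q :: "'a \<Rightarrow> real" and v :: "'b::{banach, second_countable_topology}"
  assumes "set_integrable M A q"
  shows "(LINT s:A|M. q s *\<^sub>R v) = (LINT s:A|M. q s) *\<^sub>R v"
proof -
  have "integrable M (\<lambda>s. indicator A s *\<^sub>R q s)" using assms by (simp add: set_integrable_def)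
  then have "(LINT s|M. (indicator A s *\<^sub>R q s) *\<^sub>R v) = (LINT s|M. indicator A s *\<^sub>R q s) *\<^sub>R v"
    by (intro integral_scaleR_left)
  then show ?thesis by (simp add: set_lebesgue_integral_def)
qed

lemma set_integrable_continuous_mult:
  fixes g h :: "real \<Rightarrow> real"
  assumes g: "set_integrable lborel {a<..<b} g" and h: "continuous_on {a..b} h"
  shows "set_integrable lborel {a<..<b} (\<lambda>s. h s * g s)"
proof -
  have "bounded (h ` {a..b})"
    using h by (intro compact_imp_bounded compact_continuous_image) auto
  then obtain M where "\<forall>x\<in>h ` {a..b}. norm x \<le> M" unfolding bounded_iff by blast
  then have M: "\<bar>h s\<bar> \<le> M" if "s \<in> {a..b}" for s using that by auto
  have gm: "(\<lambda>s. indicator {a<..<b} s * g s) \<in> borel_measurable lborel"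
    using borel_measurable_integrable[OF g[unfolded set_integrable_def]] by simp
  have hm: "(\<lambda>s. indicator {a<..<b} s * h s) \<in> borel_measurable lborel"
    using borel_measurable_integrable[OF set_integrable_continuous_Ioo[OF h, unfolded set_integrable_def]]
    by simp
  have eq: "indicator {a<..<b} s *\<^sub>R (h s * g s) = (indicator {a<..<b} s * h s) * (indicator {a<..<b} s * g s)" for s
    by (simp add: indicator_def)
  show ?thesis
  proof (rule set_integrable_bound[OF set_integrable_mult_right[OF g, of M]])
    show "set_borel_measurable lborel {a<..<b} (\<lambda>s. h s * g s)"
      unfolding set_borel_measurable_def eq by (rule borel_measurable_times[OF hm gm])
    have "\<bar>h s\<bar> * \<bar>g s\<bar> \<le> \<bar>M\<bar> * \<bar>g s\<bar>" if "s \<in> {a<..<b}" for s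
    proof (rule mult_right_mono)
      have "\<bar>h s\<bar> \<le> M" using that by (intro M) simp
      then show "\<bar>h s\<bar> \<le> \<bar>M\<bar>" by simp
    qed simp
    then show "AE s in lborel. s \<in> {a<..<b} \<longrightarrow> norm (h s * g s) \<le> norm (M * g s)"
      by (simp add: abs_mult)
  qed
qed

lemma set_borel_measurable_square:
  fixes f :: "real \<Rightarrow> real"
  assumes "set_borel_measurable lborel A f"
  shows "set_borel_measurable lborel A (\<lambda>s. (f s)\<^sup>2)"
proof -
  have "(\<lambda>s. (indicator A s *\<^sub>R f s)\<^sup>2) \<in> borel_measurable lborel"
    using assms unfolding set_borel_measurable_def by (rule borel_measurable_power)
  moreover have "(\<lambda>s. (indicator A s *\<^sub>R f s)\<^sup>2) = (\<lambda>s. indicator A s *\<^sub>R (f s)\<^sup>2)"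
    by (auto simp: indicator_def)
  ultimately show ?thesis by (simp add: set_borel_measurable_def)
qed

lemma set_integrable_imp_measurable: "set_integrable M A f \<Longrightarrow> set_borel_measurable M A f"
  by (simp add: set_integrable_def set_borel_measurable_def borel_measurable_integrable)

lemma L2_time_integrable:
  assumes "\<psi> \<in> L2_time T"
  shows "set_integrable lborel {0<..<T} \<psi>"
proof -
  have 1: "set_integrable lborel {0<..<T} (\<lambda>s. 1 + (norm (\<psi> s))\<^sup>2)"
    using assms by (intro set_integral_add(1) set_integrable_continuous_Ioo[where f = "\<lambda>_. 1"] continuous_on_const)
      (simp add: L2_time_def)
  show ?thesis
  proof (rule set_integrable_bound[OF 1])
    show "set_borel_measurable lborel {0<..<T} \<psi>" using assms by (simp add: L2_time_def)
    have "norm (\<psi> s) \<le> 1 + (norm (\<psi> s))\<^sup>2" for s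
    proof -
      have "0 \<le> (norm (\<psi> s) - 1)\<^sup>2 + (norm (\<psi> s))\<^sup>2 + 1" by simp
      then show ?thesis by (simp add: power2_diff)
    qed
    then show "AE s in lborel. s \<in> {0<..<T} \<longrightarrow> norm (\<psi> s) \<le> norm (1 + (norm (\<psi> s))\<^sup>2)" by simp
  qed
qed

lemma FTC_Ioo:
  fixes F f :: "real \<Rightarrow> real"
  assumes "a \<le> b" "\<And>x. x \<in> {a..b} \<Longrightarrow> (F has_real_derivative f x) (at x within {a..b})"
    and "continuous_on {a..b} f"
  shows "(LINT x:{a<..<b}|lborel. f x) = F b - F a"
  using integral_FTC_atLeastAtMost[of a b F f] assms
  by (simp add: set_lebesgue_integral_Icc_eq_Ioo[symmetric] has_real_derivative_iff_has_vector_derivative)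
     (simp add: set_lebesgue_integral_def)

text \<open>Since \<open>G\<close> is only integrable, its primitive \<open>V\<close> need not be differentiable at every point.
  The formula is Fubini's theorem for \<open>G r * f' s\<close> on the triangle \<open>r < s\<close>.\<close>

lemma integration_by_parts_primitive:
  fixes G f f' :: "real \<Rightarrow> real"
  assumes t: "0 \<le> t" and G: "set_integrable lborel {0<..<t} G"
    and f: "\<And>s. s \<in> {0..t} \<Longrightarrow> (f has_real_derivative f' s) (at s within {0..t})"
    and f': "continuous_on {0..t} f'"
    and V: "\<And>s. s \<in> {0..t} \<Longrightarrow> V s = (LINT r:{0<..<s}|lborel. G r)"
  shows "(LINT r:{0<..<t}|lborel. G r * f r) = V t * f t - (LINT s:{0<..<t}|lborel. V s * f' s)"
proof -
  define g where "g r = indicator {0<..<t} r * G r" for r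
  define p where "p s = indicator {0<..<t} s * f' s" for s
  have g[measurable]: "g \<in> borel_measurable borel" and gi: "integrable lborel g"
    using G by (auto simp: set_integrable_def g_def[abs_def])
  have pi: "integrable lborel p"
    using set_integrable_continuous_Ioo[OF f'] by (simp add: set_integrable_def p_def[abs_def])
  then have p[measurable]: "p \<in> borel_measurable borel" by auto
  obtain M where M: "\<And>s. s \<in> {0..t} \<Longrightarrow> \<bar>f' s\<bar> \<le> M"
    using compact_continuous_image[OF f'] compact_imp_bounded bounded_iff
    by (metis (no_types, opaque_lifting) compact_Icc image_eqI real_norm_def)
  define h where "h r s = indicator {0<..} (s - r) * g r * p s" for r s :: real
  have hm: "(\<lambda>(r, s). h r s) \<in> borel_measurable (lborel \<Otimes>\<^sub>M lborel)" unfolding h_def by measurable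
  have hb: "\<bar>h r s\<bar> \<le> \<bar>g r\<bar> * \<bar>p s\<bar>" for r s by (auto simp: h_def indicator_def abs_mult)
  have int_h: "integrable (lborel \<Otimes>\<^sub>M lborel) (\<lambda>(r, s). h r s)"
  proof (rule lborel_pair.Fubini_integrable[OF hm])
    have i: "integrable lborel (\<lambda>s. h r s)" for r
      by (rule Bochner_Integration.integrable_bound[OF integrable_mult_right[OF integrable_abs[OF pi], of "\<bar>g r\<bar>"]])
         (use hb in \<open>auto simp: h_def abs_mult\<close>)
    show "AE r in lborel. integrable lborel (\<lambda>y. case (r, y) of (r, s) \<Rightarrow> h r s)" using i by simp
    have "(LINT s|lborel. norm (h r s)) \<le> \<bar>g r\<bar> * (LINT s|lborel. \<bar>p s\<bar>)" for r
    proof -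
      have "(LINT s|lborel. norm (h r s)) \<le> (LINT s|lborel. \<bar>g r\<bar> * \<bar>p s\<bar>)"
        using hb by (intro integral_mono i integrable_norm integrable_mult_right integrable_abs pi) auto
      then show ?thesis by simp
    qed
    moreover have "(\<lambda>r. LINT s|lborel. norm (h r s)) \<in> borel_measurable lborel"
      using hm by measurable
    moreover have "0 \<le> (LINT s|lborel. norm (h r s))" for r
      by (rule Bochner_Integration.integral_nonneg) simp
    ultimately have "integrable lborel (\<lambda>r. LINT s|lborel. norm (h r s))"
      by (intro Bochner_Integration.integrable_bound[OF
            integrable_mult_left[OF integrable_abs[OF gi], of "LINT s|lborel. \<bar>p s\<bar>"]] AE_I2)
         (simp_all add: abs_mult)
    then show "integrable lborel (\<lambda>x. LINT y|lborel. norm (case (x, y) of (r, s) \<Rightarrow> h r s))" by simp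
  qed
  have F1: "(LINT s|lborel. h r s) = g r * (f t - f r)" for r
  proof (cases "r \<in> {0<..<t}")
    case True
    then have "h r s = g r * (indicator {r<..<t} s * f' s)" for s
      by (auto simp: h_def p_def indicator_def)
    then have "(LINT s|lborel. h r s) = g r * (LINT s:{r<..<t}|lborel. f' s)"
      by (simp add: set_lebesgue_integral_def)
    also have "(LINT s:{r<..<t}|lborel. f' s) = f t - f r"
      using True f' by (intro FTC_Ioo)
        (auto intro: continuous_on_subset intro!: has_field_derivative_subset[OF f])
    finally show ?thesis .
  next
    case False
    then have "g r = 0" by (simp add: g_def)
    then show ?thesis by (simp add: h_def)
  qed
  have F2: "(LINT r|lborel. h r s) = p s * V s" for s
  proof (cases "s \<in> {0<..<t}")
    case True
    then have "h r s = p s * (indicator {0<..<s} r * G r)" for r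
      by (auto simp: h_def g_def indicator_def)
    then have "(LINT r|lborel. h r s) = (LINT r|lborel. p s * (indicator {0<..<s} r * G r))"
      by simp
    also have "\<dots> = p s * V s" using True V[of s] by (simp add: set_lebesgue_integral_def)
    finally show ?thesis .
  next
    case False
    then have "p s = 0" by (simp add: p_def)
    then show ?thesis by (simp add: h_def)
  qed
  have fub: "(LINT s|lborel. LINT r|lborel. h r s) = (LINT r|lborel. LINT s|lborel. h r s)"
    by (rule lborel_pair.Fubini_integral[OF int_h])
  have cf: "continuous_on {0..t} f"
    using f by (meson DERIV_continuous continuous_on_eq_continuous_within)
  have gf: "integrable lborel (\<lambda>r. g r * f r)"
  proof -
    obtain M where M: "\<And>s. s \<in> {0..t} \<Longrightarrow> \<bar>f s\<bar> \<le> M"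
      using compact_continuous_image[OF cf] compact_imp_bounded bounded_iff
      by (metis (no_types, opaque_lifting) compact_Icc image_eqI real_norm_def)
    have "(\<lambda>r. g r * f r) = (\<lambda>r. g r * (indicator {0<..<t} r * f r))"
      by (auto simp: g_def indicator_def)
    moreover have "(\<lambda>r. indicator {0<..<t} r * f r) \<in> borel_measurable borel"
      using set_integrable_continuous_Ioo[OF cf] by (simp add: set_integrable_def)
    ultimately have "(\<lambda>r. g r * f r) \<in> borel_measurable lborel" by simp
    moreover have "norm (g r * f r) \<le> norm (\<bar>g r\<bar> * M)" for r
      using M[of r] by (cases "r \<in> {0<..<t}") (auto simp: g_def abs_mult intro!: mult_mono)
    ultimately show ?thesis
      by (intro Bochner_Integration.integrable_bound[OF integrable_mult_left[OF integrable_abs[OF gi], of M]]) auto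
  qed
  have "(LINT r|lborel. g r * (f t - f r)) = (LINT s|lborel. p s * V s)"
    using fub by (simp add: F1 F2)
  moreover have "(LINT r|lborel. g r * (f t - f r)) = (LINT r|lborel. g r) * f t - (LINT r|lborel. g r * f r)"
    using gi gf by (simp add: right_diff_distrib)
  moreover have "(LINT r|lborel. g r) = V t"
    using V[of t] t by (simp add: set_lebesgue_integral_def g_def)
  ultimately show ?thesis
    by (simp add: set_lebesgue_integral_def g_def p_def mult.assoc mult.commute mult.left_commute)
qed

lemma continuous_on_primitive:
  fixes g :: "real \<Rightarrow> real"
  assumes g: "set_integrable lborel {0<..<T} g"
  shows "continuous_on {0..T} (\<lambda>t. LINT s:{0<..<t}|lborel. g s)"
proof -
  have g': "set_integrable lborel {0..T} g"
    by (subst set_integrable_discrete_difference[of "{0, T}" "{0..T}" "{0<..<T}"]) (use g in auto)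
  have "(LINT s:{0<..<t}|lborel. g s) = integral {0..t} g" if "t \<in> {0..T}" for t
    using set_borel_integral_eq_integral(2)[OF set_integrable_subset[OF g', of "{0..t}"]] that
    by (simp add: set_lebesgue_integral_Icc_eq_Ioo)
  moreover have "continuous_on {0..T} (\<lambda>t. integral {0..t} g)"
    by (rule indefinite_integral_continuous_1[OF set_borel_integral_eq_integral(1)[OF g']])
  ultimately show ?thesis by (metis (no_types, lifting) continuous_on_eq)
qed

text \<open>The variation of constants formula for \<open>D' = m - a * D\<close> gives the integrated equation:
  integrate \<open>exp (a * s) * m s\<close>, whose primitive is \<open>exp (a * s) * D s\<close>, by parts against
  \<open>exp (- a * s)\<close>.\<close>

lemma duhamel_imp_integral_equation:
  fixes m :: "real \<Rightarrow> real"
  assumes m: "set_integrable lborel {0<..<T} m"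
    and D: "\<And>t. t \<in> {0..T} \<Longrightarrow> D t = (LINT s:{0<..<t}|lborel. exp (- a * (t - s)) * m s)"
    and t: "t \<in> {0..T}"
  shows "D t = (LINT s:{0<..<t}|lborel. m s) - a * (LINT s:{0<..<t}|lborel. D s)"
    and "continuous_on {0..T} D"
proof -
  define G where "G s = exp (a * s) * m s" for s
  have *: "(LINT r:{0<..<s}|lborel. G r) = exp (a * s) * D s" if "s \<in> {0..T}" for s
  proof -
    have "G r = exp (a * s) * (exp (- a * (s - r)) * m r)" for r
      by (simp add: G_def mult.assoc[symmetric] exp_add[symmetric] algebra_simps)
    then show ?thesis using D[of s] that by simp
  qed
  have G: "set_integrable lborel {0<..<T} G"
  proof -
    have mi: "integrable lborel (\<lambda>r. indicator {0<..<T} r * m r)"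
      using m by (simp add: set_integrable_def)
    have "(\<lambda>r. indicator {0<..<T} r * G r) = (\<lambda>r. exp (a * r) * (indicator {0<..<T} r * m r))"
      by (auto simp: G_def)
    moreover have "integrable lborel (\<lambda>r. exp (a * r) * (indicator {0<..<T} r * m r))"
    proof (rule Bochner_Integration.integrable_bound)
      show "integrable lborel (\<lambda>r. exp (\<bar>a\<bar> * T) * (indicator {0<..<T} r * m r))"
        using mi by (rule integrable_mult_right)
      show "(\<lambda>r. exp (a * r) * (indicator {0<..<T} r * m r)) \<in> borel_measurable lborel"
        by (rule borel_measurable_times[OF _ borel_measurable_integrable[OF mi]]) simp
      have "norm (exp (a * r) * (indicator {0<..<T} r * m r)) \<le> norm (exp (\<bar>a\<bar> * T) * (indicator {0<..<T} r * m r))" for r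
      proof (cases "r \<in> {0<..<T}")
        case True
        then have "a * r \<le> \<bar>a\<bar> * T" by (intro mult_mono) auto
        then show ?thesis by (simp add: abs_mult mult_right_mono)
      qed auto
      then show "AE r in lborel. norm (exp (a * r) * (indicator {0<..<T} r * m r)) \<le> norm (exp (\<bar>a\<bar> * T) * (indicator {0<..<T} r * m r))"
        by (intro AE_I2)
    qed
    ultimately show ?thesis unfolding set_integrable_def real_scaleR_def by (simp only:)
  qed
  show "continuous_on {0..T} D"
  proof -
    have "D s = exp (- a * s) * (LINT r:{0<..<s}|lborel. G r)" if "s \<in> {0..T}" for s
      using *[OF that] by (simp add: mult.assoc[symmetric] exp_add[symmetric])
    moreover have "continuous_on {0..T} (\<lambda>s. exp (- a * s) * (LINT r:{0<..<s}|lborel. G r))"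
      by (intro continuous_intros continuous_on_primitive G)
    ultimately show ?thesis by (metis (no_types, lifting) continuous_on_eq)
  qed
  have Gt: "set_integrable lborel {0<..<t} G" using t by (intro set_integrable_subset[OF G]) auto
  have "(LINT r:{0<..<t}|lborel. G r * exp (- a * r)) =
      exp (a * t) * D t * exp (- a * t) - (LINT s:{0<..<t}|lborel. exp (a * s) * D s * (- a * exp (- a * s)))"
    using t Gt *
    by (intro integration_by_parts_primitive[where V = "\<lambda>s. exp (a * s) * D s"])
       (auto intro!: derivative_eq_intros continuous_intros)
  moreover have "exp (a * s) * D s * (- a * exp (- a * s)) = - a * D s" for s
    by (simp add: mult.assoc mult.left_commute exp_minus)
  moreover have "G r * exp (- a * r) = m r" for r by (simp add: G_def exp_minus)
  moreover have "exp (a * t) * D t * exp (- a * t) = D t" by (simp add: exp_minus)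
  ultimately have "(LINT s:{0<..<t}|lborel. m s) = D t - (LINT s:{0<..<t}|lborel. - a * D s)"
    by (simp only:)
  then show "D t = (LINT s:{0<..<t}|lborel. m s) - a * (LINT s:{0<..<t}|lborel. D s)"
    unfolding set_integral_mult_right by simp
qed

text \<open>The Cauchy--Schwarz inequality, since the square of the exponential has integral at most
  \<open>1 / (2 * a)\<close>. When \<open>a\<close> is an eigenvalue, the factor \<open>1 / a\<close> is the derivative that a convolution
  with the heat semigroup gains. When \<open>a = 1 / \<mu>\<close>, it makes the lag small.\<close>

lemma exponential_convolution_square_bound:
  fixes m :: "real \<Rightarrow> real"
  assumes a: "a > 0" and t: "0 \<le> t" and m: "set_borel_measurable lborel {0<..<t} m"
    and m2: "set_integrable lborel {0<..<t} (\<lambda>s. (m s)\<^sup>2)"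
  shows "(LINT s:{0<..<t}|lborel. exp (- a * (t - s)) * m s)\<^sup>2 \<le> (LINT s:{0<..<t}|lborel. (m s)\<^sup>2) / (2 * a)"
proof -
  define X where "X = (LINT s:{0<..<t}|lborel. exp (- a * (t - s)) * m s)"
  define Y where "Y = (LINT s:{0<..<t}|lborel. (m s)\<^sup>2)"
  have ei: "set_integrable lborel {0<..<t} (\<lambda>s. exp (- 2 * a * (t - s)))"
    by (intro set_integrable_continuous_Ioo continuous_intros)
  have "(LINT s:{0<..<t}|lborel. exp (- 2 * a * (t - s))) = exp (- 2 * a * (t - t)) / (2 * a) - exp (- 2 * a * (t - 0)) / (2 * a)"
    using a t by (intro FTC_Ioo) (auto intro!: derivative_eq_intros continuous_intros simp: field_simps)
  also have "\<dots> \<le> 1 / (2 * a)" using a by simp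
  finally have E: "(LINT s:{0<..<t}|lborel. exp (- 2 * a * (t - s))) \<le> 1 / (2 * a)" .
  have sq: "(exp (- a * (t - s)))\<^sup>2 = exp (- 2 * a * (t - s))" for s
    by (simp add: power2_eq_square exp_add[symmetric])
  have young: "2 * \<bar>exp (- a * (t - s)) * m s\<bar> \<le> k * exp (- 2 * a * (t - s)) + (m s)\<^sup>2 / k" if "k > 0" for k s
  proof -
    have "0 \<le> (k * exp (- a * (t - s)) - \<bar>m s\<bar>)\<^sup>2" by simp
    then have "2 * k * \<bar>exp (- a * (t - s)) * m s\<bar> \<le> k\<^sup>2 * exp (- 2 * a * (t - s)) + (m s)\<^sup>2"
      unfolding power2_diff power_mult_distrib sq abs_mult by (simp add: mult.assoc)
    then have "(2 * k * \<bar>exp (- a * (t - s)) * m s\<bar>) / k \<le> (k\<^sup>2 * exp (- 2 * a * (t - s)) + (m s)\<^sup>2) / k"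
      using that by (intro divide_right_mono) auto
    then show ?thesis using that by (simp add: add_divide_distrib power2_eq_square)
  qed
  have i: "set_integrable lborel {0<..<t} (\<lambda>s. exp (- a * (t - s)) * m s)"
  proof (rule set_integrable_bound[of _ _ "\<lambda>s. exp (- 2 * a * (t - s)) + (m s)\<^sup>2"])
    show "set_integrable lborel {0<..<t} (\<lambda>s. exp (- 2 * a * (t - s)) + (m s)\<^sup>2)"
      using ei m2 by (rule set_integral_add)
    have "(\<lambda>x. exp (- a * (t - x)) * (indicator {0<..<t} x *\<^sub>R m x)) \<in> borel_measurable lborel"
      using m by (intro borel_measurable_times) (auto simp: set_borel_measurable_def)
    then show "set_borel_measurable lborel {0<..<t} (\<lambda>s. exp (- a * (t - s)) * m s)"
      by (simp add: set_borel_measurable_def mult.left_commute)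
    have "norm (exp (- a * (t - s)) * m s) \<le> norm (exp (- 2 * a * (t - s)) + (m s)\<^sup>2)" for s
      using young[of 1 s] by simp
    then show "AE x in lborel. x \<in> {0<..<t} \<longrightarrow> norm (exp (- a * (t - x)) * m x) \<le> norm (exp (- 2 * a * (t - x)) + (m x)\<^sup>2)"
      by simp
  qed
  have "2 * \<bar>X\<bar> \<le> k / (2 * a) + Y / k" if k: "k > 0" for k
  proof -
    have "2 * \<bar>X\<bar> \<le> 2 * (LINT s:{0<..<t}|lborel. \<bar>exp (- a * (t - s)) * m s\<bar>)"
      unfolding X_def using integral_abs_bound[of lborel "\<lambda>s. indicator {0<..<t} s * (exp (- a * (t - s)) * m s)"]
      by (simp add: set_lebesgue_integral_def abs_mult)
    also have "\<dots> = (LINT s:{0<..<t}|lborel. 2 * \<bar>exp (- a * (t - s)) * m s\<bar>)" by simp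
    also have "\<dots> \<le> (LINT s:{0<..<t}|lborel. k * exp (- 2 * a * (t - s)) + (m s)\<^sup>2 / k)"
      using i ei m2 young[OF k]
      by (intro set_integral_mono set_integrable_mult_right set_integrable_abs set_integral_add set_integrable_divide) auto
    also have "\<dots> = k * (LINT s:{0<..<t}|lborel. exp (- 2 * a * (t - s))) + Y / k"
      using ei m2 by (subst set_integral_add) (auto simp: Y_def)
    also have "\<dots> \<le> k * (1 / (2 * a)) + Y / k" using E k by (intro add_mono mult_left_mono) auto
    finally show ?thesis by simp
  qed
  note XY = this
  have Y: "Y \<ge> 0" unfolding Y_def set_lebesgue_integral_def
    by (intro Bochner_Integration.integral_nonneg) auto
  have "X\<^sup>2 \<le> Y / (2 * a)"
  proof (cases "X = 0")
    case True
    then show ?thesis using Y a by simp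
  next
    case False
    \<comment> \<open>the parameter for which the first term on the right is half of the left-hand side\<close>
    then have "2 * \<bar>X\<bar> \<le> \<bar>X\<bar> + Y / (2 * a * \<bar>X\<bar>)" using XY[of "2 * a * \<bar>X\<bar>"] a by simp
    then have "\<bar>X\<bar> \<le> Y / (2 * a * \<bar>X\<bar>)" by simp
    then have "\<bar>X\<bar> * (2 * a * \<bar>X\<bar>) \<le> Y" using False a by (subst (asm) pos_le_divide_eq) auto
    moreover have "\<bar>X\<bar> * (2 * a * \<bar>X\<bar>) = X\<^sup>2 * (2 * a)"
      by (simp add: power2_eq_square)
    ultimately show ?thesis using a by (subst pos_le_divide_eq) auto
  qed
  then show ?thesis by (simp add: X_def Y_def)
qed

section \<open>Elementary inequalities and series with bounded partial sums\<close>

lemma sum3_square_le: "(p + q + r :: real)\<^sup>2 \<le> 3 * (p\<^sup>2 + q\<^sup>2 + r\<^sup>2)"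
proof -
  have "0 \<le> (p - q)\<^sup>2 + (q - r)\<^sup>2 + (p - r)\<^sup>2" by simp
  then show ?thesis by (simp add: power2_eq_square algebra_simps)
qed

lemma diff_square_le: "(p - q :: real)\<^sup>2 \<le> 2 * p\<^sup>2 + 2 * q\<^sup>2"
proof -
  have "0 \<le> (p + q)\<^sup>2" by simp
  then show ?thesis by (simp add: power2_eq_square algebra_simps)
qed

lemma weighted_add_square_le:
  fixes p q \<theta> :: real
  assumes "\<theta> > 0"
  shows "(p + q)\<^sup>2 \<le> (1 + \<theta>) * p\<^sup>2 + (1 + 1 / \<theta>) * q\<^sup>2"
proof -
  have "0 \<le> (\<theta> * p - q)\<^sup>2 / \<theta>" using assms by simp
  also have "(\<theta> * p - q)\<^sup>2 / \<theta> = \<theta> * p\<^sup>2 - 2 * p * q + q\<^sup>2 / \<theta>"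
    using assms by (simp add: field_simps power2_eq_square)
  finally show ?thesis by (simp add: power2_eq_square algebra_simps)
qed

lemma sum4_square_le: "(p + q + r + v :: real)\<^sup>2 \<le> 4 * (p\<^sup>2 + q\<^sup>2 + r\<^sup>2 + v\<^sup>2)"
proof -
  have "0 \<le> (p - q)\<^sup>2 + (p - r)\<^sup>2 + (p - v)\<^sup>2 + (q - r)\<^sup>2 + (q - v)\<^sup>2 + (r - v)\<^sup>2" by simp
  then show ?thesis by (simp add: power2_eq_square algebra_simps)
qed

lemma add_square_le: "(p + q :: real)\<^sup>2 \<le> 2 * p\<^sup>2 + 2 * q\<^sup>2"
  using diff_square_le[of p "- q"] by simp

text \<open>Series of nonnegative numbers with a bound for all partial sums. Statements of this form can be
  added, scaled and compared without a separate treatment of summability.\<close>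

definition bounded_sums :: "(nat \<Rightarrow> real) \<Rightarrow> real \<Rightarrow> bool" where
  "bounded_sums a C \<longleftrightarrow> (\<forall>k. 0 \<le> a k) \<and> (\<forall>m. (\<Sum>k<m. a k) \<le> C)"

lemma bounded_sumsI: "(\<And>k. 0 \<le> a k) \<Longrightarrow> (\<And>m. (\<Sum>k<m. a k) \<le> C) \<Longrightarrow> bounded_sums a C"
  by (simp add: bounded_sums_def)

lemma bounded_sums_bound: "bounded_sums a C \<Longrightarrow> (\<Sum>k<m. a k) \<le> C"
  by (simp add: bounded_sums_def)

lemma bounded_sums_bound_nonneg: "bounded_sums a C \<Longrightarrow> 0 \<le> C"
  using bounded_sums_bound[of a C 0] by simp

lemma bounded_sums_add: "bounded_sums a C \<Longrightarrow> bounded_sums b D \<Longrightarrow> bounded_sums (\<lambda>k. a k + b k) (C + D)"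
  by (auto simp: bounded_sums_def sum.distrib intro: add_mono)

lemma bounded_sums_mult: "0 \<le> r \<Longrightarrow> bounded_sums a C \<Longrightarrow> bounded_sums (\<lambda>k. r * a k) (r * C)"
  by (auto simp: bounded_sums_def sum_distrib_left[symmetric] intro: mult_left_mono)

lemma bounded_sums_mono:
  "bounded_sums b C \<Longrightarrow> (\<And>k. 0 \<le> a k) \<Longrightarrow> (\<And>k. a k \<le> b k) \<Longrightarrow> C \<le> D \<Longrightarrow> bounded_sums a D"
  unfolding bounded_sums_def by (meson order_trans sum_mono)

lemma bounded_sums_summable: "bounded_sums a C \<Longrightarrow> summable a"
  by (rule bounded_imp_summable[where B = C])
     (auto simp: bounded_sums_def lessThan_Suc_atMost[symmetric] simp del: sum.lessThan_Suc)

lemma bounded_sums_suminf: "bounded_sums a C \<Longrightarrow> suminf a \<le> C"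
  using bounded_sums_summable[of a C] by (auto simp: bounded_sums_def intro: suminf_le_const)

lemma bounded_sums_finite:
  assumes "\<And>k. 0 \<le> a k" "\<And>k. k < n \<Longrightarrow> a k \<le> b k" "\<And>k. n \<le> k \<Longrightarrow> a k = 0"
  shows "bounded_sums a (\<Sum>k<n. b k)"
proof (rule bounded_sumsI)
  fix m
  have "(\<Sum>k<m. a k) \<le> (\<Sum>k\<in>{..<m} \<union> {..<n}. a k)" using assms(1) by (intro sum_mono2) auto
  also have "\<dots> = (\<Sum>k<n. a k)" using assms(3) by (intro sum.mono_neutral_right) auto
  also have "\<dots> \<le> (\<Sum>k<n. b k)" using assms(2) by (intro sum_mono) auto
  finally show "(\<Sum>k<m. a k) \<le> (\<Sum>k<n. b k)" .
qed (rule assms)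

lemma bounded_sums_tail:
  assumes f: "summable f" and nn: "\<And>k. 0 \<le> f k"
  shows "bounded_sums (\<lambda>k. if k < n then 0 else f k) (suminf f - (\<Sum>k<n. f k))"
proof (rule bounded_sumsI)
  fix m
  have "(\<Sum>k<m. if k < n then 0 else f k) = (\<Sum>k\<in>{..<m} - {..<n}. f k)"
    by (intro sum.mono_neutral_cong_right) auto
  moreover have "(\<Sum>k\<in>{..<m} - {..<n}. f k) + (\<Sum>k<n. f k) = (\<Sum>k\<in>{..<m} \<union> {..<n}. f k)"
    by (subst sum.union_disjoint[symmetric]) (auto intro: sum.cong)
  moreover have "(\<Sum>k\<in>{..<m} \<union> {..<n}. f k) \<le> suminf f"
    by (intro sum_le_suminf f nn) auto
  ultimately show "(\<Sum>k<m. if k < n then 0 else f k) \<le> suminf f - (\<Sum>k<n. f k)" by linarith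
qed (simp add: nn)

lemma integral_of_series_le:
  fixes a :: "nat \<Rightarrow> real \<Rightarrow> real"
  assumes cont: "\<And>k. continuous_on {0..T} (a k)" and nn: "\<And>k s. s \<in> {0..T} \<Longrightarrow> 0 \<le> a k s"
    and dom: "\<And>k s. s \<in> {0..T} \<Longrightarrow> a k s \<le> m k" "summable m"
    and int: "\<And>k. (LINT s:{0<..<T}|lborel. a k s) \<le> b k" and b: "bounded_sums b C"
  shows "set_integrable lborel {0<..<T} (\<lambda>s. \<Sum>k. a k s)" "(LINT s:{0<..<T}|lborel. (\<Sum>k. a k s)) \<le> C"
proof -
  define f where "f k s = indicator {0<..<T} s * a k s" for k s
  have fi: "integrable lborel (f k)" for k
    using set_integrable_continuous_Ioo[OF cont[of k]] by (simp add: f_def[abs_def] set_integrable_def)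
  have f0: "0 \<le> f k s" for k s using nn[of s k] by (auto simp: f_def indicator_def)
  have s: "summable (\<lambda>k. norm (f k s))" for s
  proof (cases "s \<in> {0<..<T}")
    case True
    then have "norm (norm (f k s)) \<le> m k" for k
      using nn[of s k] dom(1)[of s k] by (auto simp: f_def)
    then show ?thesis by (intro summable_comparison_test[OF _ dom(2)]) auto
  qed (simp add: f_def)
  have I: "(LINT s|lborel. norm (f k s)) = (LINT s:{0<..<T}|lborel. a k s)" for k
    using f0 by (simp add: set_lebesgue_integral_def f_def)
  have I0: "0 \<le> (LINT s|lborel. norm (f k s))" for k by (intro Bochner_Integration.integral_nonneg) simp
  have sI: "bounded_sums (\<lambda>k. LINT s|lborel. norm (f k s)) C"
    by (rule bounded_sums_mono[OF b I0 _ order_refl]) (unfold I, rule int)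
  have e: "(\<lambda>s. \<Sum>k. f k s) = (\<lambda>s. indicator {0<..<T} s *\<^sub>R (\<Sum>k. a k s))"
    by (auto simp: f_def indicator_def)
  have int: "integrable lborel (\<lambda>s. \<Sum>k. f k s)"
    using fi s bounded_sums_summable[OF sI] by (intro integrable_suminf) auto
  then show "set_integrable lborel {0<..<T} (\<lambda>s. \<Sum>k. a k s)" by (simp add: set_integrable_def e)
  have "(LINT s|lborel. (\<Sum>k. f k s)) = (\<Sum>k. LINT s|lborel. f k s)"
    using fi s bounded_sums_summable[OF sI] by (intro integral_suminf) auto
  also have "\<dots> = (\<Sum>k. LINT s|lborel. norm (f k s))" using f0 by simp
  also have "\<dots> \<le> C" by (rule bounded_sums_suminf[OF sI])
  finally show "(LINT s:{0<..<T}|lborel. (\<Sum>k. a k s)) \<le> C" by (simp add: set_lebesgue_integral_def e)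
qed

section \<open>Orthonormal bases\<close>

locale orthonormal_system =
  fixes e :: "nat \<Rightarrow> 'h::{real_inner, banach, second_countable_topology}"
  assumes basis: "orthonormal_basis e"
begin

lemma inner_basis: "inner (e i) (e k) = (if i = k then 1 else 0)"
  using basis by (simp add: orthonormal_basis_def)

lemma inner_sum_basis:
  assumes "finite F"
  shows "inner (\<Sum>k\<in>F. a k *\<^sub>R e k) (e j) = (if j \<in> F then a j else 0)"
proof -
  have "inner (\<Sum>k\<in>F. a k *\<^sub>R e k) (e j) = (\<Sum>k\<in>F. if k = j then a k else 0)"
    by (simp add: inner_sum_left inner_basis if_distrib cong: if_cong)
  then show ?thesis using assms by (simp add: sum.delta')
qed

lemma norm_sum_basis:
  assumes "finite F"
  shows "(norm (\<Sum>k\<in>F. a k *\<^sub>R e k))\<^sup>2 = (\<Sum>k\<in>F. (a k)\<^sup>2)"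
  using assms
  by (simp add: power2_norm_eq_inner inner_sum_right inner_sum_basis)
     (simp add: power2_eq_square)

lemma norm_diff_projection:
  assumes "finite F"
  shows "(norm (x - (\<Sum>k\<in>F. inner x (e k) *\<^sub>R e k)))\<^sup>2 = (norm x)\<^sup>2 - (\<Sum>k\<in>F. (inner x (e k))\<^sup>2)"
proof -
  define p where "p = (\<Sum>k\<in>F. inner x (e k) *\<^sub>R e k)"
  have "inner x p = (\<Sum>k\<in>F. (inner x (e k))\<^sup>2)"
    by (simp add: p_def inner_sum_right power2_eq_square)
  moreover have "inner p p = (\<Sum>k\<in>F. (inner x (e k))\<^sup>2)"
    using norm_sum_basis[OF assms, of "\<lambda>k. inner x (e k)"] by (simp add: p_def power2_norm_eq_inner)
  ultimately show ?thesis unfolding p_def[symmetric]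
    by (simp add: power2_norm_eq_inner inner_diff_left inner_diff_right inner_commute)
qed

text \<open>Partial sums of the expansion are the best approximations from the span, which turns density of
  the span into convergence of the expansion.\<close>

lemma projection_best:
  assumes "finite F" "finite G" "G \<subseteq> F"
  shows "norm (x - (\<Sum>k\<in>F. inner x (e k) *\<^sub>R e k)) \<le> norm (x - (\<Sum>k\<in>G. a k *\<^sub>R e k))"
proof -
  define y where "y = (\<Sum>k\<in>G. a k *\<^sub>R e k)"
  have y: "y = (\<Sum>k\<in>F. inner y (e k) *\<^sub>R e k)"
    unfolding y_def using assms
    by (intro sum.mono_neutral_cong_left) (auto simp: inner_sum_basis)
  have "(norm (x - y - (\<Sum>k\<in>F. inner (x - y) (e k) *\<^sub>R e k)))\<^sup>2 \<le> (norm (x - y))\<^sup>2"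
    using norm_diff_projection[OF assms(1), of "x - y"] by (simp add: sum_nonneg)
  moreover have "x - y - (\<Sum>k\<in>F. inner (x - y) (e k) *\<^sub>R e k) = x - (\<Sum>k\<in>F. inner x (e k) *\<^sub>R e k)"
    by (subst (2) y[symmetric, THEN sym]) (simp add: inner_diff_left scaleR_diff_left sum_subtractf y[symmetric])
  ultimately show ?thesis unfolding y_def[symmetric]
    by (metis norm_ge_zero power2_le_imp_le)
qed

lemma expansion: "(\<lambda>k. inner x (e k) *\<^sub>R e k) sums x"
  unfolding sums_def
proof (rule LIMSEQ_I)
  fix r :: real assume r: "r > 0"
  have "x \<in> closure (span (range e))" using basis by (simp add: orthonormal_basis_def)
  then obtain y where y: "y \<in> span (range e)" "dist y x < r" using r by (metis closure_approachable)
  obtain T c where T: "finite T" "T \<subseteq> range e" "y = (\<Sum>v\<in>T. c v *\<^sub>R v)"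
    using y(1) unfolding span_explicit by blast
  have inj: "inj e"
    by (rule injI) (metis inner_basis zero_neq_one)
  define G where "G = e -` T"
  have G: "finite G" unfolding G_def using T(1) inj by (rule finite_vimageI)
  have "T = e ` G" using T(2) by (auto simp: G_def)
  then have yG: "y = (\<Sum>k\<in>G. c (e k) *\<^sub>R e k)"
    using T(3) inj by (simp add: sum.reindex inj_on_subset[OF inj])
  obtain M where M: "G \<subseteq> {..<M}" using finite_nat_iff_bounded G by blast
  have "norm ((\<Sum>k<m. inner x (e k) *\<^sub>R e k) - x) < r" if "m \<ge> M" for m
  proof -
    have "norm (x - (\<Sum>k<m. inner x (e k) *\<^sub>R e k)) \<le> norm (x - y)"
      unfolding yG using M that G by (intro projection_best) auto
    then show ?thesis using y(2) by (simp add: dist_norm norm_minus_commute)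
  qed
  then show "\<exists>no. \<forall>m\<ge>no. norm ((\<Sum>k<m. inner x (e k) *\<^sub>R e k) - x) < r" by blast
qed

lemma parseval: "(\<lambda>k. (inner x (e k))\<^sup>2) sums (norm x)\<^sup>2"
proof -
  have "(\<lambda>m. (norm (\<Sum>k<m. inner x (e k) *\<^sub>R e k))\<^sup>2) \<longlonglongrightarrow> (norm x)\<^sup>2"
    using expansion[of x] unfolding sums_def by (intro tendsto_intros)
  then show ?thesis by (simp add: sums_def norm_sum_basis)
qed

lemma norm_projection_le: "norm (\<Sum>k<m. inner x (e k) *\<^sub>R e k) \<le> norm x"
proof (rule power2_le_imp_le)
  show "(norm (\<Sum>k<m. inner x (e k) *\<^sub>R e k))\<^sup>2 \<le> (norm x)\<^sup>2"
    using parseval[of x] sum_le_suminf[of "\<lambda>k. (inner x (e k))\<^sup>2" "{..<m}"]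
    by (simp add: norm_sum_basis sums_iff)
qed simp

lemma eq_if_coefficients_eq: "(\<And>k. inner x (e k) = inner y (e k)) \<Longrightarrow> x = y"
  using expansion[of x] expansion[of y] sums_unique2 by simp

definition series :: "(nat \<Rightarrow> real) \<Rightarrow> 'h" where
  "series a = (\<Sum>k. a k *\<^sub>R e k)"

text \<open>The theorem of Riesz and Fischer.\<close>

lemma series_sums:
  assumes a: "summable (\<lambda>k. (a k)\<^sup>2)"
  shows "(\<lambda>k. a k *\<^sub>R e k) sums series a"
proof -
  have "summable (\<lambda>k. a k *\<^sub>R e k)"
    unfolding summable_Cauchy
  proof (intro allI impI)
    fix r :: real assume r: "r > 0"
    then have "r\<^sup>2 > 0" by simp
    then obtain N where N: "\<And>m n. m \<ge> N \<Longrightarrow> norm (sum (\<lambda>k. (a k)\<^sup>2) {m..<n}) < r\<^sup>2"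
      using a unfolding summable_Cauchy by blast
    have "norm (\<Sum>k=m..<n. a k *\<^sub>R e k) < r" if "m \<ge> N" for m n
    proof (rule power2_less_imp_less)
      show "(norm (\<Sum>k=m..<n. a k *\<^sub>R e k))\<^sup>2 < r\<^sup>2"
        using N[OF that, of n] by (simp add: norm_sum_basis sum_nonneg)
    qed (use r in simp)
    then show "\<exists>N. \<forall>m\<ge>N. \<forall>n. norm (\<Sum>k=m..<n. a k *\<^sub>R e k) < r" by blast
  qed
  then show ?thesis unfolding series_def by (rule summable_sums)
qed

lemma inner_series:
  assumes a: "summable (\<lambda>k. (a k)\<^sup>2)"
  shows "inner (series a) (e j) = a j"
proof -
  have "(\<lambda>k. inner (a k *\<^sub>R e k) (e j)) sums inner (series a) (e j)"
    by (rule bounded_linear.sums[OF bounded_linear_inner_left series_sums[OF a]])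
  moreover have "(\<lambda>k. inner (a k *\<^sub>R e k) (e j)) = (\<lambda>k. if k = j then a k else 0)"
    by (auto simp: inner_basis)
  ultimately show ?thesis using sums_single[of j a] sums_unique2 by metis
qed

lemma norm_series:
  assumes a: "summable (\<lambda>k. (a k)\<^sup>2)"
  shows "(norm (series a))\<^sup>2 = (\<Sum>k. (a k)\<^sup>2)"
  using parseval[of "series a"] by (simp add: inner_series[OF a] sums_iff)

lemma continuous_on_series:
  assumes a: "\<And>k. continuous_on I (a k)" and M: "summable M"
    and bound: "\<And>k s. s \<in> I \<Longrightarrow> (a k s)\<^sup>2 \<le> M k"
  shows "continuous_on I (\<lambda>s. series (\<lambda>k. a k s))"
proof (cases "I = {}")
  case False
  then have M0: "M k \<ge> 0" for k using bound order_trans[OF zero_le_power2] by blast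
  have sm: "summable (\<lambda>k. (a k s)\<^sup>2)" if "s \<in> I" for s
    by (rule summable_comparison_test[OF _ M]) (use bound that in auto)
  show ?thesis
  proof (rule uniform_limit_theorem)
    show "\<forall>\<^sub>F m in sequentially. continuous_on I (\<lambda>s. \<Sum>k<m. a k s *\<^sub>R e k)"
      using a by (intro always_eventually allI continuous_intros) auto
    show "uniform_limit I (\<lambda>m s. \<Sum>k<m. a k s *\<^sub>R e k) (\<lambda>s. series (\<lambda>k. a k s)) sequentially"
    proof (rule uniform_limitI)
      fix r :: real assume r: "r > 0"
      have "(\<lambda>m. (\<Sum>k. M (k + m))) \<longlonglongrightarrow> 0" by (rule suminf_exist_split2[OF M])
      then have "\<forall>\<^sub>F m in sequentially. (\<Sum>k. M (k + m)) < r\<^sup>2"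
        using r by (intro order_tendstoD) auto
      then show "\<forall>\<^sub>F m in sequentially. \<forall>s\<in>I. dist (\<Sum>k<m. a k s *\<^sub>R e k) (series (\<lambda>k. a k s)) < r"
      proof eventually_elim
        case (elim m)
        show ?case
        proof
          fix s assume s: "s \<in> I"
          let ?x = "series (\<lambda>k. a k s)"
          have "(norm (?x - (\<Sum>k<m. a k s *\<^sub>R e k)))\<^sup>2 = (\<Sum>k. (a k s)\<^sup>2) - (\<Sum>k<m. (a k s)\<^sup>2)"
            using norm_diff_projection[of "{..<m}" ?x] by (simp add: inner_series norm_series sm s)
          also have "\<dots> = (\<Sum>k. (a (k + m) s)\<^sup>2)"
            using suminf_minus_initial_segment[OF sm[OF s], of m] by simp
          also have "\<dots> \<le> (\<Sum>k. M (k + m))"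
            using bound[OF s] sm[OF s] M by (intro suminf_le summable_ignore_initial_segment) auto
          finally have "(norm (?x - (\<Sum>k<m. a k s *\<^sub>R e k)))\<^sup>2 < r\<^sup>2" using elim by simp
          then have "norm (?x - (\<Sum>k<m. a k s *\<^sub>R e k)) < r"
            by (rule power2_less_imp_less) (use r in simp)
          then show "dist (\<Sum>k<m. a k s *\<^sub>R e k) ?x < r" by (simp add: dist_norm norm_minus_commute)
        qed
      qed
    qed
  qed simp
qed simp

text \<open>Expansions in the basis may be integrated term by term, because the partial sums are dominated by
  a multiple of the norm of \<open>f\<close>. The expansion also shows that \<open>L s (f s)\<close> is measurable in \<open>s\<close>,
  although \<open>L\<close> is only strongly continuous.\<close>

lemma integral_of_operator_family_sums:
  fixes L :: "real \<Rightarrow> 'h \<Rightarrow> 'x::{banach, second_countable_topology}"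
  assumes f: "set_integrable lborel {a<..<b} f"
    and L: "\<And>s. s \<in> {a<..<b} \<Longrightarrow> bounded_linear (L s)"
    and K: "\<And>s x. s \<in> {a<..<b} \<Longrightarrow> norm (L s x) \<le> K * norm x"
    and cont: "\<And>k. continuous_on {a<..<b} (\<lambda>s. L s (e k))"
  shows "set_integrable lborel {a<..<b} (\<lambda>s. L s (f s))"
    and "(\<lambda>k. LINT s:{a<..<b}|lborel. inner (f s) (e k) *\<^sub>R L s (e k)) sums
           (LINT s:{a<..<b}|lborel. L s (f s))"
    and "\<And>k. set_integrable lborel {a<..<b} (\<lambda>s. inner (f s) (e k) *\<^sub>R L s (e k))"
proof -
  define I where "I = {a<..<b}"
  define g where "g s = indicator I s *\<^sub>R f s" for s
  have gi: "integrable lborel g" using f by (simp add: g_def[abs_def] set_integrable_def I_def)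
  then have gm[measurable]: "g \<in> borel_measurable borel" by auto
  define l where "l k s = indicator I s *\<^sub>R L s (e k)" for k s
  have l[measurable]: "l k \<in> borel_measurable borel" for k
    unfolding l_def[abs_def] using cont[of k]
    by (intro borel_measurable_continuous_on_indicator) (auto simp: I_def)
  have eq: "indicator I s *\<^sub>R (inner (f s) (e k) *\<^sub>R L s (e k)) = inner (g s) (e k) *\<^sub>R l k s" for k s
    by (auto simp: g_def l_def indicator_def)
  have eqs: "(\<Sum>k<m. inner (g s) (e k) *\<^sub>R l k s) = indicator I s *\<^sub>R L s (\<Sum>k<m. inner (f s) (e k) *\<^sub>R e k)" for m s
  proof (cases "s \<in> I")
    case True
    interpret bounded_linear "L s" using L True by (simp add: I_def)
    show ?thesis using True by (simp add: g_def l_def sum scaleR)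
  qed (simp add: g_def)
  have K': "norm (indicator I s *\<^sub>R L s x) \<le> K * norm (indicator I s *\<^sub>R x)" for s x
    using K by (auto simp: I_def indicator_def)
  have Kpos: "norm (indicator I s *\<^sub>R L s (f s)) \<le> \<bar>K\<bar> * norm (g s)" for s
    using K'[of s "f s"] abs_ge_self[of K] mult_right_mono[of K "\<bar>K\<bar>" "norm (g s)"]
    by (simp add: g_def)
  have b: "norm (\<Sum>k<m. inner (g s) (e k) *\<^sub>R l k s) \<le> \<bar>K\<bar> * norm (g s)" for m s
  proof -
    have "norm (\<Sum>k<m. inner (g s) (e k) *\<^sub>R l k s)
        \<le> K * norm (indicator I s *\<^sub>R (\<Sum>k<m. inner (f s) (e k) *\<^sub>R e k))"
      unfolding eqs by (rule K')
    also have "\<dots> \<le> \<bar>K\<bar> * norm (indicator I s *\<^sub>R (\<Sum>k<m. inner (f s) (e k) *\<^sub>R e k))"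
      by (intro mult_right_mono) auto
    also have "\<dots> \<le> \<bar>K\<bar> * norm (g s)"
      using norm_projection_le[of "f s" m] by (intro mult_left_mono) (auto simp: g_def indicator_def)
    finally show ?thesis .
  qed
  have lim: "(\<lambda>m. \<Sum>k<m. inner (g s) (e k) *\<^sub>R l k s) \<longlonglongrightarrow> indicator I s *\<^sub>R L s (f s)" for s
  proof (cases "s \<in> I")
    case True
    interpret bounded_linear "L s" using L True by (simp add: I_def)
    have "(\<lambda>m. indicator I s *\<^sub>R L s (\<Sum>k<m. inner (f s) (e k) *\<^sub>R e k)) \<longlonglongrightarrow> indicator I s *\<^sub>R L s (f s)"
      using expansion[of "f s"] unfolding sums_def by (intro tendsto_intros tendsto)
    then show ?thesis unfolding eqs .
  qed (simp add: g_def)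
  have w: "integrable lborel (\<lambda>s. \<bar>K\<bar> * norm (g s))" using gi by auto
  have m1: "(\<lambda>s. \<Sum>k<m. inner (g s) (e k) *\<^sub>R l k s) \<in> borel_measurable lborel" for m by measurable
  have m2: "(\<lambda>s. indicator I s *\<^sub>R L s (f s)) \<in> borel_measurable lborel"
    by (rule borel_measurable_LIMSEQ_metric[OF m1 lim])
  have psum: "integrable lborel (\<lambda>s. \<Sum>k<m. inner (g s) (e k) *\<^sub>R l k s)" for m
    by (rule Bochner_Integration.integrable_bound[OF w m1]) (use b in auto)
  have single: "integrable lborel (\<lambda>s. inner (g s) (e k) *\<^sub>R l k s)" for k
    using Bochner_Integration.integrable_diff[OF psum[of "Suc k"] psum[of k]] by simp
  show "set_integrable lborel {a<..<b} (\<lambda>s. inner (f s) (e k) *\<^sub>R L s (e k))" for k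
    using single[of k] eq by (simp add: set_integrable_def I_def)
  show "set_integrable lborel {a<..<b} (\<lambda>s. L s (f s))"
    unfolding set_integrable_def I_def[symmetric]
    by (rule Bochner_Integration.integrable_bound[OF w m2]) (use Kpos in auto)
  have "(\<lambda>m. LINT s|lborel. (\<Sum>k<m. inner (g s) (e k) *\<^sub>R l k s)) \<longlonglongrightarrow> (LINT s|lborel. indicator I s *\<^sub>R L s (f s))"
    by (rule integral_dominated_convergence[OF m2 m1 w]) (use lim b in auto)
  then show "(\<lambda>k. LINT s:{a<..<b}|lborel. inner (f s) (e k) *\<^sub>R L s (e k)) sums (LINT s:{a<..<b}|lborel. L s (f s))"
    unfolding sums_def set_lebesgue_integral_def I_def[symmetric] eq
    by (simp add: single)
qed

lemma diagonal_operator_coefficient: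
  assumes "bounded_linear Q" "\<And>k. Q (e k) = lam k *\<^sub>R e k"
  shows "inner (Q x) (e j) = lam j * inner x (e j)"
proof -
  have "(\<lambda>k. inner (Q (inner x (e k) *\<^sub>R e k)) (e j)) sums inner (Q x) (e j)"
    by (intro bounded_linear.sums[OF bounded_linear_inner_left] bounded_linear.sums[OF assms(1)] expansion)
  moreover have "(\<lambda>k. inner (Q (inner x (e k) *\<^sub>R e k)) (e j)) = (\<lambda>k. if k = j then lam k * inner x (e k) else 0)"
    using assms by (auto simp: linear_simps inner_basis)
  ultimately show ?thesis using sums_single[of j "\<lambda>k. lam k * inner x (e k)"] sums_unique2 by metis
qed

end

text \<open>The derivative of \<open>exp (a * s) *\<^sub>R S s x\<close> vanishes.\<close>

lemma C0_eigenvector: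
  assumes S: "C0_semigroup (S :: real \<Rightarrow> 'a::banach \<Rightarrow> 'a)" and x: "(x, - a *\<^sub>R x) \<in> generator S" and t: "t \<ge> 0"
  shows "S t x = exp (- a * t) *\<^sub>R x"
proof -
  define h where "h s = exp (a * s) *\<^sub>R S s x" for s
  have "(h has_vector_derivative 0) (at s within {0..})" if "s \<in> {0..}" for s
  proof -
    have "((\<lambda>s. S s x) has_vector_derivative - a *\<^sub>R S s x) (at s within {0..})"
      using C0_generator_derivative[OF S x, of s] C0_bounded_linear[OF S, of s] that
      by (simp add: linear_simps)
    moreover have "((\<lambda>s. exp (a * s)) has_field_derivative (a * exp (a * s))) (at s within {0..})"
      by (auto intro!: derivative_eq_intros)
    ultimately have "(h has_vector_derivative exp (a * s) *\<^sub>R (- a *\<^sub>R S s x) + (a * exp (a * s)) *\<^sub>R S s x) (at s within {0..})"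
      unfolding h_def[abs_def] by (intro has_vector_derivative_scaleR)
    then show ?thesis by (simp add: mult.commute)
  qed
  then obtain c where "\<And>s. s \<in> {0..} \<Longrightarrow> h s = c"
    using has_vector_derivative_zero_constant[of "{0..}" h] convex_real_interval(1) by blast
  from this[of t] this[of 0] have "h t = h 0" using t by simp
  then have "exp (a * t) *\<^sub>R S t x = x" using C0_zero[OF S] by (simp add: h_def)
  then have "exp (- a * t) *\<^sub>R x = exp (- a * t) *\<^sub>R (exp (a * t) *\<^sub>R S t x)" by simp
  then show ?thesis by (simp add: exp_add[symmetric])
qed

context orthonormal_system begin

text \<open>The semigroup is known on the eigenvectors only; the expansion of \<open>f\<close> reduces the integral to them.\<close>

lemma semigroup_convolution_coefficient:
  assumes E: "C0_semigroup E" and gen: "\<And>k. (e k, - \<alpha> k *\<^sub>R e k) \<in> generator E"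
    and f: "set_integrable lborel {0<..<t} f"
  shows "inner (LINT s:{0<..<t}|lborel. E (t - s) (f s)) (e j) =
           (LINT s:{0<..<t}|lborel. exp (- \<alpha> j * (t - s)) * inner (f s) (e j))"
proof -
  obtain K where K: "\<And>s x. s \<in> {0..t} \<Longrightarrow> norm (E s x) \<le> K * norm x"
    using C0_bounded_on_compact[OF E, of t] by blast
  have Ee: "E (t - s) (e k) = exp (- \<alpha> k * (t - s)) *\<^sub>R e k" if "s \<in> {0<..<t}" for s k
    using that by (intro C0_eigenvector[OF E gen]) auto
  have cont: "continuous_on {0<..<t} (\<lambda>s. E (t - s) (e k))" for k
    using Ee by (subst continuous_on_cong[OF refl, where g = "\<lambda>s. exp (- \<alpha> k * (t - s)) *\<^sub>R e k"])
      (auto intro!: continuous_intros)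
  have bl: "bounded_linear (E (t - s))" if "s \<in> {0<..<t}" for s
    using C0_bounded_linear[OF E] that by simp
  have bd: "norm (E (t - s) x) \<le> K * norm x" if "s \<in> {0<..<t}" for s x using K that by simp
  define c where "c k = (LINT s:{0<..<t}|lborel. exp (- \<alpha> k * (t - s)) * inner (f s) (e k))" for k
  have "(LINT s:{0<..<t}|lborel. inner (f s) (e k) *\<^sub>R E (t - s) (e k)) = c k *\<^sub>R e k" for k
  proof -
    have "(LINT s:{0<..<t}|lborel. inner (f s) (e k) *\<^sub>R E (t - s) (e k)) =
        (LINT s:{0<..<t}|lborel. (exp (- \<alpha> k * (t - s)) * inner (f s) (e k)) *\<^sub>R e k)"
      by (intro set_lebesgue_integral_cong) (auto simp: Ee mult.commute)
    moreover have "set_integrable lborel {0<..<t} (\<lambda>s. exp (- \<alpha> k * (t - s)) * inner (f s) (e k))"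
    proof (rule set_integrable_continuous_mult)
      show "set_integrable lborel {0<..<t} (\<lambda>s. inner (f s) (e k))"
        using integrable_inner_left[of "e k" lborel, OF f[unfolded set_integrable_def]]
        by (simp add: set_integrable_def)
    qed (intro continuous_intros)
    then have "(LINT s:{0<..<t}|lborel. (exp (- \<alpha> k * (t - s)) * inner (f s) (e k)) *\<^sub>R e k) = c k *\<^sub>R e k"
      unfolding c_def by (rule set_lebesgue_integral_scaleR_left)
    ultimately show ?thesis by simp
  qed
  then have "(\<lambda>k. c k *\<^sub>R e k) sums (LINT s:{0<..<t}|lborel. E (t - s) (f s))"
    using integral_of_operator_family_sums(2)[where L = "\<lambda>s. E (t - s)", OF f bl bd cont] by simp
  then have "(\<lambda>k. inner (c k *\<^sub>R e k) (e j)) sums inner (LINT s:{0<..<t}|lborel. E (t - s) (f s)) (e j)"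
    by (rule bounded_linear.sums[OF bounded_linear_inner_left])
  moreover have "(\<lambda>k. inner (c k *\<^sub>R e k) (e j)) = (\<lambda>k. if k = j then c k else 0)"
    by (auto simp: inner_basis)
  ultimately have "(\<lambda>k. if k = j then c k else 0) sums
      inner (LINT s:{0<..<t}|lborel. E (t - s) (f s)) (e j)" by (simp only:)
  from sums_unique2[OF this sums_single] show ?thesis by (simp add: c_def)
qed

end

section \<open>Steering a damped oscillator\<close>

text \<open>A function \<open>y\<close> that is traversed backwards in time enters the oscillator equation with the sign of
  \<open>y1\<close> reversed. If \<open>y\<close> is a free motion, \<open>\<mu> * y2 + y1 + a * y = 0\<close>, the residual is therefore
  \<open>- 2 * y1\<close>; this is used in the oscillating case \<open>4 * \<mu> * a > 1\<close>. In the overdamped case the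
  exponential \<open>exp (- a * x)\<close>, the free motion for \<open>\<mu> = 0\<close>, is good enough. In both cases the bound of
  the squared residual has integral \<open>8 * a\<close> over the half line, whatever \<open>\<mu>\<close> is.\<close>

lemma reversed_oscillator:
  fixes \<mu> a :: real
  assumes mu: "0 < \<mu>" "\<mu> \<le> 1" and a: "0 < a"
  obtains y y1 y2 \<kappa> where "0 < \<kappa>" "\<kappa> \<le> 1 / (2 * \<mu>)" "y 0 = 1"
    "\<And>x. (y has_real_derivative y1 x) (at x)" "\<And>x. (y1 has_real_derivative y2 x) (at x)"
    "continuous_on UNIV y2"
    "\<And>x. x \<ge> 0 \<Longrightarrow> (y x)\<^sup>2 \<le> 1" "\<And>x. x \<ge> 0 \<Longrightarrow> (y1 x)\<^sup>2 \<le> a / \<mu>"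
    "\<And>x. x \<ge> 0 \<Longrightarrow> (\<mu> * y2 x - y1 x + a * y x)\<^sup>2 \<le> 16 * a * \<kappa> * exp (- 2 * \<kappa> * x)"
proof (cases "4 * \<mu> * a \<le> 1")
  case True
  define y where "y x = exp (- a * x)" for x
  have y: "0 < y x \<and> y x \<le> 1" if "x \<ge> 0" for x using that a by (simp add: y_def)
  have y2: "(y x)\<^sup>2 = exp (- 2 * a * x)" for x
    by (simp add: y_def power2_eq_square exp_add[symmetric])
  have y2le: "(y x)\<^sup>2 \<le> 1" if "x \<ge> 0" for x using y[OF that] by (simp add: power_le_one)
  have am: "a \<le> 1 / (4 * \<mu>)" using True mu by (simp add: field_simps)
  show thesis
  proof (rule that[of a y "\<lambda>x. - a * y x" "\<lambda>x. a\<^sup>2 * y x"])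
    show "(y has_real_derivative - a * y x) (at x)" for x
      unfolding y_def[abs_def] by (auto intro!: derivative_eq_intros)
    show "((\<lambda>x. - a * y x) has_real_derivative a\<^sup>2 * y x) (at x)" for x
      unfolding y_def[abs_def] by (auto intro!: derivative_eq_intros simp: power2_eq_square)
    show "continuous_on UNIV (\<lambda>x. a\<^sup>2 * y x)" unfolding y_def by (intro continuous_intros)
    show "a \<le> 1 / (2 * \<mu>)"
    proof -
      have "1 / (4 * \<mu>) \<le> 1 / (2 * \<mu>)" using mu by (simp add: field_simps)
      then show ?thesis using am by linarith
    qed
    show "(- a * y x)\<^sup>2 \<le> a / \<mu>" if "x \<ge> 0" for x
    proof -
      have "(- a * y x)\<^sup>2 = a\<^sup>2 * (y x)\<^sup>2" by (simp add: power_mult_distrib)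
      also have "\<dots> \<le> a\<^sup>2 * 1" by (intro mult_left_mono y2le that) simp
      also have "\<dots> = a * a" by (simp add: power2_eq_square)
      also have "\<dots> \<le> a * (1 / \<mu>)"
      proof (intro mult_left_mono)
        have "1 / (4 * \<mu>) \<le> 1 / \<mu>" using mu by (simp add: field_simps)
        then show "a \<le> 1 / \<mu>" using am by linarith
      qed (use a in simp)
      finally show ?thesis by simp
    qed
    show "(\<mu> * (a\<^sup>2 * y x) - - a * y x + a * y x)\<^sup>2 \<le> 16 * a * a * exp (- 2 * a * x)" if "x \<ge> 0" for x
    proof -
      have "\<mu> * (a\<^sup>2 * y x) - - a * y x + a * y x = (a * (\<mu> * a + 2)) * y x"
        by (simp add: algebra_simps power2_eq_square)
      then have "(\<mu> * (a\<^sup>2 * y x) - - a * y x + a * y x)\<^sup>2 = (a * (\<mu> * a + 2))\<^sup>2 * exp (- 2 * a * x)"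
        by (simp only: power_mult_distrib y2)
      also have "\<dots> \<le> (a * 4)\<^sup>2 * exp (- 2 * a * x)"
        using True a mu by (intro mult_right_mono power_mono mult_left_mono) auto
      finally show ?thesis by (simp add: power2_eq_square)
    qed
  qed (use a y2le in \<open>auto simp: y_def\<close>)
next
  case False
  define \<kappa> where "\<kappa> = 1 / (2 * \<mu>)"
  define \<omega> where "\<omega> = sqrt (4 * \<mu> * a - 1) / (2 * \<mu>)"
  have k: "\<kappa> > 0" using mu by (simp add: \<kappa>_def)
  have mk: "2 * \<mu> * \<kappa> = 1" using mu by (simp add: \<kappa>_def)
  have "\<omega>\<^sup>2 = (4 * \<mu> * a - 1) / (4 * \<mu>\<^sup>2)"
    using False by (simp add: \<omega>_def power_divide power_mult_distrib)
  then have w2: "\<kappa>\<^sup>2 + \<omega>\<^sup>2 = a / \<mu>"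
    using mu by (simp add: \<kappa>_def power_divide power_mult_distrib field_simps power2_eq_square)
  then have w2': "\<mu> * (\<kappa>\<^sup>2 + \<omega>\<^sup>2) = a" using mu by simp
  define y where "y x = exp (- \<kappa> * x) * cos (\<omega> * x)" for x
  define y1 where "y1 x = - (exp (- \<kappa> * x) * (\<kappa> * cos (\<omega> * x) + \<omega> * sin (\<omega> * x)))" for x
  define y2 where "y2 x = exp (- \<kappa> * x) * ((\<kappa>\<^sup>2 - \<omega>\<^sup>2) * cos (\<omega> * x) + 2 * \<kappa> * \<omega> * sin (\<omega> * x))" for x
  have e2: "(exp (- \<kappa> * x))\<^sup>2 = exp (- 2 * \<kappa> * x)" for x
    by (simp add: power2_eq_square exp_add[symmetric])
  have e2le: "exp (- 2 * \<kappa> * x) \<le> 1" if "x \<ge> 0" for x using that k by simp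
  have y1sq: "(y1 x)\<^sup>2 \<le> exp (- 2 * \<kappa> * x) * (a / \<mu>)" for x
  proof -
    have lagrange: "(p * c + q * s)\<^sup>2 = (p\<^sup>2 + q\<^sup>2) * (s\<^sup>2 + c\<^sup>2) - (p * s - q * c)\<^sup>2" for p q s c :: real
      by (simp add: power2_eq_square algebra_simps)
    have "(\<kappa> * cos (\<omega> * x) + \<omega> * sin (\<omega> * x))\<^sup>2 \<le> \<kappa>\<^sup>2 + \<omega>\<^sup>2"
      unfolding lagrange sin_cos_squared_add by simp
    then show ?thesis
      unfolding y1_def power2_minus power_mult_distrib e2 w2 by (intro mult_left_mono) auto
  qed
  show thesis
  proof (rule that[of \<kappa> y y1 y2])
    show "(y has_real_derivative y1 x) (at x)" for x
      unfolding y_def[abs_def] y1_def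
      by (auto intro!: derivative_eq_intros simp: algebra_simps)
    show "(y1 has_real_derivative y2 x) (at x)" for x
      unfolding y1_def[abs_def] y2_def
      by (auto intro!: derivative_eq_intros simp: algebra_simps power2_eq_square)
    show "continuous_on UNIV y2" unfolding y2_def[abs_def] by (intro continuous_intros)
    show "(y x)\<^sup>2 \<le> 1" if "x \<ge> 0" for x
    proof -
      have "(y x)\<^sup>2 = exp (- 2 * \<kappa> * x) * (cos (\<omega> * x))\<^sup>2"
        unfolding y_def power_mult_distrib e2 ..
      also have "\<dots> \<le> 1 * 1"
        using e2le[OF that] by (intro mult_mono) (auto simp: abs_square_le_1)
      finally show ?thesis by simp
    qed
    show "(y1 x)\<^sup>2 \<le> a / \<mu>" if "x \<ge> 0" for x
    proof -
      have "exp (- 2 * \<kappa> * x) * (a / \<mu>) \<le> 1 * (a / \<mu>)"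
        using e2le[OF that] a mu by (intro mult_right_mono) auto
      then show ?thesis using y1sq[of x] by linarith
    qed
    show "(\<mu> * y2 x - y1 x + a * y x)\<^sup>2 \<le> 16 * a * \<kappa> * exp (- 2 * \<kappa> * x)" if "x \<ge> 0" for x
    proof -
      have "\<mu> * y2 x + y1 x + a * y x = exp (- \<kappa> * x) *
          ((\<mu> * (\<kappa>\<^sup>2 - \<omega>\<^sup>2) - \<kappa> + a) * cos (\<omega> * x) + (2 * \<mu> * \<kappa> - 1) * \<omega> * sin (\<omega> * x))"
        by (simp add: y_def y1_def y2_def algebra_simps)
      also have "\<mu> * (\<kappa>\<^sup>2 - \<omega>\<^sup>2) - \<kappa> + a = 2 * \<mu> * \<kappa> * \<kappa> - \<kappa>"
        by (simp add: w2'[symmetric] algebra_simps power2_eq_square)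
      finally have "\<mu> * y2 x + y1 x + a * y x = 0" by (simp add: mk)
      then have eq: "\<mu> * y2 x - y1 x + a * y x = - 2 * y1 x" by linarith
      have "(\<mu> * y2 x - y1 x + a * y x)\<^sup>2 = 4 * (y1 x)\<^sup>2"
        unfolding eq by (simp add: power_mult_distrib)
      also have "\<dots> \<le> 4 * (exp (- 2 * \<kappa> * x) * (a / \<mu>))" using y1sq[of x] by simp
      also have "a / \<mu> = 2 * a * \<kappa>" by (simp add: \<kappa>_def)
      also have "4 * (exp (- 2 * \<kappa> * x) * (2 * a * \<kappa>)) \<le> 16 * a * \<kappa> * exp (- 2 * \<kappa> * x)"
        using a k by (simp add: mult_ac)
      finally show ?thesis .
    qed
  qed (use k in \<open>auto simp: \<kappa>_def y_def\<close>)
qed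

text \<open>The function \<open>w\<close>, with derivatives \<open>w1\<close> and \<open>w2\<close>, moves the oscillator from rest at \<open>0\<close> to the
  position \<open>1\<close>, with no condition on the final velocity. The residual \<open>\<mu> * w2 + w1 + a * w\<close> is
  the force that this takes. The estimate of the cost is the one with \<open>K\<close>; the pointwise bounds with
  \<open>C\<close> only serve to make series over the modes converge for fixed \<open>\<mu>\<close>.\<close>

definition steers :: "real \<Rightarrow> real \<Rightarrow> real \<Rightarrow> real \<Rightarrow> real
    \<Rightarrow> (real \<Rightarrow> real) \<Rightarrow> (real \<Rightarrow> real) \<Rightarrow> (real \<Rightarrow> real) \<Rightarrow> bool" where
  "steers T \<mu> K C a w w1 w2 \<longleftrightarrow>
      (\<forall>t. (w has_real_derivative w1 t) (at t)) \<and> (\<forall>t. (w1 has_real_derivative w2 t) (at t)) \<and>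
      continuous_on UNIV w2 \<and> w 0 = 0 \<and> w1 0 = 0 \<and> w T = 1 \<and>
      (\<forall>t\<in>{0..T}. (w t)\<^sup>2 \<le> 1 \<and> (w1 t)\<^sup>2 \<le> C * a \<and> (\<mu> * w2 t + w1 t + a * w t)\<^sup>2 \<le> C * a) \<and>
      (LINT t:{0<..<T}|lborel. (\<mu> * w2 t + w1 t + a * w t)\<^sup>2) \<le> K * a"

text \<open>The backward motion of \<open>reversed_oscillator\<close> is multiplied by \<open>(t / T)\<^sup>2\<close>, which vanishes to second
  order at \<open>0\<close> and equals \<open>1\<close> at \<open>T\<close>. The terms in which this factor is differentiated contribute at most
  a constant times \<open>1 + a\<close>, hence a constant times \<open>a\<close> for \<open>a \<ge> a0\<close>. The constant \<open>K\<close> is chosen before \<open>\<mu>\<close>,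
  whereas \<open>C\<close> is of order \<open>1 / \<mu>\<close>.\<close>

lemma oscillator_steering:
  fixes T a0 :: real
  assumes T: "T > 0" and a0: "a0 > 0"
  obtains K where "K \<ge> 0" "\<And>\<mu>. 0 < \<mu> \<Longrightarrow> \<mu> \<le> 1 \<Longrightarrow> \<exists>C\<ge>0. \<forall>a\<ge>a0. \<exists>w w1 w2. steers T \<mu> K C a w w1 w2"
proof
  define C1 where "C1 = 12 / T\<^sup>2 * (2 / a0 + 8) + 12 / T ^ 4 / a0"
  have C1: "C1 \<ge> 0" using T a0 by (simp add: C1_def)
  show "24 + T * C1 \<ge> 0" using T C1 by simp
  fix \<mu> :: real assume mu: "0 < \<mu>" "\<mu> \<le> 1"
  define C where "C = 24 / \<mu> + C1 + 8 / (T\<^sup>2 * a0) + 2 / \<mu>"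
  have C_terms: "0 \<le> 24 / \<mu>" "0 \<le> 8 / (T\<^sup>2 * a0)" "0 \<le> 2 / \<mu>" using mu T a0 by simp_all
  have C0: "C \<ge> 0" using mu C1 T a0 by (simp add: C_def)
  show "\<exists>C\<ge>0. \<forall>a\<ge>a0. \<exists>w w1 w2. steers T \<mu> (24 + T * C1) C a w w1 w2"
  proof (intro exI[of _ C] conjI C0 allI impI)
    fix a assume aa: "a \<ge> a0"
    then have a: "a > 0" and a1: "1 \<le> a / a0" using a0 by auto
    obtain y y1 y2 \<kappa> where k: "0 < \<kappa>" "\<kappa> \<le> 1 / (2 * \<mu>)" and y0: "y 0 = 1"
      and yd: "\<And>x. (y has_real_derivative y1 x) (at x)" and y1d: "\<And>x. (y1 has_real_derivative y2 x) (at x)"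
      and y2c: "continuous_on UNIV y2"
      and yb: "\<And>x. x \<ge> 0 \<Longrightarrow> (y x)\<^sup>2 \<le> 1" and y1b: "\<And>x. x \<ge> 0 \<Longrightarrow> (y1 x)\<^sup>2 \<le> a / \<mu>"
      and res: "\<And>x. x \<ge> 0 \<Longrightarrow> (\<mu> * y2 x - y1 x + a * y x)\<^sup>2 \<le> 16 * a * \<kappa> * exp (- 2 * \<kappa> * x)"
      using reversed_oscillator[OF mu a] by metis
    define w where "w t = t\<^sup>2 / T\<^sup>2 * y (T - t)" for t
    define w1 where "w1 t = 2 * t / T\<^sup>2 * y (T - t) - t\<^sup>2 / T\<^sup>2 * y1 (T - t)" for t
    define w2 where "w2 t = 2 / T\<^sup>2 * y (T - t) - 4 * t / T\<^sup>2 * y1 (T - t) + t\<^sup>2 / T\<^sup>2 * y2 (T - t)" for t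
    have dy: "((\<lambda>t. y (T - t)) has_real_derivative - y1 (T - t)) (at t)" for t
    proof -
      have "((\<lambda>t. y (T - t)) has_real_derivative y1 (T - t) * (- 1)) (at t)"
        by (rule DERIV_chain2[where f = y and g = "\<lambda>t. T - t"]) (auto intro!: yd derivative_eq_intros)
      then show ?thesis by simp
    qed
    have dy1: "((\<lambda>t. y1 (T - t)) has_real_derivative - y2 (T - t)) (at t)" for t
    proof -
      have "((\<lambda>t. y1 (T - t)) has_real_derivative y2 (T - t) * (- 1)) (at t)"
        by (rule DERIV_chain2[where f = y1 and g = "\<lambda>t. T - t"]) (auto intro!: y1d derivative_eq_intros)
      then show ?thesis by simp
    qed
    have wd: "(w has_real_derivative w1 t) (at t)" for t
      unfolding w_def[abs_def] w1_def using T
      by (auto intro!: derivative_eq_intros dy simp: field_simps)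
    have w1d: "(w1 has_real_derivative w2 t) (at t)" for t
      unfolding w1_def[abs_def] w2_def using T
      by (auto intro!: derivative_eq_intros dy dy1 simp: field_simps)
    have yc: "continuous_on UNIV (\<lambda>t. y (T - t))" "continuous_on UNIV (\<lambda>t. y1 (T - t))"
      using dy dy1 by (auto intro!: DERIV_isCont continuous_at_imp_continuous_on)
    have y2c': "continuous_on UNIV (\<lambda>t. y2 (T - t))"
      by (rule continuous_on_compose2[OF y2c]) (auto intro!: continuous_intros)
    have w2c: "continuous_on UNIV w2"
      unfolding w2_def[abs_def] by (intro continuous_intros yc y2c') (use T in auto)
    define R where "R t = \<mu> * w2 t + w1 t + a * w t" for t
    have R: "R t = t\<^sup>2 / T\<^sup>2 * (\<mu> * y2 (T - t) - y1 (T - t) + a * y (T - t)) +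
        2 * t / T\<^sup>2 * (y (T - t) - 2 * \<mu> * y1 (T - t)) + 2 * \<mu> / T\<^sup>2 * y (T - t)" for t
      by (simp add: R_def w_def w1_def w2_def algebra_simps)
    have chi: "0 \<le> t\<^sup>2 / T\<^sup>2 \<and> t\<^sup>2 / T\<^sup>2 \<le> 1 \<and> 0 \<le> 2 * t / T\<^sup>2 \<and> 2 * t / T\<^sup>2 \<le> 2 / T" if "t \<in> {0..T}" for t
    proof -
      have "t\<^sup>2 \<le> T\<^sup>2" using that by (intro power_mono) auto
      moreover have "2 * t / T\<^sup>2 \<le> 2 * T / T\<^sup>2" using that by (intro divide_right_mono) auto
      moreover have "2 * T / T\<^sup>2 = 2 / T" using T by (simp add: power2_eq_square)
      ultimately show ?thesis using that T by simp
    qed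
    have mult_sq: "(p * q)\<^sup>2 \<le> P\<^sup>2 * Q" if "0 \<le> p" "p \<le> P" "q\<^sup>2 \<le> Q" for p q P Q :: real
      using that by (simp add: power_mult_distrib) (intro mult_mono power_mono, auto)
    have Rb: "(R t)\<^sup>2 \<le> 48 * a * \<kappa> * exp (- 2 * \<kappa> * (T - t)) + a * C1" if t: "t \<in> {0..T}" for t
    proof -
      have tt: "T - t \<ge> 0" using t by simp
      note chi = chi[OF t]
      have 1: "(t\<^sup>2 / T\<^sup>2 * (\<mu> * y2 (T - t) - y1 (T - t) + a * y (T - t)))\<^sup>2
          \<le> 1\<^sup>2 * (16 * a * \<kappa> * exp (- 2 * \<kappa> * (T - t)))"
        using chi res[OF tt] by (intro mult_sq) auto
      have "(y (T - t) - 2 * \<mu> * y1 (T - t))\<^sup>2 \<le> 2 * (y (T - t))\<^sup>2 + 2 * (2 * \<mu> * y1 (T - t))\<^sup>2"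
        by (rule diff_square_le)
      also have "\<dots> = 2 * (y (T - t))\<^sup>2 + 8 * \<mu>\<^sup>2 * (y1 (T - t))\<^sup>2" by (simp add: power_mult_distrib)
      also have "\<dots> \<le> 2 * 1 + 8 * \<mu>\<^sup>2 * (a / \<mu>)"
        using yb[OF tt] y1b[OF tt] by (intro add_mono mult_left_mono) auto
      also have "8 * \<mu>\<^sup>2 * (a / \<mu>) = 8 * (\<mu> * a)" using mu by (simp add: power2_eq_square)
      also have "\<dots> \<le> 8 * (1 * a)" using mu a by (intro mult_left_mono mult_right_mono) auto
      finally have "(y (T - t) - 2 * \<mu> * y1 (T - t))\<^sup>2 \<le> 2 + 8 * a" by simp
      also have "\<dots> \<le> 2 * (a / a0) + 8 * a" using a1 by linarith
      also have "\<dots> = a * (2 / a0 + 8)" by (simp add: distrib_left)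
      finally have 2: "(2 * t / T\<^sup>2 * (y (T - t) - 2 * \<mu> * y1 (T - t)))\<^sup>2 \<le> (2 / T)\<^sup>2 * (a * (2 / a0 + 8))"
        using chi by (intro mult_sq) auto
      have "2 * \<mu> / T\<^sup>2 \<le> 2 / T\<^sup>2" using mu by (intro divide_right_mono) auto
      then have 3: "(2 * \<mu> / T\<^sup>2 * y (T - t))\<^sup>2 \<le> (2 / T\<^sup>2)\<^sup>2 * (a / a0)"
        using mu yb[OF tt] a1 by (intro mult_sq) auto
      have "(R t)\<^sup>2 \<le> 3 * (1\<^sup>2 * (16 * a * \<kappa> * exp (- 2 * \<kappa> * (T - t))) +
          (2 / T)\<^sup>2 * (a * (2 / a0 + 8)) + (2 / T\<^sup>2)\<^sup>2 * (a / a0))"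
        unfolding R by (rule order_trans[OF sum3_square_le]) (intro mult_left_mono add_mono 1 2 3, simp)
      also have "\<dots> = 48 * a * \<kappa> * exp (- 2 * \<kappa> * (T - t)) + a * C1"
      proof -
        have "(2 / T\<^sup>2)\<^sup>2 = 4 / T ^ 4" "(2 / T)\<^sup>2 = 4 / T\<^sup>2" by (simp_all add: power_divide)
        then show ?thesis by (simp add: C1_def algebra_simps add_divide_distrib)
      qed
      finally show ?thesis .
    qed
    have Rc: "continuous_on {0..T} R"
      unfolding R using T by (intro continuous_intros continuous_on_subset[OF yc(1)]
        continuous_on_subset[OF yc(2)] continuous_on_subset[OF y2c']) auto
    have "(LINT t:{0<..<T}|lborel. (R t)\<^sup>2) \<le>
        (LINT t:{0<..<T}|lborel. 48 * a * \<kappa> * exp (- 2 * \<kappa> * (T - t)) + a * C1)"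
      using Rb by (intro set_integral_mono set_integrable_continuous_Ioo continuous_intros Rc) auto
    also have "\<dots> = (24 * a * exp (- 2 * \<kappa> * (T - T)) + a * C1 * T) - (24 * a * exp (- 2 * \<kappa> * (T - 0)) + a * C1 * 0)"
      using T k by (intro FTC_Ioo) (auto intro!: derivative_eq_intros continuous_intros)
    also have "\<dots> \<le> (24 + T * C1) * a"
      using a by (simp add: algebra_simps)
    finally have Rint: "(LINT t:{0<..<T}|lborel. (R t)\<^sup>2) \<le> (24 + T * C1) * a" .
    have bounds: "(w t)\<^sup>2 \<le> 1 \<and> (w1 t)\<^sup>2 \<le> C * a \<and> (R t)\<^sup>2 \<le> C * a" if t: "t \<in> {0..T}" for t
    proof (intro conjI)
      have tt: "T - t \<ge> 0" using t by simp
      note chi = chi[OF t]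
      show "(w t)\<^sup>2 \<le> 1"
        unfolding w_def using mult_sq[of "t\<^sup>2 / T\<^sup>2" 1 "y (T - t)" 1] chi yb[OF tt] by simp
      have "(w1 t)\<^sup>2 \<le> 2 * (2 * t / T\<^sup>2 * y (T - t))\<^sup>2 + 2 * (t\<^sup>2 / T\<^sup>2 * y1 (T - t))\<^sup>2"
        unfolding w1_def by (rule diff_square_le)
      also have "\<dots> \<le> 2 * ((2 / T)\<^sup>2 * (a / a0)) + 2 * (1\<^sup>2 * (a / \<mu>))"
        using chi yb[OF tt] y1b[OF tt] a1 by (intro add_mono mult_left_mono mult_sq) auto
      also have "\<dots> = (8 / (T\<^sup>2 * a0) + 2 / \<mu>) * a" by (simp add: power_divide algebra_simps)
      also have "\<dots> \<le> C * a" using C_terms a C1 unfolding C_def by (intro mult_right_mono) linarith+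
      finally show "(w1 t)\<^sup>2 \<le> C * a" .
      have "(R t)\<^sup>2 \<le> 48 * a * \<kappa> * exp (- 2 * \<kappa> * (T - t)) + a * C1" by (rule Rb[OF t])
      also have "\<dots> \<le> 48 * a * (1 / (2 * \<mu>)) * 1 + a * C1"
        using k a tt mu by (intro add_right_mono mult_mono) auto
      also have "\<dots> = (24 / \<mu> + C1) * a" by (simp add: algebra_simps)
      also have "\<dots> \<le> C * a" using C_terms a unfolding C_def by (intro mult_right_mono) linarith+
      finally show "(R t)\<^sup>2 \<le> C * a" .
    qed
    show "\<exists>w w1 w2. steers T \<mu> (24 + T * C1) C a w w1 w2"
      using wd w1d w2c bounds Rint T y0
      by (intro exI[of _ w] exI[of _ w1] exI[of _ w2]) (simp add: steers_def R_def w_def w1_def)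
  qed
qed

section \<open>The scale of spaces and the coefficients of the equation\<close>

locale eigenvalue_scale = orthonormal_system e
  for e :: "nat \<Rightarrow> 'h::{real_inner, banach, second_countable_topology}" +
  fixes \<alpha> :: "nat \<Rightarrow> real"
  assumes alpha0: "0 < \<alpha> 0" and mono_alpha: "mono \<alpha>" and alpha_top: "filterlim \<alpha> at_top sequentially"
begin

lemma alpha_ge: "\<alpha> 0 \<le> \<alpha> k" using mono_alpha by (simp add: monoD)

lemma alpha_pos [simp]: "0 < \<alpha> k" using alpha0 alpha_ge[of k] by linarith

lemma alpha_nonneg [simp]: "0 \<le> \<alpha> k" using alpha_pos[of k] by linarith

lemma alpha_ne_zero [simp]: "\<alpha> k \<noteq> 0" using alpha_pos[of k] by linarith

abbreviation Hs :: "real \<Rightarrow> 'h set" where "Hs \<equiv> hspace \<alpha> e"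

text \<open>The square of the norm of \<open>H\<^sup>\<delta>\<close>; squares add up over the modes.\<close>

definition sqn :: "real \<Rightarrow> 'h \<Rightarrow> real" where
  "sqn \<delta> x = (\<Sum>k. \<alpha> k powr \<delta> * (inner x (e k))\<^sup>2)"

lemma hspace_summable: "x \<in> Hs \<delta> \<Longrightarrow> summable (\<lambda>k. \<alpha> k powr \<delta> * (inner x (e k))\<^sup>2)"
  by (simp add: hspace_def)

lemma sqn_nonneg: "x \<in> Hs \<delta> \<Longrightarrow> 0 \<le> sqn \<delta> x"
  unfolding sqn_def by (intro suminf_nonneg hspace_summable) auto

lemma hnorm_eq: "hnorm \<alpha> e \<delta> x = sqrt (sqn \<delta> x)" by (simp add: hnorm_def sqn_def)

lemma partial_sum_le_sqn: "x \<in> Hs \<delta> \<Longrightarrow> (\<Sum>k<m. \<alpha> k powr \<delta> * (inner x (e k))\<^sup>2) \<le> sqn \<delta> x"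
  unfolding sqn_def by (intro sum_le_suminf hspace_summable) auto

lemma hspaceI:
  assumes "\<And>m. (\<Sum>k<m. \<alpha> k powr \<delta> * (inner x (e k))\<^sup>2) \<le> C"
  shows "x \<in> Hs \<delta>" "sqn \<delta> x \<le> C"
proof -
  have s: "summable (\<lambda>k. \<alpha> k powr \<delta> * (inner x (e k))\<^sup>2)"
    by (rule bounded_imp_summable[where B = C])
      (use assms in \<open>auto simp: lessThan_Suc_atMost[symmetric] simp del: sum.lessThan_Suc\<close>)
  then show "x \<in> Hs \<delta>" by (simp add: hspace_def)
  show "sqn \<delta> x \<le> C" unfolding sqn_def by (rule suminf_le_const[OF s assms])
qed

lemma hspace_comparison:
  assumes "summable M" "\<And>k. \<alpha> k powr \<delta> * (inner x (e k))\<^sup>2 \<le> M k"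
  shows "x \<in> Hs \<delta>" "sqn \<delta> x \<le> (\<Sum>k. M k)"
proof -
  have s: "summable (\<lambda>k. \<alpha> k powr \<delta> * (inner x (e k))\<^sup>2)"
    by (rule summable_comparison_test[OF _ assms(1)]) (use assms(2) in auto)
  then show "x \<in> Hs \<delta>" by (simp add: hspace_def)
  show "sqn \<delta> x \<le> (\<Sum>k. M k)" unfolding sqn_def by (rule suminf_le[OF assms(2) s assms(1)])
qed

lemma alpha_powr_mono: "\<delta>' \<le> \<delta> \<Longrightarrow> \<alpha> k powr \<delta>' \<le> \<alpha> 0 powr (\<delta>' - \<delta>) * \<alpha> k powr \<delta>"
proof -
  assume "\<delta>' \<le> \<delta>"
  then have "\<alpha> k powr (\<delta>' - \<delta>) \<le> \<alpha> 0 powr (\<delta>' - \<delta>)"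
    by (intro powr_mono2') (auto simp: alpha_ge alpha0)
  then have "\<alpha> k powr (\<delta>' - \<delta>) * \<alpha> k powr \<delta> \<le> \<alpha> 0 powr (\<delta>' - \<delta>) * \<alpha> k powr \<delta>"
    by (intro mult_right_mono) auto
  then show ?thesis by (simp add: powr_add[symmetric])
qed

lemma hspace_mono:
  assumes "\<delta>' \<le> \<delta>" "x \<in> Hs \<delta>"
  shows "x \<in> Hs \<delta>'" "sqn \<delta>' x \<le> \<alpha> 0 powr (\<delta>' - \<delta>) * sqn \<delta> x"
proof -
  have s: "summable (\<lambda>k. \<alpha> 0 powr (\<delta>' - \<delta>) * (\<alpha> k powr \<delta> * (inner x (e k))\<^sup>2))"
    by (intro summable_mult hspace_summable assms)
  have b: "\<alpha> k powr \<delta>' * (inner x (e k))\<^sup>2 \<le> \<alpha> 0 powr (\<delta>' - \<delta>) * (\<alpha> k powr \<delta> * (inner x (e k))\<^sup>2)" for k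
    using mult_right_mono[OF alpha_powr_mono[OF assms(1), of k], of "(inner x (e k))\<^sup>2"]
    by (simp add: mult.assoc)
  show "x \<in> Hs \<delta>'" "sqn \<delta>' x \<le> \<alpha> 0 powr (\<delta>' - \<delta>) * sqn \<delta> x"
    using hspace_comparison[OF s b] suminf_mult[OF hspace_summable[OF assms(2)]]
    by (simp_all add: sqn_def)
qed

lemma hspace_zero: "Hs 0 = UNIV" and sqn_zero: "sqn 0 x = (norm x)\<^sup>2"
  using parseval by (auto simp: hspace_def sqn_def sums_iff)

lemma hspace_diff:
  assumes "x \<in> Hs \<delta>" "y \<in> Hs \<delta>"
  shows "x - y \<in> Hs \<delta>" "sqn \<delta> (x - y) \<le> 2 * sqn \<delta> x + 2 * sqn \<delta> y"
proof -
  have s: "summable (\<lambda>k. 2 * (\<alpha> k powr \<delta> * (inner x (e k))\<^sup>2) + 2 * (\<alpha> k powr \<delta> * (inner y (e k))\<^sup>2))"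
    by (intro summable_add summable_mult hspace_summable assms)
  have b: "\<alpha> k powr \<delta> * (inner (x - y) (e k))\<^sup>2 \<le>
      2 * (\<alpha> k powr \<delta> * (inner x (e k))\<^sup>2) + 2 * (\<alpha> k powr \<delta> * (inner y (e k))\<^sup>2)" for k
    using mult_left_mono[OF diff_square_le[of "inner x (e k)" "inner y (e k)"], of "\<alpha> k powr \<delta>"]
    by (simp add: inner_diff_left algebra_simps)
  show "x - y \<in> Hs \<delta>" by (rule hspace_comparison(1)[OF s b])
  have "(\<Sum>k. 2 * (\<alpha> k powr \<delta> * (inner x (e k))\<^sup>2) + 2 * (\<alpha> k powr \<delta> * (inner y (e k))\<^sup>2))
      = 2 * sqn \<delta> x + 2 * sqn \<delta> y"
    unfolding sqn_def using hspace_summable[OF assms(1)] hspace_summable[OF assms(2)]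
    by (simp add: suminf_add[symmetric] suminf_mult)
  then show "sqn \<delta> (x - y) \<le> 2 * sqn \<delta> x + 2 * sqn \<delta> y"
    using hspace_comparison(2)[OF s b] by simp
qed

end

locale controlled_equation = eigenvalue_scale e \<alpha>
  for e :: "nat \<Rightarrow> 'h::{real_inner, banach, second_countable_topology}" and \<alpha> +
  fixes Q :: "'h \<Rightarrow> 'h" and lam :: "nat \<Rightarrow> real" and c \<beta> :: real and B :: "'h \<Rightarrow> 'h" and \<gamma> :: "real \<Rightarrow> real"
  assumes Q: "bounded_linear Q" and Q_basis: "\<And>k. Q (e k) = lam k *\<^sub>R e k"
    and c: "c > 0" and lam: "\<And>k. 1 / c * \<alpha> k powr (-\<beta>) \<le> lam k \<and> lam k \<le> c * \<alpha> k powr (-\<beta>)"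
    and beta: "0 \<le> \<beta>"
    and B_maps: "\<And>\<delta>. \<delta> \<in> {0..1 + 2 * \<beta>} \<Longrightarrow> B ` hspace \<alpha> e \<delta> \<subseteq> hspace \<alpha> e \<delta>"
    and B_Lipschitz: "\<And>\<delta> x y. \<delta> \<in> {0..1 + 2 * \<beta>} \<Longrightarrow> x \<in> hspace \<alpha> e \<delta> \<Longrightarrow> y \<in> hspace \<alpha> e \<delta> \<Longrightarrow>
           hnorm \<alpha> e \<delta> (B x - B y) \<le> \<gamma> \<delta> * hnorm \<alpha> e \<delta> (x - y)"
    and B_zero: "B 0 = 0"
begin

lemma B_in: "\<delta> \<in> {0..1 + 2 * \<beta>} \<Longrightarrow> x \<in> Hs \<delta> \<Longrightarrow> B x \<in> Hs \<delta>"
  using B_maps by blast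

lemma B_sqn:
  assumes "\<delta> \<in> {0..1 + 2 * \<beta>}" "x \<in> Hs \<delta>" "y \<in> Hs \<delta>"
  shows "sqn \<delta> (B x - B y) \<le> (\<gamma> \<delta>)\<^sup>2 * sqn \<delta> (x - y)"
proof -
  have 1: "0 \<le> sqn \<delta> (B x - B y)" "0 \<le> sqn \<delta> (x - y)"
    using assms by (auto intro!: sqn_nonneg hspace_diff B_in)
  have "(sqrt (sqn \<delta> (B x - B y)))\<^sup>2 \<le> (\<gamma> \<delta> * sqrt (sqn \<delta> (x - y)))\<^sup>2"
    using B_Lipschitz[OF assms] 1 by (intro power_mono) (auto simp: hnorm_eq)
  then show ?thesis using 1 by (simp add: power_mult_distrib)
qed

lemma zero_in_hspace [simp]: "0 \<in> Hs \<delta>" by (simp add: hspace_def)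

lemma B_sqn0:
  assumes "\<delta> \<in> {0..1 + 2 * \<beta>}" "x \<in> Hs \<delta>"
  shows "sqn \<delta> (B x) \<le> (\<gamma> \<delta>)\<^sup>2 * sqn \<delta> x"
  using B_sqn[OF assms zero_in_hspace] by (simp add: B_zero)

text \<open>The Lipschitz condition for \<open>\<delta> = 0\<close>, where the norm is the one of the ambient space.\<close>

lemma continuous_on_B: "continuous_on UNIV B"
proof -
  have "norm (B x - B y) \<le> \<bar>\<gamma> 0\<bar> * norm (x - y)" for x y
  proof (rule power2_le_imp_le)
    show "(norm (B x - B y))\<^sup>2 \<le> (\<bar>\<gamma> 0\<bar> * norm (x - y))\<^sup>2"
      using B_sqn[of 0 x y] beta by (simp add: hspace_zero sqn_zero power_mult_distrib)
  qed simp
  then have "\<bar>\<gamma> 0\<bar>-lipschitz_on UNIV B"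
    by (intro lipschitz_onI) (auto simp: dist_norm)
  then show ?thesis by (rule lipschitz_on_continuous_on)
qed

lemma lam_pos: "0 < lam k"
  using lam[of k] c by (smt (verit) alpha_pos divide_pos_pos mult_pos_pos powr_gt_zero zero_less_one less_irrefl)

lemma lam_sq_le: "(lam k)\<^sup>2 \<le> c\<^sup>2 * \<alpha> k powr (- 2 * \<beta>)"
proof -
  have "(lam k)\<^sup>2 \<le> (c * \<alpha> k powr (-\<beta>))\<^sup>2"
    using lam[of k] lam_pos[of k] by (intro power_mono) auto
  also have "\<dots> = c\<^sup>2 * \<alpha> k powr (- 2 * \<beta>)"
    by (simp add: power_mult_distrib power2_eq_square powr_add[symmetric])
  finally show ?thesis .
qed

text \<open>In terms of operators: \<open>Q\<^sup>-\<^sup>1\<close> maps \<open>H\<^sup>2\<^sup>\<beta>\<close> to \<open>H\<close> with norm at most \<open>c\<close>.\<close>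

lemma inverse_lam_sq_le: "1 / (lam k)\<^sup>2 \<le> c\<^sup>2 * \<alpha> k powr (2 * \<beta>)"
proof -
  have "1 / lam k \<le> c * \<alpha> k powr \<beta>"
  proof -
    have "1 \<le> c * \<alpha> k powr \<beta> * (1 / c * \<alpha> k powr (-\<beta>))"
      using c by (simp add: powr_minus field_simps)
    also have "\<dots> \<le> c * \<alpha> k powr \<beta> * lam k"
      using lam[of k] c by (intro mult_left_mono) auto
    finally show ?thesis using lam_pos[of k] by (simp add: pos_divide_le_eq)
  qed
  then have "(1 / lam k)\<^sup>2 \<le> (c * \<alpha> k powr \<beta>)\<^sup>2"
    using lam_pos[of k] by (intro power_mono) auto
  also have "\<dots> = c\<^sup>2 * \<alpha> k powr (2 * \<beta>)"
    by (simp add: power_mult_distrib power2_eq_square powr_add[symmetric])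
  finally show ?thesis by (simp add: power_divide)
qed

lemma inner_Q: "inner (Q x) (e k) = lam k * inner x (e k)"
  by (rule diagonal_operator_coefficient[OF Q Q_basis])

text \<open>The coefficients of \<open>\<mu> U'' + U' = A U + B(U) + Q \<psi>\<close> with \<open>V = U'\<close>, starting at rest at \<open>0\<close>. The
  equation is stated in integrated form, since the accelerations \<open>G k\<close> are merely integrable
  functions of time.\<close>

definition solves_wave_modes :: "real \<Rightarrow> real \<Rightarrow> (real \<Rightarrow> 'h) \<Rightarrow> (real \<Rightarrow> 'h) \<Rightarrow> (real \<Rightarrow> 'h) \<Rightarrow> bool" where
  "solves_wave_modes \<mu> T \<psi> U V \<longleftrightarrow>
     continuous_on {0..T} U \<and> continuous_on {0..T} V \<and> U 0 = 0 \<and> V 0 = 0 \<and>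
     (\<exists>G. \<forall>k. set_integrable lborel {0<..<T} (G k) \<and>
       (\<forall>t\<in>{0..T}. inner (V t) (e k) = (LINT s:{0<..<t}|lborel. G k s)) \<and>
       (\<forall>t\<in>{0..T}. inner (U t) (e k) = (LINT s:{0<..<t}|lborel. inner (V s) (e k))) \<and>
       (\<forall>s\<in>{0<..<T}. \<mu> * G k s =
         inner (B (U s)) (e k) + lam k * inner (\<psi> s) (e k) - inner (V s) (e k) - \<alpha> k * inner (U s) (e k)))"

end

section \<open>Regularity of paths of finite action\<close>

text \<open>One competitor in the infimum that defines \<open>V_limit\<close>: a path with its control.\<close>

locale parabolic_path = controlled_equation e \<alpha> Q lam c \<beta> B \<gamma>
  for e :: "nat \<Rightarrow> 'h::{real_inner, banach, second_countable_topology}" and \<alpha> Q lam c \<beta> B \<gamma> +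
  fixes E :: "real \<Rightarrow> 'h \<Rightarrow> 'h" and T :: real and \<psi> \<phi> :: "real \<Rightarrow> 'h"
  assumes E: "C0_semigroup E" and E_gen: "\<And>k. (e k, - \<alpha> k *\<^sub>R e k) \<in> generator E"
    and T: "0 < T" and psi: "\<psi> \<in> L2_time T" and phi_cont: "continuous_on {0..T} \<phi>" and phi0: "\<phi> 0 = 0"
    and mild: "mild_solution E B Q T \<psi> \<phi>"
begin

definition force :: "nat \<Rightarrow> real \<Rightarrow> real" where
  "force k s = inner (B (\<phi> s)) (e k) + lam k * inner (\<psi> s) (e k)"

lemma psi_integrable: "set_integrable lborel {0<..<T} \<psi>"
  by (rule L2_time_integrable[OF psi])

lemma psi_sq_integrable: "set_integrable lborel {0<..<T} (\<lambda>s. (norm (\<psi> s))\<^sup>2)"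
  using psi by (simp add: L2_time_def)

lemma B_phi_cont: "continuous_on {0..T} (\<lambda>s. B (\<phi> s))"
  by (rule continuous_on_compose2[OF continuous_on_B phi_cont]) auto

lemma inner_psi_integrable: "set_integrable lborel {0<..<T} (\<lambda>s. inner (\<psi> s) v)"
  using integrable_inner_left[of v lborel, OF psi_integrable[unfolded set_integrable_def]]
  by (simp add: set_integrable_def)

lemma force_integrable: "set_integrable lborel {0<..<T} (force k)"
  unfolding force_def[abs_def]
  by (intro set_integral_add set_integrable_mult_right inner_psi_integrable
      set_integrable_continuous_Ioo continuous_intros B_phi_cont)

lemma inner_psi_sq_integrable: "set_integrable lborel {0<..<T} (\<lambda>s. (inner (\<psi> s) (e k))\<^sup>2)"
proof (rule set_integrable_bound[OF psi_sq_integrable])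
  show "set_borel_measurable lborel {0<..<T} (\<lambda>s. (inner (\<psi> s) (e k))\<^sup>2)"
    by (intro set_borel_measurable_square set_integrable_imp_measurable inner_psi_integrable)
  have "norm ((inner (\<psi> s) (e k))\<^sup>2) \<le> norm ((norm (\<psi> s))\<^sup>2)" for s
    using norm_projection_le[of "\<psi> s" "Suc k"] Cauchy_Schwarz_ineq[of "\<psi> s" "e k"]
    by (simp add: inner_basis power2_norm_eq_inner)
  then show "AE s in lborel. s \<in> {0<..<T} \<longrightarrow> norm ((inner (\<psi> s) (e k))\<^sup>2) \<le> norm ((norm (\<psi> s))\<^sup>2)"
    by simp
qed

lemma force_sq_integrable: "set_integrable lborel {0<..<T} (\<lambda>s. (force k s)\<^sup>2)"
proof (rule set_integrable_bound[where f = "\<lambda>s. 2 * (inner (B (\<phi> s)) (e k))\<^sup>2 + 2 * ((lam k)\<^sup>2 * (inner (\<psi> s) (e k))\<^sup>2)"])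
  show "set_integrable lborel {0<..<T} (\<lambda>s. 2 * (inner (B (\<phi> s)) (e k))\<^sup>2 + 2 * ((lam k)\<^sup>2 * (inner (\<psi> s) (e k))\<^sup>2))"
    by (intro set_integral_add set_integrable_mult_right inner_psi_sq_integrable
        set_integrable_continuous_Ioo continuous_intros B_phi_cont)
  show "set_borel_measurable lborel {0<..<T} (\<lambda>s. (force k s)\<^sup>2)"
    by (intro set_borel_measurable_square set_integrable_imp_measurable force_integrable)
  have "norm ((force k s)\<^sup>2) \<le> norm (2 * (inner (B (\<phi> s)) (e k))\<^sup>2 + 2 * ((lam k)\<^sup>2 * (inner (\<psi> s) (e k))\<^sup>2))" for s
    using add_square_le[of "inner (B (\<phi> s)) (e k)" "lam k * inner (\<psi> s) (e k)"]
    by (simp add: force_def power_mult_distrib)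
  then show "AE s in lborel. s \<in> {0<..<T} \<longrightarrow> norm ((force k s)\<^sup>2) \<le>
      norm (2 * (inner (B (\<phi> s)) (e k))\<^sup>2 + 2 * ((lam k)\<^sup>2 * (inner (\<psi> s) (e k))\<^sup>2))"
    by simp
qed

lemma phi_coefficient:
  assumes t: "t \<in> {0..T}"
  shows "inner (\<phi> t) (e k) = (LINT s:{0<..<t}|lborel. exp (- \<alpha> k * (t - s)) * force k s)"
proof -
  have sub: "{0<..<t} \<subseteq> {0<..<T}" using t by auto
  have iB: "set_integrable lborel {0<..<t} (\<lambda>s. B (\<phi> s))"
    using t by (intro set_integrable_continuous_Ioo continuous_on_subset[OF B_phi_cont]) auto
  have iQ: "set_integrable lborel {0<..<t} (\<lambda>s. Q (\<psi> s))"
    using integrable_bounded_linear[OF Q set_integrable_subset[OF psi_integrable _ sub, unfolded set_integrable_def]] Q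
    by (simp add: set_integrable_def linear_simps)
  have scal: "set_integrable lborel {0<..<t} (\<lambda>s. exp (- \<alpha> k * (t - s)) * inner (g s) (e k))"
    if "set_integrable lborel {0<..<t} g" for g
    using integrable_inner_left[of "e k" lborel, OF that[unfolded set_integrable_def]]
    by (intro set_integrable_continuous_mult continuous_intros) (simp add: set_integrable_def)
  have "\<phi> t = (LINT s:{0<..<t}|lborel. E (t - s) (B (\<phi> s))) + (LINT s:{0<..<t}|lborel. E (t - s) (Q (\<psi> s)))"
    using mild t C0_bounded_linear[OF E, of t] by (simp add: mild_solution_def phi0 linear_simps)
  then have "inner (\<phi> t) (e k) = (LINT s:{0<..<t}|lborel. exp (- \<alpha> k * (t - s)) * inner (B (\<phi> s)) (e k)) +
      (LINT s:{0<..<t}|lborel. exp (- \<alpha> k * (t - s)) * inner (Q (\<psi> s)) (e k))"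
    by (simp add: inner_add_left semigroup_convolution_coefficient[OF E E_gen iB]
        semigroup_convolution_coefficient[OF E E_gen iQ])
  also have "\<dots> = (LINT s:{0<..<t}|lborel. exp (- \<alpha> k * (t - s)) * force k s)"
    unfolding force_def distrib_left inner_Q[symmetric]
    by (rule set_integral_add(2)[symmetric]) (intro scal iB iQ)+
  finally show ?thesis .
qed

lemma phi_integral_equation:
  assumes "t \<in> {0..T}"
  shows "inner (\<phi> t) (e k) = (LINT s:{0<..<t}|lborel. force k s - \<alpha> k * inner (\<phi> s) (e k))"
proof -
  have sub: "{0<..<t} \<subseteq> {0<..<T}" using assms by auto
  have "set_integrable lborel {0<..<t} (\<lambda>s. \<alpha> k * inner (\<phi> s) (e k))"
    using assms by (intro set_integrable_continuous_Ioo continuous_intros continuous_on_subset[OF phi_cont]) auto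
  then have "(LINT s:{0<..<t}|lborel. force k s - \<alpha> k * inner (\<phi> s) (e k)) =
      (LINT s:{0<..<t}|lborel. force k s) - (LINT s:{0<..<t}|lborel. \<alpha> k * inner (\<phi> s) (e k))"
    using set_integrable_subset[OF force_integrable _ sub] by (intro set_integral_diff) auto
  then show ?thesis
    using duhamel_imp_integral_equation(1)[OF force_integrable phi_coefficient assms, of k] by simp
qed

text \<open>In mode \<open>k\<close> the path is the convolution of the force with an exponential of rate \<open>\<alpha> k\<close>, which
  gains a factor \<open>1 / \<alpha> k\<close> for the squares, that is, one derivative. The force is square integrable in
  time with values in \<open>H\<^sup>\<delta>\<close>: the nonlinear part because \<open>B\<close> is Lipschitz on \<open>H\<^sup>\<delta>\<close>, the control
  because \<open>Q\<close> maps \<open>H\<close> to \<open>H\<^sup>2\<^sup>\<beta>\<close>; hence the restriction \<open>\<delta> \<le> 2 * \<beta>\<close>.\<close>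

lemma regularity_step:
  assumes d: "0 \<le> \<delta>" "\<delta> \<le> 2 * \<beta>" and M: "\<And>t. t \<in> {0..T} \<Longrightarrow> \<phi> t \<in> Hs \<delta> \<and> sqn \<delta> (\<phi> t) \<le> M"
  shows "\<exists>M'. \<forall>t\<in>{0..T}. \<phi> t \<in> Hs (\<delta> + 1) \<and> sqn (\<delta> + 1) (\<phi> t) \<le> M'"
proof -
  define c1 where "c1 = c\<^sup>2 * \<alpha> 0 powr (\<delta> - 2 * \<beta>)"
  have c1: "c1 \<ge> 0" by (simp add: c1_def)
  have lamc: "\<alpha> k powr \<delta> * (lam k)\<^sup>2 \<le> c1" for k
  proof -
    have "\<alpha> k powr \<delta> * (lam k)\<^sup>2 \<le> \<alpha> k powr \<delta> * (c\<^sup>2 * \<alpha> k powr (- 2 * \<beta>))"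
      by (intro mult_left_mono lam_sq_le) simp
    also have "\<dots> = c\<^sup>2 * \<alpha> k powr (\<delta> - 2 * \<beta>)" by (simp add: powr_diff powr_minus field_simps)
    also have "\<dots> \<le> c1" unfolding c1_def using d
      by (intro mult_left_mono powr_mono2') (auto simp: alpha_ge alpha0)
    finally show ?thesis .
  qed
  define h where "h s = (\<gamma> \<delta>)\<^sup>2 * M + c1 * (norm (\<psi> s))\<^sup>2" for s
  have hi: "set_integrable lborel {0<..<T} h"
    unfolding h_def[abs_def]
    by (intro set_integral_add set_integrable_mult_right psi_sq_integrable set_integrable_continuous_Ioo continuous_intros)
  have M0: "0 \<le> M" using M[of 0] T sqn_nonneg[of "\<phi> 0" \<delta>] by auto
  have h0: "0 \<le> h s" for s using M0 c1 by (simp add: h_def)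
  have "(\<Sum>k<m. \<alpha> k powr (\<delta> + 1) * (inner (\<phi> t) (e k))\<^sup>2) \<le> (LINT s:{0<..<T}|lborel. h s)"
    if t: "t \<in> {0..T}" for t m
  proof -
    have sub: "{0<..<t} \<subseteq> {0<..<T}" using t by auto
    have fi: "set_integrable lborel {0<..<t} (\<lambda>s. (force k s)\<^sup>2)" for k
      by (rule set_integrable_subset[OF force_sq_integrable _ sub]) simp
    have fm: "set_borel_measurable lborel {0<..<t} (force k)" for k
      using set_integrable_subset[OF force_integrable _ sub, of k]
      by (simp add: set_integrable_def set_borel_measurable_def borel_measurable_integrable)
    have "\<alpha> k powr (\<delta> + 1) * (inner (\<phi> t) (e k))\<^sup>2 \<le> (LINT s:{0<..<t}|lborel. \<alpha> k powr \<delta> / 2 * (force k s)\<^sup>2)" for k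
    proof -
      have "(inner (\<phi> t) (e k))\<^sup>2 \<le> (LINT s:{0<..<t}|lborel. (force k s)\<^sup>2) / (2 * \<alpha> k)"
        unfolding phi_coefficient[OF t] using t
        by (intro exponential_convolution_square_bound fi fm) auto
      then have "\<alpha> k powr (\<delta> + 1) * (inner (\<phi> t) (e k))\<^sup>2 \<le>
          \<alpha> k powr (\<delta> + 1) * ((LINT s:{0<..<t}|lborel. (force k s)\<^sup>2) / (2 * \<alpha> k))"
        by (intro mult_left_mono) auto
      also have "\<dots> = \<alpha> k powr \<delta> / 2 * (LINT s:{0<..<t}|lborel. (force k s)\<^sup>2)"
        by (simp add: powr_add)
      also have "\<dots> = (LINT s:{0<..<t}|lborel. \<alpha> k powr \<delta> / 2 * (force k s)\<^sup>2)" by simp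
      finally show ?thesis .
    qed
    then have "(\<Sum>k<m. \<alpha> k powr (\<delta> + 1) * (inner (\<phi> t) (e k))\<^sup>2) \<le>
        (\<Sum>k<m. LINT s:{0<..<t}|lborel. \<alpha> k powr \<delta> / 2 * (force k s)\<^sup>2)"
      by (intro sum_mono)
    also have "\<dots> = (LINT s:{0<..<t}|lborel. (\<Sum>k<m. \<alpha> k powr \<delta> / 2 * (force k s)\<^sup>2))"
      unfolding set_lebesgue_integral_def scaleR_sum_right
      using set_integrable_mult_right[OF fi, unfolded set_integrable_def]
      by (intro Bochner_Integration.integral_sum[symmetric])
    also have "\<dots> \<le> (LINT s:{0<..<t}|lborel. h s)"
    proof (rule set_integral_mono)
      show "set_integrable lborel {0<..<t} (\<lambda>s. \<Sum>k<m. \<alpha> k powr \<delta> / 2 * (force k s)\<^sup>2)"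
        unfolding set_integrable_def scaleR_sum_right
        using set_integrable_mult_right[OF fi, unfolded set_integrable_def]
        by (intro Bochner_Integration.integrable_sum)
      show "set_integrable lborel {0<..<t} h" by (rule set_integrable_subset[OF hi _ sub]) simp
      fix s assume s: "s \<in> {0<..<t}"
      then have sT: "s \<in> {0..T}" using t by auto
      have dd: "\<delta> \<in> {0..1 + 2 * \<beta>}" using d by auto
      have "\<alpha> k powr \<delta> / 2 * (force k s)\<^sup>2 \<le> \<alpha> k powr \<delta> * (inner (B (\<phi> s)) (e k))\<^sup>2 + c1 * (inner (\<psi> s) (e k))\<^sup>2" for k
      proof -
        have "\<alpha> k powr \<delta> / 2 * (force k s)\<^sup>2 \<le>
            \<alpha> k powr \<delta> / 2 * (2 * (inner (B (\<phi> s)) (e k))\<^sup>2 + 2 * (lam k * inner (\<psi> s) (e k))\<^sup>2)"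
          unfolding force_def by (intro mult_left_mono add_square_le) simp
        also have "\<dots> = \<alpha> k powr \<delta> * (inner (B (\<phi> s)) (e k))\<^sup>2 + \<alpha> k powr \<delta> * (lam k)\<^sup>2 * (inner (\<psi> s) (e k))\<^sup>2"
          by (simp add: power_mult_distrib algebra_simps)
        also have "\<dots> \<le> \<alpha> k powr \<delta> * (inner (B (\<phi> s)) (e k))\<^sup>2 + c1 * (inner (\<psi> s) (e k))\<^sup>2"
          by (intro add_left_mono mult_right_mono lamc) simp
        finally show ?thesis .
      qed
      then have "(\<Sum>k<m. \<alpha> k powr \<delta> / 2 * (force k s)\<^sup>2) \<le>
          (\<Sum>k<m. \<alpha> k powr \<delta> * (inner (B (\<phi> s)) (e k))\<^sup>2 + c1 * (inner (\<psi> s) (e k))\<^sup>2)"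
        by (intro sum_mono)
      also have "\<dots> = (\<Sum>k<m. \<alpha> k powr \<delta> * (inner (B (\<phi> s)) (e k))\<^sup>2) + c1 * (\<Sum>k<m. (inner (\<psi> s) (e k))\<^sup>2)"
        by (simp add: sum.distrib sum_distrib_left)
      also have "\<dots> \<le> sqn \<delta> (B (\<phi> s)) + c1 * (norm (\<psi> s))\<^sup>2"
      proof (intro add_mono mult_left_mono c1)
        show "(\<Sum>k<m. \<alpha> k powr \<delta> * (inner (B (\<phi> s)) (e k))\<^sup>2) \<le> sqn \<delta> (B (\<phi> s))"
          using M[OF sT] B_in[OF dd] by (intro partial_sum_le_sqn) auto
        show "(\<Sum>k<m. (inner (\<psi> s) (e k))\<^sup>2) \<le> (norm (\<psi> s))\<^sup>2"
          using parseval[of "\<psi> s"] sum_le_suminf[of "\<lambda>k. (inner (\<psi> s) (e k))\<^sup>2" "{..<m}"]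
          by (simp add: sums_iff)
      qed
      also have "sqn \<delta> (B (\<phi> s)) \<le> (\<gamma> \<delta>)\<^sup>2 * M"
        using M[OF sT] by (intro order_trans[OF B_sqn0[OF dd]] mult_left_mono) auto
      finally show "(\<Sum>k<m. \<alpha> k powr \<delta> / 2 * (force k s)\<^sup>2) \<le> h s" by (simp add: h_def)
    qed
    also have "\<dots> \<le> (LINT s:{0<..<T}|lborel. h s)"
      unfolding set_lebesgue_integral_def
      using hi set_integrable_subset[OF hi _ sub] sub h0
      by (intro Bochner_Integration.integral_mono) (auto simp: set_integrable_def indicator_def)
    finally show ?thesis .
  qed
  then show ?thesis using hspaceI by blast
qed

text \<open>Repeated gain of one derivative reaches \<open>H\<^sup>2\<^sup>\<beta>\<close> after finitely many steps, and one further step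
  is possible from there.\<close>

lemma parabolic_regularity: "\<exists>M. \<forall>t\<in>{0..T}. \<phi> t \<in> Hs (1 + 2 * \<beta>) \<and> sqn (1 + 2 * \<beta>) (\<phi> t) \<le> M"
proof -
  have "\<exists>M. \<forall>t\<in>{0..T}. \<phi> t \<in> Hs (min (real n) (2 * \<beta>)) \<and> sqn (min (real n) (2 * \<beta>)) (\<phi> t) \<le> M" for n
  proof (induction n)
    case 0
    have "bounded (\<phi> ` {0..T})"
      using phi_cont by (intro compact_imp_bounded compact_continuous_image) auto
    then obtain M where "\<forall>x\<in>\<phi> ` {0..T}. norm x \<le> M" unfolding bounded_iff by blast
    then have "\<forall>t\<in>{0..T}. (norm (\<phi> t))\<^sup>2 \<le> M\<^sup>2" by (auto intro!: power_mono)
    moreover have "min (real 0) (2 * \<beta>) = 0" using beta by simp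
    ultimately show ?case by (auto simp: hspace_zero sqn_zero)
  next
    case (Suc n)
    then obtain M where M: "\<And>t. t \<in> {0..T} \<Longrightarrow> \<phi> t \<in> Hs (min (real n) (2 * \<beta>)) \<and> sqn (min (real n) (2 * \<beta>)) (\<phi> t) \<le> M"
      by blast
    obtain M' where M': "\<And>t. t \<in> {0..T} \<Longrightarrow> \<phi> t \<in> Hs (min (real n) (2 * \<beta>) + 1) \<and> sqn (min (real n) (2 * \<beta>) + 1) (\<phi> t) \<le> M'"
      using regularity_step[OF _ _ M] beta by (metis min.cobounded2 min_def of_nat_0_le_iff mult_nonneg_nonneg zero_le_numeral)
    define p where "p = min (real (Suc n)) (2 * \<beta>)"
    define q where "q = min (real n) (2 * \<beta>) + 1"
    have pq: "p \<le> q" by (auto simp: p_def q_def)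
    have "\<phi> t \<in> Hs p \<and> sqn p (\<phi> t) \<le> \<alpha> 0 powr (p - q) * M'" if t: "t \<in> {0..T}" for t
    proof -
      have q: "\<phi> t \<in> Hs q" "sqn q (\<phi> t) \<le> M'" using M'[OF t] by (auto simp: q_def)
      have "sqn p (\<phi> t) \<le> \<alpha> 0 powr (p - q) * sqn q (\<phi> t)" by (rule hspace_mono(2)[OF pq q(1)])
      also have "\<dots> \<le> \<alpha> 0 powr (p - q) * M'" by (intro mult_left_mono q(2)) simp
      finally show ?thesis using hspace_mono(1)[OF pq q(1)] by simp
    qed
    then show ?case unfolding p_def[symmetric] by blast
  qed
  moreover obtain n where "2 * \<beta> \<le> real n" using real_arch_simple by blast
  then have "min (real n) (2 * \<beta>) = 2 * \<beta>" by simp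
  ultimately obtain M where "\<And>t. t \<in> {0..T} \<Longrightarrow> \<phi> t \<in> Hs (2 * \<beta>) \<and> sqn (2 * \<beta>) (\<phi> t) \<le> M"
    by metis
  from regularity_step[OF _ _ this] beta show ?thesis by (simp add: add.commute)
qed

end

section \<open>Mild solutions of the wave equation\<close>

locale wave_semigroup = eigenvalue_scale e \<alpha>
  for e :: "nat \<Rightarrow> 'h::{real_inner, banach, second_countable_topology}" and \<alpha> +
  fixes \<iota> :: "'h \<Rightarrow> 'g::{real_inner, banach, second_countable_topology}"
    and S :: "real \<Rightarrow> 'h \<times> 'g \<Rightarrow> 'h \<times> 'g" and \<mu> :: real
  assumes iota: "is_H_minus_1 \<alpha> e \<iota>" and mu: "\<mu> > 0"
    and S: "C0_semigroup S" and S_gen: "generator S = A_mu \<alpha> e \<iota> \<mu>"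
begin

lemma bounded_linear_iota: "bounded_linear \<iota>"
proof -
  have "norm (\<iota> x) \<le> norm x * sqrt (\<alpha> 0 powr (- 1))" for x
  proof -
    have "sqn (- 1) x \<le> \<alpha> 0 powr (- 1) * (norm x)\<^sup>2"
      using hspace_mono(2)[of "- 1" 0 x] by (simp add: hspace_zero sqn_zero)
    then have "sqrt (sqn (- 1) x) \<le> sqrt (\<alpha> 0 powr (- 1) * (norm x)\<^sup>2)" by (rule real_sqrt_le_mono)
    moreover have "norm (\<iota> x) = sqrt (sqn (- 1) x)" using iota by (simp add: is_H_minus_1_def hnorm_eq)
    moreover have "sqrt (\<alpha> 0 powr (- 1) * (norm x)\<^sup>2) = norm x * sqrt (\<alpha> 0 powr (- 1))"
      by (simp only: real_sqrt_mult real_sqrt_abs abs_norm_cancel mult.commute[of _ "norm x"])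
    ultimately show ?thesis by linarith
  qed
  moreover have "linear \<iota>" using iota by (simp add: is_H_minus_1_def)
  ultimately show ?thesis by (auto simp: bounded_linear_def bounded_linear_axioms_def)
qed

abbreviation position_mode :: "nat \<Rightarrow> 'h \<times> 'g" where "position_mode k \<equiv> (e k, 0)"
abbreviation velocity_mode :: "nat \<Rightarrow> 'h \<times> 'g" where "velocity_mode k \<equiv> (0, \<iota> (e k))"

lemma A_ext_basis: "A_ext \<alpha> e \<iota> (e k) = - \<alpha> k *\<^sub>R \<iota> (e k)"
proof -
  have "(\<lambda>j. (- \<alpha> j * inner (e k) (e j)) *\<^sub>R \<iota> (e j)) = (\<lambda>j. if j = k then - \<alpha> j *\<^sub>R \<iota> (e j) else 0)"
    by (auto simp: inner_basis)
  then show ?thesis unfolding A_ext_def using sums_single[of k "\<lambda>j. - \<alpha> j *\<^sub>R \<iota> (e j)"]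
    by (simp add: sums_iff)
qed

lemma basis_in_hspace: "e k \<in> Hs \<delta>"
proof -
  have "(\<lambda>j. \<alpha> j powr \<delta> * (inner (e k) (e j))\<^sup>2) = (\<lambda>j. if j = k then \<alpha> j powr \<delta> else 0)"
    by (auto simp: inner_basis)
  then show ?thesis using sums_single[of k "\<lambda>j. \<alpha> j powr \<delta>"] by (simp add: hspace_def sums_iff)
qed

lemma generator_position_mode: "(position_mode k, (- \<alpha> k / \<mu>) *\<^sub>R velocity_mode k) \<in> generator S"
proof -
  have "\<exists>u v. (position_mode k, (- \<alpha> k / \<mu>) *\<^sub>R velocity_mode k) =
      ((u, \<iota> v), (v, (1 / \<mu>) *\<^sub>R A_ext \<alpha> e \<iota> u - (1 / \<mu>) *\<^sub>R \<iota> v)) \<and> u \<in> Hs 1"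
    by (rule exI[of _ "e k"], rule exI[of _ 0])
       (simp add: linear_0[OF bounded_linear.linear[OF bounded_linear_iota]] A_ext_basis basis_in_hspace)
  then show ?thesis unfolding S_gen A_mu_def by blast
qed

lemma generator_velocity_mode: "(velocity_mode k, position_mode k - (1 / \<mu>) *\<^sub>R velocity_mode k) \<in> generator S"
proof -
  have A0: "A_ext \<alpha> e \<iota> 0 = 0" by (simp add: A_ext_def)
  have "0 \<in> Hs 1" by (simp add: hspace_def)
  then have "\<exists>u v. (velocity_mode k, position_mode k - (1 / \<mu>) *\<^sub>R velocity_mode k) =
      ((u, \<iota> v), (v, (1 / \<mu>) *\<^sub>R A_ext \<alpha> e \<iota> u - (1 / \<mu>) *\<^sub>R \<iota> v)) \<and> u \<in> Hs 1"
    by (intro exI[of _ 0] exI[of _ "e k"]) (simp add: A0)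
  then show ?thesis unfolding S_gen A_mu_def by blast
qed

lemma reversed_orbit_derivative:
  assumes xy: "(x, y) \<in> generator S" and s: "s \<in> {0..t}"
  shows "((\<lambda>s. inner (S (t - s) x) \<zeta>) has_real_derivative - inner (S (t - s) y) \<zeta>) (at s within {0..t})"
proof -
  have "((\<lambda>r. S r x) has_vector_derivative S (t - s) y) (at (t - s) within {0..})"
    using s by (intro C0_generator_derivative[OF S xy]) auto
  then have "((\<lambda>r. S r x) has_vector_derivative S (t - s) y) (at (t - s) within (\<lambda>s. t - s) ` {0..t})"
    by (rule has_vector_derivative_within_subset) auto
  moreover have "((\<lambda>s. t - s) has_vector_derivative - 1) (at s within {0..t})"
    by (auto intro!: derivative_eq_intros)
  ultimately have "((\<lambda>s. S (t - s) x) has_vector_derivative - 1 *\<^sub>R S (t - s) y) (at s within {0..t})"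
    using vector_diff_chain_within[of "\<lambda>s. t - s" "- 1" s "{0..t}" "\<lambda>r. S r x"] by (simp add: o_def)
  then have "((\<lambda>s. inner (S (t - s) x) \<zeta>) has_vector_derivative inner (- 1 *\<^sub>R S (t - s) y) \<zeta>) (at s within {0..t})"
    by (rule bounded_linear.has_vector_derivative[OF bounded_linear_inner_left])
  then show ?thesis by (simp add: has_real_derivative_iff_has_vector_derivative)
qed

lemma reversed_orbit_continuous: "continuous_on {0..t} (\<lambda>s. S (t - s) x)"
  by (rule continuous_on_compose2[OF C0_continuous_on[OF S]]) (auto intro!: continuous_intros)

text \<open>Each mode is invariant under the semigroup, on which it acts by the exponential of a matrix of size
  two. The exponential need not be known: \<open>U\<close> and \<open>V\<close> are integrated by parts against the orbits
  of the two basis vectors of the mode, whose derivatives are given by the generator. Pairing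
  with a fixed vector \<open>\<zeta>\<close> makes the functions scalar.\<close>

lemma mode_variation_of_constants:
  assumes t: "0 \<le> t" and G: "set_integrable lborel {0<..<t} G"
    and V: "\<And>s. s \<in> {0..t} \<Longrightarrow> V s = (LINT r:{0<..<s}|lborel. G r)"
    and U: "\<And>s. s \<in> {0..t} \<Longrightarrow> U s = (LINT r:{0<..<s}|lborel. V r)"
    and eq: "\<And>s. s \<in> {0<..<t} \<Longrightarrow> \<mu> * G s = f s - V s - \<alpha> k * U s"
    and int: "set_integrable lborel {0<..<t} (\<lambda>s. f s *\<^sub>R S (t - s) ((1 / \<mu>) *\<^sub>R velocity_mode k))"
  shows "(U t *\<^sub>R e k, V t *\<^sub>R \<iota> (e k)) = (LINT s:{0<..<t}|lborel. f s *\<^sub>R S (t - s) ((1 / \<mu>) *\<^sub>R velocity_mode k))"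
proof (rule vector_eq_rdot[THEN iffD1], rule allI)
  fix \<zeta> :: "'h \<times> 'g"
  define p1 where "p1 s = inner (S (t - s) (position_mode k)) \<zeta>" for s
  define p2 where "p2 s = inner (S (t - s) (velocity_mode k)) \<zeta>" for s
  have lin: "bounded_linear (S (t - s))" if "s \<in> {0..t}" for s
    using that by (intro C0_bounded_linear[OF S]) auto
  have d1: "(p1 has_real_derivative \<alpha> k / \<mu> * p2 s) (at s within {0..t})" if "s \<in> {0..t}" for s
  proof -
    have "- inner (S (t - s) ((- \<alpha> k / \<mu>) *\<^sub>R velocity_mode k)) \<zeta> = \<alpha> k / \<mu> * p2 s"
      unfolding linear_scale[OF bounded_linear.linear[OF lin[OF that]]] p2_def by simp
    then show ?thesis
      using reversed_orbit_derivative[OF generator_position_mode[of k] that, where \<zeta> = \<zeta>]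
      by (simp only: p1_def[abs_def])
  qed
  have d2: "(p2 has_real_derivative p2 s / \<mu> - p1 s) (at s within {0..t})" if "s \<in> {0..t}" for s
  proof -
    have "- inner (S (t - s) (position_mode k - (1 / \<mu>) *\<^sub>R velocity_mode k)) \<zeta> = p2 s / \<mu> - p1 s"
      unfolding linear_diff[OF bounded_linear.linear[OF lin[OF that]]] linear_scale[OF bounded_linear.linear[OF lin[OF that]]] p1_def p2_def
      by (simp add: inner_diff_left)
    then show ?thesis
      using reversed_orbit_derivative[OF generator_velocity_mode[of k] that, where \<zeta> = \<zeta>]
      by (simp only: p2_def[abs_def])
  qed
  have c1: "continuous_on {0..t} p1" and c2: "continuous_on {0..t} p2"
    unfolding p1_def[abs_def] p2_def[abs_def] by (intro continuous_intros reversed_orbit_continuous)+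
  have Vc: "continuous_on {0..t} V"
    by (rule continuous_on_eq[OF continuous_on_primitive[OF G]]) (simp add: V)
  have Vi: "set_integrable lborel {0<..<t} V" by (rule set_integrable_continuous_Ioo[OF Vc])
  have Uc: "continuous_on {0..t} U"
    by (rule continuous_on_eq[OF continuous_on_primitive[OF Vi]]) (simp add: U)
  have I1: "(LINT s:{0<..<t}|lborel. V s * p1 s) = U t * p1 t - (LINT s:{0<..<t}|lborel. U s * (\<alpha> k / \<mu> * p2 s))"
    by (rule integration_by_parts_primitive[OF t Vi d1 _ U]) (use mu in \<open>auto intro!: continuous_intros c2\<close>)
  have I2: "(LINT s:{0<..<t}|lborel. G s * p2 s) = V t * p2 t - (LINT s:{0<..<t}|lborel. V s * (p2 s / \<mu> - p1 s))"
    by (rule integration_by_parts_primitive[OF t G d2 _ V]) (use mu in \<open>auto intro!: continuous_intros c1 c2\<close>)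
  have i1: "set_integrable lborel {0<..<t} (\<lambda>s. V s * p1 s)"
    "set_integrable lborel {0<..<t} (\<lambda>s. U s * (\<alpha> k / \<mu> * p2 s))"
    "set_integrable lborel {0<..<t} (\<lambda>s. V s * (p2 s / \<mu> - p1 s))"
    by (rule set_integrable_continuous_Ioo, use mu in \<open>auto intro!: continuous_intros c1 c2 Vc Uc\<close>)+
  have i2: "set_integrable lborel {0<..<t} (\<lambda>s. G s * p2 s)"
    using set_integrable_continuous_mult[OF G c2] by (simp add: mult.commute)
  have pt: "p1 t = inner (position_mode k) \<zeta>" "p2 t = inner (velocity_mode k) \<zeta>"
    using C0_zero[OF S] by (simp_all add: p1_def p2_def)
  have "inner (LINT s:{0<..<t}|lborel. f s *\<^sub>R S (t - s) ((1 / \<mu>) *\<^sub>R velocity_mode k)) \<zeta> =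
      (LINT s:{0<..<t}|lborel. f s * (p2 s / \<mu>))"
  proof -
    have "inner (LINT s:{0<..<t}|lborel. f s *\<^sub>R S (t - s) ((1 / \<mu>) *\<^sub>R velocity_mode k)) \<zeta> =
        (LINT s|lborel. inner (indicator {0<..<t} s *\<^sub>R f s *\<^sub>R S (t - s) ((1 / \<mu>) *\<^sub>R velocity_mode k)) \<zeta>)"
      unfolding set_lebesgue_integral_def
      using int by (intro integral_inner_left[symmetric]) (simp add: set_integrable_def)
    also have "\<dots> = (LINT s:{0<..<t}|lborel. f s * (p2 s / \<mu>))"
      unfolding set_lebesgue_integral_def
    proof (rule Bochner_Integration.integral_cong[OF refl])
      fix s
      show "inner (indicator {0<..<t} s *\<^sub>R f s *\<^sub>R S (t - s) ((1 / \<mu>) *\<^sub>R velocity_mode k)) \<zeta> =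
          indicator {0<..<t} s *\<^sub>R (f s * (p2 s / \<mu>))"
      proof (cases "s \<in> {0<..<t}")
        case True
        then have "S (t - s) ((1 / \<mu>) *\<^sub>R velocity_mode k) = (1 / \<mu>) *\<^sub>R S (t - s) (velocity_mode k)"
          by (intro linear_scale[OF bounded_linear.linear[OF lin]]) auto
        then show ?thesis by (simp only: inner_scaleR_left p2_def) simp
      qed simp
    qed
    finally show ?thesis .
  qed
  also have "\<dots> = (LINT s:{0<..<t}|lborel. G s * p2 s + (V s * (p2 s / \<mu> - p1 s) + (V s * p1 s + U s * (\<alpha> k / \<mu> * p2 s))))"
  proof (intro set_lebesgue_integral_cong allI impI)
    fix s assume "s \<in> {0<..<t}"
    then have f: "f s = \<mu> * G s + V s + \<alpha> k * U s" using eq by simp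
    show "f s * (p2 s / \<mu>) = G s * p2 s + (V s * (p2 s / \<mu> - p1 s) + (V s * p1 s + U s * (\<alpha> k / \<mu> * p2 s)))"
      unfolding f using mu by (simp add: algebra_simps add_divide_distrib)
  qed simp
  also have "\<dots> = (LINT s:{0<..<t}|lborel. G s * p2 s) + ((LINT s:{0<..<t}|lborel. V s * (p2 s / \<mu> - p1 s)) +
      ((LINT s:{0<..<t}|lborel. V s * p1 s) + (LINT s:{0<..<t}|lborel. U s * (\<alpha> k / \<mu> * p2 s))))"
    by (simp only: set_integral_add(2)[OF i1(1,2)] set_integral_add(2)[OF i1(3) set_integral_add(1)[OF i1(1,2)]]
        set_integral_add(2)[OF i2 set_integral_add(1)[OF i1(3) set_integral_add(1)[OF i1(1,2)]]])
  also have "\<dots> = V t * p2 t + U t * p1 t" unfolding I1 I2 by simp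
  also have "\<dots> = inner (U t *\<^sub>R e k, V t *\<^sub>R \<iota> (e k)) \<zeta>" by (cases \<zeta>) (simp add: pt)
  finally show "inner (U t *\<^sub>R e k, V t *\<^sub>R \<iota> (e k)) \<zeta> =
      inner (LINT s:{0<..<t}|lborel. f s *\<^sub>R S (t - s) ((1 / \<mu>) *\<^sub>R velocity_mode k)) \<zeta>" by simp
qed

end

locale controlled_wave = controlled_equation e \<alpha> Q lam c \<beta> B \<gamma> + wave_semigroup e \<alpha> \<iota> S \<mu>
  for e :: "nat \<Rightarrow> 'h::{real_inner, banach, second_countable_topology}" and \<alpha> Q lam c \<beta> B \<gamma>
    and \<iota> :: "'h \<Rightarrow> 'g::{real_inner, banach, second_countable_topology}" and S \<mu>
begin

text \<open>Both sides of the mild equation are sums of their modes: the left one since \<open>\<iota>\<close> is bounded, the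
  right one by \<open>integral_of_operator_family_sums\<close>. The modes agree by
  \<open>mode_variation_of_constants\<close>.\<close>

lemma mild_solution_from_modes:
  assumes psi: "set_integrable lborel {0<..<T} \<psi>" and modes: "solves_wave_modes \<mu> T \<psi> U V"
  shows "mild_solution S (B_mu \<iota> B \<mu>) (Q_mu \<iota> Q \<mu>) T \<psi> (\<lambda>t. (U t, \<iota> (V t)))"
  unfolding mild_solution_def
proof
  have Uc: "continuous_on {0..T} U" and U0: "U 0 = 0" and V0: "V 0 = 0"
    using modes by (simp_all add: solves_wave_modes_def)
  obtain G where G: "\<And>k. set_integrable lborel {0<..<T} (G k)"
    and V: "\<And>k t. t \<in> {0..T} \<Longrightarrow> inner (V t) (e k) = (LINT s:{0<..<t}|lborel. G k s)"
    and U: "\<And>k t. t \<in> {0..T} \<Longrightarrow> inner (U t) (e k) = (LINT s:{0<..<t}|lborel. inner (V s) (e k))"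
    and eq: "\<And>k s. s \<in> {0<..<T} \<Longrightarrow> \<mu> * G k s =
      inner (B (U s)) (e k) + lam k * inner (\<psi> s) (e k) - inner (V s) (e k) - \<alpha> k * inner (U s) (e k)"
    using modes unfolding solves_wave_modes_def by blast
  fix t assume t: "t \<in> {0..T}"
  then have sub: "{0<..<t} \<subseteq> {0<..<T}" by auto
  define L where "L s y = S (t - s) ((1 / \<mu>) *\<^sub>R (0, \<iota> y))" for s y
  interpret i: bounded_linear \<iota> by (rule bounded_linear_iota)
  have inj: "bounded_linear (\<lambda>y. (1 / \<mu>) *\<^sub>R ((0, \<iota> y) :: 'h \<times> 'g))"
    by (intro bounded_linear_const_scaleR bounded_linear_Pair bounded_linear_zero bounded_linear_iota)
  have bl: "bounded_linear (L s)" if "s \<in> {0<..<t}" for s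
    using that unfolding L_def[abs_def] by (intro bounded_linear_compose[OF C0_bounded_linear[OF S] inj]) auto
  obtain K1 where K1: "K1 \<ge> 0" "\<And>r x. r \<in> {0..t} \<Longrightarrow> norm (S r x) \<le> K1 * norm x"
    using C0_bounded_on_compact[OF S, of t] by blast
  obtain K2 where K2: "\<And>y. norm ((1 / \<mu>) *\<^sub>R ((0, \<iota> y) :: 'h \<times> 'g)) \<le> norm y * K2"
    using bounded_linear.bounded[OF inj] by blast
  have bd: "norm (L s y) \<le> K1 * K2 * norm y" if "s \<in> {0<..<t}" for s y
  proof -
    have "norm (L s y) \<le> K1 * norm ((1 / \<mu>) *\<^sub>R ((0, \<iota> y) :: 'h \<times> 'g))"
      unfolding L_def using that by (intro K1(2)) auto
    also have "\<dots> \<le> K1 * (norm y * K2)" by (intro mult_left_mono K2 K1)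
    finally show ?thesis by (simp add: mult_ac)
  qed
  have cont: "continuous_on {0<..<t} (\<lambda>s. L s (e k))" for k
    unfolding L_def by (rule continuous_on_subset[OF reversed_orbit_continuous]) auto
  have fB: "set_integrable lborel {0<..<t} (\<lambda>s. B (U s))"
    using t by (intro set_integrable_continuous_Ioo continuous_on_compose2[OF continuous_on_B continuous_on_subset[OF Uc]]) auto
  have psit: "set_integrable lborel {0<..<t} \<psi>" by (rule set_integrable_subset[OF psi _ sub]) simp
  have fQ: "set_integrable lborel {0<..<t} (\<lambda>s. Q (\<psi> s))"
    using integrable_bounded_linear[OF Q psit[unfolded set_integrable_def]] Q
    by (simp add: set_integrable_def linear_simps)
  define f where "f s = B (U s) + Q (\<psi> s)" for s
  have f: "set_integrable lborel {0<..<t} f"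
    unfolding f_def[abs_def] by (rule set_integral_add(1)[OF fB fQ])
  note conv = integral_of_operator_family_sums[where L = L, OF _ bl bd cont]
  have mode: "(LINT s:{0<..<t}|lborel. inner (f s) (e k) *\<^sub>R L s (e k)) =
      (inner (U t) (e k) *\<^sub>R e k, inner (V t) (e k) *\<^sub>R \<iota> (e k))" for k
    unfolding L_def
  proof (rule mode_variation_of_constants[symmetric, where G = "G k" and V = "\<lambda>s. inner (V s) (e k)" and U = "\<lambda>s. inner (U s) (e k)"])
    show "0 \<le> t" using t by simp
    show "set_integrable lborel {0<..<t} (G k)" by (rule set_integrable_subset[OF G _ sub]) simp
    show "inner (V s) (e k) = (LINT r:{0<..<s}|lborel. G k r)" if "s \<in> {0..t}" for s
      using that t by (intro V) auto
    show "inner (U s) (e k) = (LINT r:{0<..<s}|lborel. inner (V r) (e k))" if "s \<in> {0..t}" for s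
      using that t by (intro U) auto
    show "\<mu> * G k s = inner (f s) (e k) - inner (V s) (e k) - \<alpha> k * inner (U s) (e k)" if "s \<in> {0<..<t}" for s
      using that t eq[of s k] by (simp add: f_def inner_add_left inner_Q)
    show "set_integrable lborel {0<..<t} (\<lambda>s. inner (f s) (e k) *\<^sub>R S (t - s) ((1 / \<mu>) *\<^sub>R velocity_mode k))"
      using conv(3)[OF f, of k] by (simp add: L_def)
  qed
  have "(\<lambda>k. (inner (U t) (e k) *\<^sub>R e k, inner (V t) (e k) *\<^sub>R \<iota> (e k))) sums (LINT s:{0<..<t}|lborel. L s (f s))"
    using conv(2)[OF f] by (simp only: mode)
  moreover have "(\<lambda>k. (inner (U t) (e k) *\<^sub>R e k, inner (V t) (e k) *\<^sub>R \<iota> (e k))) sums (U t, \<iota> (V t))"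
  proof -
    have "(\<lambda>k. \<iota> (inner (V t) (e k) *\<^sub>R e k)) sums \<iota> (V t)" by (rule i.sums[OF expansion])
    then have "(\<lambda>k. inner (V t) (e k) *\<^sub>R \<iota> (e k)) sums \<iota> (V t)" by (simp add: i.scaleR)
    then have "(\<lambda>k. ((0 :: 'h), inner (V t) (e k) *\<^sub>R \<iota> (e k))) sums (0, \<iota> (V t))"
      by (rule bounded_linear.sums[OF bounded_linear_Pair[OF bounded_linear_zero bounded_linear_ident]])
    moreover have "(\<lambda>k. (inner (U t) (e k) *\<^sub>R e k, (0 :: 'g))) sums (U t, 0)"
      by (rule bounded_linear.sums[OF bounded_linear_Pair[OF bounded_linear_ident bounded_linear_zero] expansion])
    ultimately have "(\<lambda>k. (inner (U t) (e k) *\<^sub>R e k, (0 :: 'g)) + (0, inner (V t) (e k) *\<^sub>R \<iota> (e k))) sums ((U t, 0) + (0, \<iota> (V t)))"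
      by (intro sums_add)
    then show ?thesis by simp
  qed
  ultimately have "(U t, \<iota> (V t)) = (LINT s:{0<..<t}|lborel. L s (f s))" by (rule sums_unique2[symmetric])
  also have "\<dots> = (LINT s:{0<..<t}|lborel. L s (B (U s)) + L s (Q (\<psi> s)))"
    by (intro set_lebesgue_integral_cong) (auto simp: f_def linear_add[OF bounded_linear.linear[OF bl]])
  also have "\<dots> = (LINT s:{0<..<t}|lborel. L s (B (U s))) + (LINT s:{0<..<t}|lborel. L s (Q (\<psi> s)))"
    by (rule set_integral_add(2)[OF conv(1)[OF fB] conv(1)[OF fQ]])
  finally have "(U t, \<iota> (V t)) = (LINT s:{0<..<t}|lborel. L s (B (U s))) + (LINT s:{0<..<t}|lborel. L s (Q (\<psi> s)))" .
  moreover have "S t (U 0, \<iota> (V 0)) = 0"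
    using linear_0[OF bounded_linear.linear[OF C0_bounded_linear[OF S, of t]]] t by (simp add: U0 V0 i.zero zero_prod_def)
  ultimately show "(U t, \<iota> (V t)) = S t (U 0, \<iota> (V 0)) +
      (LINT s:{0<..<t}|lborel. S (t - s) (B_mu \<iota> B \<mu> (U s, \<iota> (V s)))) +
      (LINT s:{0<..<t}|lborel. S (t - s) (Q_mu \<iota> Q \<mu> (\<psi> s)))"
    by (simp add: L_def B_mu_def Q_mu_def)
qed

end

section \<open>The lag of the low modes and the tail of the endpoint\<close>

context orthonormal_system begin

lemma inner_sum_lessThan: "inner (\<Sum>k<n. a k *\<^sub>R e k) (e j) = (if j < n then a j else 0)"
  by (simp add: inner_sum_basis)

lemma set_borel_measurable_series:
  fixes a :: "nat \<Rightarrow> real \<Rightarrow> real"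
  assumes cont: "\<And>k. continuous_on {0..T} (a k)" and s: "\<And>s. s \<in> {0<..<T} \<Longrightarrow> summable (\<lambda>k. (a k s)\<^sup>2)"
  shows "set_borel_measurable lborel {0<..<T} (\<lambda>s. series (\<lambda>k. a k s))"
  unfolding set_borel_measurable_def
proof (rule borel_measurable_LIMSEQ_metric)
  show "(\<lambda>s. \<Sum>k<m. (indicator {0<..<T} s * a k s) *\<^sub>R e k) \<in> borel_measurable lborel" for m
    using set_integrable_imp_measurable[OF set_integrable_continuous_Ioo[OF cont]]
    by (intro borel_measurable_sum borel_measurable_scaleR) (simp_all add: set_borel_measurable_def)
  show "(\<lambda>m. \<Sum>k<m. (indicator {0<..<T} s * a k s) *\<^sub>R e k) \<longlonglongrightarrow> indicator {0<..<T} s *\<^sub>R series (\<lambda>k. a k s)" for s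
    using series_sums[OF s[of s]] by (cases "s \<in> {0<..<T}") (simp_all add: sums_def)
qed

end

context eigenvalue_scale begin

lemma bounded_sums_sqn: "x \<in> Hs \<delta> \<Longrightarrow> bounded_sums (\<lambda>k. \<alpha> k powr \<delta> * (inner x (e k))\<^sup>2) (sqn \<delta> x)"
  by (rule bounded_sumsI) (auto intro: partial_sum_le_sqn)

text \<open>Giving up one derivative on the modes \<open>k \<ge> n\<close> gains a factor \<open>1 / \<alpha> n\<close>.\<close>

lemma bounded_sums_high_modes:
  assumes x: "x \<in> Hs (1 + \<delta>)"
  shows "bounded_sums (\<lambda>k. \<alpha> k powr \<delta> * (if k < n then 0 else inner x (e k))\<^sup>2) (sqn (1 + \<delta>) x * (1 / \<alpha> n))"
proof (rule bounded_sums_mono[OF bounded_sums_mult[OF _ bounded_sums_sqn[OF x]]])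
  show "0 \<le> 1 / \<alpha> n" by simp
  show "\<alpha> k powr \<delta> * (if k < n then 0 else inner x (e k))\<^sup>2 \<le> 1 / \<alpha> n * (\<alpha> k powr (1 + \<delta>) * (inner x (e k))\<^sup>2)" for k
  proof (cases "k < n")
    case False
    then have "\<alpha> n \<le> \<alpha> k" using mono_alpha by (simp add: monoD)
    then have "\<alpha> k powr \<delta> * \<alpha> n \<le> \<alpha> k powr \<delta> * \<alpha> k" by (intro mult_left_mono) auto
    also have "\<dots> = \<alpha> k powr (1 + \<delta>)" by (simp add: powr_add)
    finally have "\<alpha> k powr \<delta> \<le> 1 / \<alpha> n * \<alpha> k powr (1 + \<delta>)" by (simp add: pos_le_divide_eq)
    then have "\<alpha> k powr \<delta> * (inner x (e k))\<^sup>2 \<le> 1 / \<alpha> n * \<alpha> k powr (1 + \<delta>) * (inner x (e k))\<^sup>2"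
      by (rule mult_right_mono) simp
    then show ?thesis using False by (simp add: mult.assoc)
  qed simp
  show "1 / \<alpha> n * sqn (1 + \<delta>) x \<le> sqn (1 + \<delta>) x * (1 / \<alpha> n)" by simp
qed simp

end

context parabolic_path begin

definition velocity :: "nat \<Rightarrow> real \<Rightarrow> real" where
  "velocity k s = force k s - \<alpha> k * inner (\<phi> s) (e k)"

lemma mode_continuous: "continuous_on {0..T} (\<lambda>s. inner (\<phi> s) (e k))"
  by (intro continuous_intros phi_cont)

lemma velocity_integrable: "set_integrable lborel {0<..<T} (velocity k)"
  unfolding velocity_def[abs_def]
  by (intro set_integral_diff(1) force_integrable set_integrable_continuous_Ioo continuous_intros mode_continuous)

lemma velocity_sq_integrable: "set_integrable lborel {0<..<T} (\<lambda>s. (velocity k s)\<^sup>2)"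
proof (rule set_integrable_bound[where f = "\<lambda>s. 2 * (force k s)\<^sup>2 + 2 * (\<alpha> k * inner (\<phi> s) (e k))\<^sup>2"])
  show "set_integrable lborel {0<..<T} (\<lambda>s. 2 * (force k s)\<^sup>2 + 2 * (\<alpha> k * inner (\<phi> s) (e k))\<^sup>2)"
    by (intro set_integral_add(1) set_integrable_mult_right force_sq_integrable set_integrable_continuous_Ioo
        continuous_intros mode_continuous)
  show "set_borel_measurable lborel {0<..<T} (\<lambda>s. (velocity k s)\<^sup>2)"
    by (intro set_borel_measurable_square set_integrable_imp_measurable velocity_integrable)
  have "norm ((velocity k s)\<^sup>2) \<le> norm (2 * (force k s)\<^sup>2 + 2 * (\<alpha> k * inner (\<phi> s) (e k))\<^sup>2)" for s
    using diff_square_le[of "force k s" "\<alpha> k * inner (\<phi> s) (e k)"] by (simp add: velocity_def)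
  then show "AE s in lborel. s \<in> {0<..<T} \<longrightarrow> norm ((velocity k s)\<^sup>2) \<le> norm (2 * (force k s)\<^sup>2 + 2 * (\<alpha> k * inner (\<phi> s) (e k))\<^sup>2)"
    by simp
qed

lemma phi_eq_integral_velocity:
  "t \<in> {0..T} \<Longrightarrow> inner (\<phi> t) (e k) = (LINT s:{0<..<t}|lborel. velocity k s)"
  unfolding velocity_def by (rule phi_integral_equation)

text \<open>In a mode \<open>k < n\<close> the lag \<open>D\<close> is the solution of \<open>\<mu> D' + D = \<mu> \<phi>\<^sub>k'\<close> with \<open>D(0) = 0\<close>, so that \<open>u = \<phi>\<^sub>k - D\<close> satisfies
  \<open>\<mu> u' = D\<close>, that is, \<open>\<mu> u'' + u' = \<phi>\<^sub>k'\<close> with \<open>u(0) = u'(0) = 0\<close>.\<close>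

definition lag :: "nat \<Rightarrow> real \<Rightarrow> nat \<Rightarrow> real \<Rightarrow> real" where
  "lag n \<mu> k t = (if k < n then LINT s:{0<..<t}|lborel. exp (- (1 / \<mu>) * (t - s)) * velocity k s else 0)"

definition lag_bound :: "nat \<Rightarrow> real" where
  "lag_bound n = (\<Sum>k<n. \<alpha> k powr (2 + 2 * \<beta>) * ((LINT s:{0<..<T}|lborel. (velocity k s)\<^sup>2) / 2))"

lemma lag_bound_nonneg: "0 \<le> lag_bound n"
  unfolding lag_bound_def set_lebesgue_integral_def
  by (intro sum_nonneg mult_nonneg_nonneg divide_nonneg_nonneg Bochner_Integration.integral_nonneg) auto

lemma lag_zero: "lag n \<mu> k 0 = 0" by (simp add: lag_def set_lebesgue_integral_def)

lemma lag_high: "n \<le> k \<Longrightarrow> lag n \<mu> k t = 0" by (simp add: lag_def)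

lemma lag_equation:
  assumes "k < n" "t \<in> {0..T}"
  shows "lag n \<mu> k t = inner (\<phi> t) (e k) - 1 / \<mu> * (LINT s:{0<..<t}|lborel. lag n \<mu> k s)"
proof -
  have "lag n \<mu> k t = (LINT s:{0<..<t}|lborel. velocity k s) - 1 / \<mu> * (LINT s:{0<..<t}|lborel. lag n \<mu> k s)"
    using assms by (intro duhamel_imp_integral_equation(1)[OF velocity_integrable]) (auto simp: lag_def)
  then show ?thesis using phi_eq_integral_velocity[OF assms(2), of k] by simp
qed

lemma lag_continuous: "continuous_on {0..T} (lag n \<mu> k)"
proof (cases "k < n")
  case True
  show ?thesis
    by (rule duhamel_imp_integral_equation(2)[OF velocity_integrable, where t = 0 and a = "1 / \<mu>"])
       (use True T in \<open>auto simp: lag_def\<close>)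
next
  case False
  then have "lag n \<mu> k = (\<lambda>_. 0)" by (auto simp: lag_def)
  then show ?thesis by simp
qed

text \<open>The exponential that defines the lag has rate \<open>1 / \<mu>\<close>, so its convolution with \<open>\<phi>\<^sub>k'\<close> is of order
  \<open>\<surd>\<mu>\<close>. Only the modes \<open>k < n\<close> contribute, so the large exponent of \<open>\<alpha> k\<close> costs a factor that depends
  on \<open>n\<close> but not on \<open>\<mu>\<close>.\<close>

lemma bounded_sums_lag:
  assumes mu: "\<mu> > 0" and t: "t \<in> {0..T}"
  shows "bounded_sums (\<lambda>k. \<alpha> k powr (2 + 2 * \<beta>) * (lag n \<mu> k t)\<^sup>2) (\<mu> * lag_bound n)"
proof -
  have sub: "{0<..<t} \<subseteq> {0<..<T}" using t by auto
  have "\<alpha> k powr (2 + 2 * \<beta>) * (lag n \<mu> k t)\<^sup>2 \<le>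
      \<mu> * (\<alpha> k powr (2 + 2 * \<beta>) * ((LINT s:{0<..<T}|lborel. (velocity k s)\<^sup>2) / 2))" if "k < n" for k
  proof -
    have "(LINT s:{0<..<t}|lborel. exp (- (1 / \<mu>) * (t - s)) * velocity k s)\<^sup>2 \<le>
        (LINT s:{0<..<t}|lborel. (velocity k s)\<^sup>2) / (2 * (1 / \<mu>))"
      using mu t set_integrable_subset[OF velocity_integrable _ sub] set_integrable_subset[OF velocity_sq_integrable _ sub]
      by (intro exponential_convolution_square_bound set_integrable_imp_measurable) auto
    also have "\<dots> \<le> (LINT s:{0<..<T}|lborel. (velocity k s)\<^sup>2) / (2 * (1 / \<mu>))"
    proof (rule divide_right_mono)
      show "(LINT s:{0<..<t}|lborel. (velocity k s)\<^sup>2) \<le> (LINT s:{0<..<T}|lborel. (velocity k s)\<^sup>2)"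
        unfolding set_lebesgue_integral_def
        using velocity_sq_integrable[of k] set_integrable_subset[OF velocity_sq_integrable[of k] _ sub] sub
        by (intro Bochner_Integration.integral_mono) (auto simp: set_integrable_def indicator_def)
    qed (use mu in simp)
    also have "\<dots> = \<mu> * ((LINT s:{0<..<T}|lborel. (velocity k s)\<^sup>2) / 2)"
      by (simp add: mult.commute)
    finally have "(lag n \<mu> k t)\<^sup>2 \<le> \<mu> * ((LINT s:{0<..<T}|lborel. (velocity k s)\<^sup>2) / 2)"
      using that by (simp add: lag_def)
    from mult_left_mono[OF this, of "\<alpha> k powr (2 + 2 * \<beta>)"] show ?thesis by (simp add: mult_ac)
  qed
  then show ?thesis unfolding lag_bound_def sum_distrib_left
    by (intro bounded_sums_finite) (auto simp: lag_high)
qed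

text \<open>The part of the squared norm of the endpoint in \<open>H\<^sup>1\<^sup>+\<^sup>2\<^sup>\<beta>\<close> that stems from the modes \<open>k \<ge> n\<close>.\<close>

definition endpoint_tail :: "nat \<Rightarrow> real" where
  "endpoint_tail n = sqn (1 + 2 * \<beta>) (\<phi> T) - (\<Sum>k<n. \<alpha> k powr (1 + 2 * \<beta>) * (inner (\<phi> T) (e k))\<^sup>2)"

lemma phi_T_regular: "\<phi> T \<in> Hs (1 + 2 * \<beta>)"
  using parabolic_regularity T by auto

lemma bounded_sums_endpoint_tail:
  "bounded_sums (\<lambda>k. if k < n then 0 else \<alpha> k powr (1 + 2 * \<beta>) * (inner (\<phi> T) (e k))\<^sup>2) (endpoint_tail n)"
  unfolding endpoint_tail_def sqn_def by (intro bounded_sums_tail hspace_summable phi_T_regular) auto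

lemma endpoint_tail_nonneg: "0 \<le> endpoint_tail n"
  by (rule bounded_sums_bound_nonneg[OF bounded_sums_endpoint_tail])

lemma endpoint_tail_tendsto: "endpoint_tail \<longlonglongrightarrow> 0"
proof -
  have "(\<lambda>n. sqn (1 + 2 * \<beta>) (\<phi> T) - (\<Sum>k<n. \<alpha> k powr (1 + 2 * \<beta>) * (inner (\<phi> T) (e k))\<^sup>2))
      \<longlonglongrightarrow> sqn (1 + 2 * \<beta>) (\<phi> T) - sqn (1 + 2 * \<beta>) (\<phi> T)"
    unfolding sqn_def by (intro tendsto_diff tendsto_const summable_LIMSEQ hspace_summable phi_T_regular)
  then show ?thesis unfolding endpoint_tail_def[abs_def] by simp
qed

end

section \<open>The regularised control\<close>

context parabolic_path begin

text \<open>Multiplied by the small quantity \<open>defect\<close>, these constants bound the squares of the following norms: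
  of the error at the endpoint (\<open>c_end\<close>), of the distance of the path from \<open>\<phi>\<close> in \<open>H\<^sup>2\<^sup>\<beta>\<close> (\<open>c_path\<close>) and, up to
  a factor, of the drift terms in the control (\<open>c_drift\<close>) and of its whole remainder (\<open>c_rem\<close>). They depend neither on the number
  of low modes nor on \<open>\<mu>\<close>.\<close>

definition a1 :: real where "a1 = \<alpha> 0 powr (- 1)"

definition a2 :: real where "a2 = \<alpha> 0 powr (- 2)"

definition c_end :: real where "c_end = 1 + a1"

definition c_path :: "real \<Rightarrow> real" where "c_path M = 3 * (M + a2 + a1 * c_end)"

definition c_drift :: "real \<Rightarrow> real" where
  "c_drift M = (\<gamma> (2 * \<beta>))\<^sup>2 * c_path M + (\<gamma> (1 + 2 * \<beta>))\<^sup>2 * M + 1"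

definition c_rem :: "real \<Rightarrow> real \<Rightarrow> real" where
  "c_rem M K = 4 * c\<^sup>2 * (T * c_drift M + K * c_end)"

lemma a1_nonneg: "0 \<le> a1" and a2_nonneg: "0 \<le> a2"
  by (simp_all add: a1_def a2_def)

lemma c_rem_nonneg: "0 \<le> M \<Longrightarrow> 0 \<le> K \<Longrightarrow> 0 \<le> c_rem M K"
  using a1_nonneg a2_nonneg T by (simp add: c_rem_def c_drift_def c_path_def c_end_def)

end

text \<open>The construction for one \<open>\<mu>\<close> and one number \<open>n\<close> of low modes. The function \<open>w k\<close> steers mode \<open>k\<close>, and
  \<open>M\<close> bounds \<open>\<phi>\<close> in \<open>H\<^sup>1\<^sup>+\<^sup>2\<^sup>\<beta>\<close>.\<close>

locale steered_path = parabolic_path e \<alpha> Q lam c \<beta> B \<gamma> E T \<psi> \<phi>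
  for e :: "nat \<Rightarrow> 'h::{real_inner, banach, second_countable_topology}" and \<alpha> Q lam c \<beta> B \<gamma> E T \<psi> \<phi> +
  fixes M K C \<mu> :: real and n :: nat and w w1 w2 :: "nat \<Rightarrow> real \<Rightarrow> real"
  assumes M: "\<And>t. t \<in> {0..T} \<Longrightarrow> \<phi> t \<in> Hs (1 + 2 * \<beta>) \<and> sqn (1 + 2 * \<beta>) (\<phi> t) \<le> M"
    and K_nonneg: "0 \<le> K" and C_nonneg: "0 \<le> C" and mu: "0 < \<mu>"
    and steers_modes: "\<And>k. steers T \<mu> K C (\<alpha> k) (w k) (w1 k) (w2 k)"
begin

lemma M_nonneg: "0 \<le> M"
  using M[of 0] sqn_nonneg[of "\<phi> 0" "1 + 2 * \<beta>"] T by auto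

abbreviation lg :: "nat \<Rightarrow> real \<Rightarrow> real" where
  "lg \<equiv> lag n \<mu>"

text \<open>It becomes small if first \<open>n\<close> is chosen large and then \<open>\<mu>\<close> small.\<close>

definition defect where
  "defect = 1 / \<alpha> n + endpoint_tail n + \<mu> * lag_bound n"

lemma defect_ge: "1 / \<alpha> n \<le> defect" "endpoint_tail n \<le> defect" "\<mu> * lag_bound n \<le> defect"
  using endpoint_tail_nonneg[of n] lag_bound_nonneg[of n] mu by (simp_all add: defect_def)

lemma bounded_sums_lag_defect:
  assumes s: "s \<in> {0..T}"
  shows "bounded_sums (\<lambda>k. \<alpha> k powr (2 + 2 * \<beta>) * (lg k s)\<^sup>2) defect"
  by (rule bounded_sums_mono[OF bounded_sums_lag[OF mu s, of n]])
     (use defect_ge in \<open>auto\<close>)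

lemma lag_as_integral:
  assumes t: "t \<in> {0..T}"
  shows "(if k < n then inner (\<phi> t) (e k) - lg k t else 0) = 1 / \<mu> * (LINT s:{0<..<t}|lborel. lg k s)"
proof (cases "k < n")
  case True
  then show ?thesis using lag_equation[OF True t, of \<mu>] by simp
next
  case False
  then show ?thesis by (simp add: lag_high set_lebesgue_integral_def)
qed

text \<open>The first part of the path. In each low mode it satisfies \<open>\<mu> u'' + u' = \<phi>\<^sub>k'\<close> and starts at rest.\<close>

definition low_modes where
  "low_modes s = (\<Sum>k<n. (inner (\<phi> s) (e k) - lg k s) *\<^sub>R e k)"

definition endpoint_error where
  "endpoint_error = \<phi> T - low_modes T"

definition err where
  "err k = inner endpoint_error (e k)"

lemma err_eq: "err k = (if k < n then 0 else inner (\<phi> T) (e k)) + lg k T"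
  by (simp add: err_def endpoint_error_def low_modes_def inner_diff_left inner_sum_lessThan lag_high)

text \<open>The tail of the endpoint and the lag live on disjoint sets of modes, so their squares add up.\<close>

lemma bounded_sums_err: "bounded_sums (\<lambda>k. \<alpha> k powr (1 + 2 * \<beta>) * (err k)\<^sup>2) (c_end * defect)"
proof (rule bounded_sums_mono[OF bounded_sums_add[OF bounded_sums_endpoint_tail[of n]
        bounded_sums_mult[OF a1_nonneg bounded_sums_lag_defect[of T]]]])
  show "T \<in> {0..T}" using T by simp
  show "endpoint_tail n + a1 * defect \<le> c_end * defect" using defect_ge by (simp add: c_end_def distrib_right)
  show "\<alpha> k powr (1 + 2 * \<beta>) * (err k)\<^sup>2 \<le>
      (if k < n then 0 else \<alpha> k powr (1 + 2 * \<beta>) * (inner (\<phi> T) (e k))\<^sup>2) +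
      a1 * (\<alpha> k powr (2 + 2 * \<beta>) * (lg k T)\<^sup>2)" for k
  proof (cases "k < n")
    case True
    have "\<alpha> k powr (1 + 2 * \<beta>) \<le> a1 * \<alpha> k powr (2 + 2 * \<beta>)"
      using alpha_powr_mono[of "1 + 2 * \<beta>" "2 + 2 * \<beta>" k] by (simp add: a1_def)
    from mult_right_mono[OF this, of "(lg k T)\<^sup>2"] show ?thesis using True by (simp add: err_eq mult.assoc)
  qed (use a1_nonneg in \<open>simp add: err_eq lag_high\<close>)
qed simp

lemma bounded_sums_err_weak: "bounded_sums (\<lambda>k. \<alpha> k powr (2 * \<beta>) * (err k)\<^sup>2) (a1 * (c_end * defect))"
proof (rule bounded_sums_mono[OF bounded_sums_mult[OF a1_nonneg bounded_sums_err]])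
  fix k
  have "\<alpha> k powr (2 * \<beta>) \<le> a1 * \<alpha> k powr (1 + 2 * \<beta>)"
    using alpha_powr_mono[of "2 * \<beta>" "1 + 2 * \<beta>" k] by (simp add: a1_def)
  from mult_right_mono[OF this, of "(err k)\<^sup>2"]
  show "\<alpha> k powr (2 * \<beta>) * (err k)\<^sup>2 \<le> a1 * (\<alpha> k powr (1 + 2 * \<beta>) * (err k)\<^sup>2)" by (simp add: mult.assoc)
qed simp_all

lemma summable_err: "summable (\<lambda>k. (err k)\<^sup>2)"
  using parseval[of endpoint_error] by (simp add: err_def sums_iff)

lemma summable_alpha_err: "summable (\<lambda>k. \<alpha> k * (err k)\<^sup>2)"
proof (rule summable_comparison_test)
  show "summable (\<lambda>k. \<alpha> 0 powr (- 2 * \<beta>) * (\<alpha> k powr (1 + 2 * \<beta>) * (err k)\<^sup>2))"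
    by (intro summable_mult bounded_sums_summable[OF bounded_sums_err])
  have "\<alpha> k * (err k)\<^sup>2 \<le> \<alpha> 0 powr (- 2 * \<beta>) * (\<alpha> k powr (1 + 2 * \<beta>) * (err k)\<^sup>2)" for k
  proof -
    have "\<alpha> k \<le> \<alpha> 0 powr (- 2 * \<beta>) * \<alpha> k powr (1 + 2 * \<beta>)"
      using alpha_powr_mono[of 1 "1 + 2 * \<beta>" k] beta by simp
    from mult_right_mono[OF this, of "(err k)\<^sup>2"] show ?thesis by (simp add: mult.assoc)
  qed
  then show "\<exists>N. \<forall>k\<ge>N. norm (\<alpha> k * (err k)\<^sup>2) \<le> \<alpha> 0 powr (- 2 * \<beta>) * (\<alpha> k powr (1 + 2 * \<beta>) * (err k)\<^sup>2)"
    by simp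
qed

lemma w_derivative: "(w k has_real_derivative w1 k s) (at s)" and w1_derivative: "(w1 k has_real_derivative w2 k s) (at s)"
  and w2_continuous: "continuous_on UNIV (w2 k)" and w_ends: "w k 0 = 0" "w1 k 0 = 0" "w k T = 1"
  using steers_modes[of k] by (simp_all add: steers_def)

lemma w_bounds:
  assumes s: "s \<in> {0..T}"
  shows "(w k s)\<^sup>2 \<le> 1" and "(w1 k s)\<^sup>2 \<le> C * \<alpha> k" and "(\<mu> * w2 k s + w1 k s + \<alpha> k * w k s)\<^sup>2 \<le> C * \<alpha> k"
  using steers_modes[of k] s by (simp_all add: steers_def)

definition push where
  "push k s = \<mu> * w2 k s + w1 k s + \<alpha> k * w k s"

lemma push_integral: "(LINT s:{0<..<T}|lborel. (push k s)\<^sup>2) \<le> K * \<alpha> k"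
  using steers_modes[of k] by (simp add: steers_def push_def)

lemma w_continuous: "continuous_on I (w k)" "continuous_on I (w1 k)" "continuous_on I (w2 k)"
  using w_derivative w1_derivative continuous_on_subset[OF w2_continuous]
  by (auto intro!: continuous_at_imp_continuous_on DERIV_isCont)

lemma push_continuous: "continuous_on {0..T} (push k)"
  unfolding push_def[abs_def] by (intro continuous_intros w_continuous)

lemma w_integrals:
  assumes t: "t \<in> {0..T}"
  shows "(LINT s:{0<..<t}|lborel. w1 k s) = w k t" and "(LINT s:{0<..<t}|lborel. w2 k s) = w1 k t"
  using t w_ends FTC_Ioo[of 0 t "w k" "w1 k"] FTC_Ioo[of 0 t "w1 k" "w2 k"]
    has_field_derivative_at_within[OF w_derivative] has_field_derivative_at_within[OF w1_derivative] w_continuous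
  by auto

lemma err_w_square_le:
  assumes s: "s \<in> {0..T}"
  shows "(err k * w k s)\<^sup>2 \<le> (err k)\<^sup>2" and "(err k * w1 k s)\<^sup>2 \<le> C * (\<alpha> k * (err k)\<^sup>2)"
  using mult_left_mono[OF w_bounds(1)[OF s, of k], of "(err k)\<^sup>2"] mult_left_mono[OF w_bounds(2)[OF s, of k], of "(err k)\<^sup>2"]
  by (simp_all add: power_mult_distrib mult_ac)

lemma summable_C_err: "summable (\<lambda>k. C * (\<alpha> k * (err k)\<^sup>2))"
  by (intro summable_mult summable_alpha_err)

lemma summable_err_w:
  assumes s: "s \<in> {0..T}"
  shows "summable (\<lambda>k. (err k * w k s)\<^sup>2)" and "summable (\<lambda>k. (err k * w1 k s)\<^sup>2)"
  by (rule summable_comparison_test[OF _ summable_err], use err_w_square_le[OF s] in simp)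
     (rule summable_comparison_test[OF _ summable_C_err], use err_w_square_le[OF s] in simp)

text \<open>The path and its velocity. In the low modes the velocity of the first part is the lag divided
  by \<open>\<mu>\<close>.\<close>

definition U where
  "U s = low_modes s + series (\<lambda>k. err k * w k s)"

definition V where
  "V s = (\<Sum>k<n. (lg k s / \<mu>) *\<^sub>R e k) + series (\<lambda>k. err k * w1 k s)"

lemma U_coefficient:
  assumes s: "s \<in> {0..T}"
  shows "inner (U s) (e k) = (if k < n then inner (\<phi> s) (e k) - lg k s else 0) + err k * w k s"
  by (simp add: U_def low_modes_def inner_add_left inner_sum_lessThan inner_series summable_err_w[OF s])

lemma V_coefficient:
  assumes s: "s \<in> {0..T}"
  shows "inner (V s) (e k) = lg k s / \<mu> + err k * w1 k s"
  by (simp add: V_def inner_add_left inner_sum_lessThan inner_series summable_err_w[OF s] lag_high)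

lemma U_continuous: "continuous_on {0..T} U"
  unfolding U_def[abs_def] low_modes_def
  by (intro continuous_intros phi_cont lag_continuous continuous_on_series[OF _ summable_err err_w_square_le(1)] w_continuous)

lemma V_continuous: "continuous_on {0..T} V"
  unfolding V_def[abs_def]
  by (intro continuous_intros lag_continuous continuous_on_series[OF _ summable_C_err err_w_square_le(2)] w_continuous) (use mu in simp)

lemma U_V_ends: "U 0 = 0" "V 0 = 0" "U T = \<phi> T"
proof -
  have 0: "0 \<in> {0..T}" and 1: "T \<in> {0..T}" using T by auto
  show "U 0 = 0" by (rule eq_if_coefficients_eq) (simp add: U_coefficient[OF 0] phi0 lag_zero w_ends)
  show "V 0 = 0" by (rule eq_if_coefficients_eq) (simp add: V_coefficient[OF 0] lag_zero w_ends)
  show "U T = \<phi> T" by (rule eq_if_coefficients_eq) (simp add: U_coefficient[OF 1] w_ends err_eq lag_high)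
qed

definition G where
  "G k s = (if k < n then velocity k s else 0) / \<mu> - lg k s / \<mu>\<^sup>2 + err k * w2 k s"

lemma low_velocity_integrable: "set_integrable lborel {0<..<T} (\<lambda>s. (if k < n then velocity k s else 0) / \<mu>)"
  using velocity_integrable[of k] by (cases "k < n") (simp_all add: set_integrable_def)

lemma lag_integrable:
  assumes t: "t \<in> {0..T}"
  shows "set_integrable lborel {0<..<t} (lg k)"
  using t by (intro set_integrable_continuous_Ioo continuous_on_subset[OF lag_continuous]) auto

lemma w_integrable: "set_integrable lborel {0<..<t} (w1 k)" "set_integrable lborel {0<..<t} (w2 k)"
  by (intro set_integrable_continuous_Ioo w_continuous)+

lemma G_integrable: "set_integrable lborel {0<..<T} (G k)"
  unfolding G_def[abs_def] using T
  by (intro set_integral_add(1) set_integral_diff(1) low_velocity_integrable set_integrable_divide lag_integrable set_integrable_mult_right w_integrable) auto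

lemma V_eq_integral:
  assumes t: "t \<in> {0..T}"
  shows "inner (V t) (e k) = (LINT s:{0<..<t}|lborel. G k s)"
proof -
  have vit: "set_integrable lborel {0<..<t} (\<lambda>s. (if k < n then velocity k s else 0) / \<mu>)"
    by (rule set_integrable_subset[OF low_velocity_integrable]) (use t in auto)
  have li: "set_integrable lborel {0<..<t} (\<lambda>s. lg k s / \<mu>\<^sup>2)" by (intro set_integrable_divide lag_integrable t)
  have "(LINT s:{0<..<t}|lborel. G k s) =
      (LINT s:{0<..<t}|lborel. (if k < n then velocity k s else 0) / \<mu>) -
      (LINT s:{0<..<t}|lborel. lg k s / \<mu>\<^sup>2) + (LINT s:{0<..<t}|lborel. err k * w2 k s)"
    unfolding G_def
    by (simp only: set_integral_add(2)[OF set_integral_diff(1)[OF vit li] set_integrable_mult_right[OF w_integrable(2)]]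
        set_integral_diff(2)[OF vit li])
  also have "(LINT s:{0<..<t}|lborel. (if k < n then velocity k s else 0) / \<mu>) =
      (if k < n then inner (\<phi> t) (e k) else 0) / \<mu>"
    by (simp add: phi_eq_integral_velocity[OF t])
  also have "(LINT s:{0<..<t}|lborel. lg k s / \<mu>\<^sup>2) = (1 / \<mu> * (LINT s:{0<..<t}|lborel. lg k s)) / \<mu>"
    by (simp add: power2_eq_square)
  also have "1 / \<mu> * (LINT s:{0<..<t}|lborel. lg k s) = (if k < n then inner (\<phi> t) (e k) - lg k t else 0)"
    by (rule lag_as_integral[OF t, symmetric])
  also have "(LINT s:{0<..<t}|lborel. err k * w2 k s) = err k * w1 k t" by (simp add: w_integrals[OF t])
  finally show ?thesis by (simp add: V_coefficient[OF t] lag_high diff_divide_distrib)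
qed

lemma U_eq_integral:
  assumes t: "t \<in> {0..T}"
  shows "inner (U t) (e k) = (LINT s:{0<..<t}|lborel. inner (V s) (e k))"
proof -
  have "(LINT s:{0<..<t}|lborel. inner (V s) (e k)) = (LINT s:{0<..<t}|lborel. lg k s / \<mu> + err k * w1 k s)"
    using t by (intro set_lebesgue_integral_cong) (auto simp: V_coefficient)
  also have "\<dots> = (LINT s:{0<..<t}|lborel. lg k s / \<mu>) + (LINT s:{0<..<t}|lborel. err k * w1 k s)"
    by (intro set_integral_add(2) set_integrable_divide lag_integrable t set_integrable_mult_right w_integrable)
  also have "\<dots> = inner (U t) (e k)" using lag_as_integral[OF t, of k] by (simp add: U_coefficient[OF t] w_integrals[OF t])
  finally show ?thesis by simp
qed

text \<open>The part of the control other than \<open>\<psi>\<close> itself, read off from the equation of mode \<open>k\<close> along \<open>U\<close>: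
  the control there has the coefficient \<open>\<rho> k\<close>, plus that of \<open>\<psi>\<close> if \<open>k < n\<close>.\<close>

definition \<rho> where
  "\<rho> k s = 1 / lam k * ((if k < n then inner (B (\<phi> s)) (e k) else 0) - \<alpha> k * lg k s
    + err k * push k s - inner (B (U s)) (e k))"

lemma B_U_continuous: "continuous_on {0..T} (\<lambda>s. B (U s))"
  by (rule continuous_on_compose2[OF continuous_on_B U_continuous]) simp

lemma lam_nonzero: "lam k \<noteq> 0"
  using lam_pos[of k] by simp

lemma rho_continuous: "continuous_on {0..T} (\<rho> k)"
proof (cases "k < n")
  case True
  then show ?thesis unfolding \<rho>_def[abs_def]
    by simp (intro continuous_intros B_phi_cont lag_continuous push_continuous B_U_continuous ballI lam_nonzero)
next
  case False
  then show ?thesis unfolding \<rho>_def[abs_def]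
    by simp (intro continuous_intros B_phi_cont lag_continuous push_continuous B_U_continuous ballI lam_nonzero)
qed

text \<open>The squared force on the oscillators, weighted as in \<open>H\<^sup>2\<^sup>\<beta>\<close>. For fixed \<open>\<mu>\<close> it is summable over the
  modes at each time, but only the time integral of the sum is bounded uniformly in \<open>\<mu>\<close>.\<close>

definition q where
  "q k s = \<alpha> k powr (2 * \<beta>) * (err k)\<^sup>2 * (push k s)\<^sup>2"

lemma q_nonneg: "0 \<le> q k s"
  by (simp add: q_def)

lemma raise_exponent: "\<alpha> k powr (2 * \<beta>) * (err k)\<^sup>2 * (D * \<alpha> k) = D * (\<alpha> k powr (1 + 2 * \<beta>) * (err k)\<^sup>2)"
  by (simp add: powr_add)

lemma q_le:
  assumes s: "s \<in> {0..T}"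
  shows "q k s \<le> C * (\<alpha> k powr (1 + 2 * \<beta>) * (err k)\<^sup>2)"
proof -
  have "q k s \<le> \<alpha> k powr (2 * \<beta>) * (err k)\<^sup>2 * (C * \<alpha> k)"
    unfolding q_def using w_bounds(3)[OF s, of k] by (intro mult_left_mono) (auto simp: push_def)
  then show ?thesis unfolding raise_exponent .
qed

lemma bounded_sums_q:
  assumes s: "s \<in> {0..T}"
  shows "bounded_sums (\<lambda>k. q k s) (C * (c_end * defect))"
  by (rule bounded_sums_mono[OF bounded_sums_mult[OF C_nonneg bounded_sums_err] q_nonneg q_le[OF s] order_refl])

lemma bounded_sums_q_suminf:
  assumes s: "s \<in> {0..T}"
  shows "bounded_sums (\<lambda>k. q k s) (\<Sum>k. q k s)"
  using sum_le_suminf[OF bounded_sums_summable[OF bounded_sums_q[OF s]]] q_nonneg by (intro bounded_sumsI) auto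

lemma q_continuous: "continuous_on {0..T} (q k)"
  unfolding q_def[abs_def] by (intro continuous_intros push_continuous)

lemma q_integral_le: "(LINT s:{0<..<T}|lborel. q k s) \<le> K * (\<alpha> k powr (1 + 2 * \<beta>) * (err k)\<^sup>2)"
proof -
  have "(LINT s:{0<..<T}|lborel. q k s) = \<alpha> k powr (2 * \<beta>) * (err k)\<^sup>2 * (LINT s:{0<..<T}|lborel. (push k s)\<^sup>2)"
    by (simp add: q_def)
  also have "\<dots> \<le> \<alpha> k powr (2 * \<beta>) * (err k)\<^sup>2 * (K * \<alpha> k)" by (intro mult_left_mono push_integral) simp
  finally show ?thesis unfolding raise_exponent .
qed

lemmas q_series = integral_of_series_le[OF q_continuous q_nonneg q_le
  summable_mult[OF bounded_sums_summable[OF bounded_sums_err]] q_integral_le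
  bounded_sums_mult[OF K_nonneg bounded_sums_err]]

text \<open>The path differs from \<open>\<phi>\<close> by the high modes of \<open>\<phi>\<close>, the lag and the steering of the error.\<close>

lemma phi_minus_U:
  assumes s: "s \<in> {0..T}"
  shows "\<phi> s - U s \<in> Hs (2 * \<beta>)" and "sqn (2 * \<beta>) (\<phi> s - U s) \<le> c_path M * defect"
proof -
  have "bounded_sums (\<lambda>k. \<alpha> k powr (2 * \<beta>) * (inner (\<phi> s - U s) (e k))\<^sup>2) (c_path M * defect)"
  proof (rule bounded_sums_mono[OF bounded_sums_mult[OF _ bounded_sums_add[OF bounded_sums_add[OF
          bounded_sums_high_modes[OF conjunct1[OF M[OF s]], of n] bounded_sums_mult[OF a2_nonneg bounded_sums_lag_defect[OF s]]] bounded_sums_err_weak]]])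
    show "0 \<le> (3 :: real)" by simp
    show "\<alpha> k powr (2 * \<beta>) * (inner (\<phi> s - U s) (e k))\<^sup>2 \<le>
        3 * (\<alpha> k powr (2 * \<beta>) * (if k < n then 0 else inner (\<phi> s) (e k))\<^sup>2 +
          a2 * (\<alpha> k powr (2 + 2 * \<beta>) * (lg k s)\<^sup>2) + \<alpha> k powr (2 * \<beta>) * (err k)\<^sup>2)" for k
    proof -
      have "inner (\<phi> s - U s) (e k) = (if k < n then 0 else inner (\<phi> s) (e k)) + lg k s + - (err k * w k s)"
        by (simp add: inner_diff_left U_coefficient[OF s] lag_high)
      then have "(inner (\<phi> s - U s) (e k))\<^sup>2 \<le>
          3 * ((if k < n then 0 else inner (\<phi> s) (e k))\<^sup>2 + (lg k s)\<^sup>2 + (- (err k * w k s))\<^sup>2)"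
        by (simp only: sum3_square_le)
      also have "\<dots> \<le> 3 * ((if k < n then 0 else inner (\<phi> s) (e k))\<^sup>2 + (lg k s)\<^sup>2 + (err k)\<^sup>2)"
        using err_w_square_le(1)[OF s, of k] by simp
      finally have "\<alpha> k powr (2 * \<beta>) * (inner (\<phi> s - U s) (e k))\<^sup>2 \<le>
          \<alpha> k powr (2 * \<beta>) * (3 * ((if k < n then 0 else inner (\<phi> s) (e k))\<^sup>2 + (lg k s)\<^sup>2 + (err k)\<^sup>2))"
        by (rule mult_left_mono) simp
      also have "\<dots> = 3 * (\<alpha> k powr (2 * \<beta>) * (if k < n then 0 else inner (\<phi> s) (e k))\<^sup>2 +
          \<alpha> k powr (2 * \<beta>) * (lg k s)\<^sup>2 + \<alpha> k powr (2 * \<beta>) * (err k)\<^sup>2)"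
        by (simp only: distrib_left mult.left_commute)
      also have "\<alpha> k powr (2 * \<beta>) * (lg k s)\<^sup>2 \<le> a2 * (\<alpha> k powr (2 + 2 * \<beta>) * (lg k s)\<^sup>2)"
      proof -
        have "\<alpha> k powr (2 * \<beta>) \<le> a2 * \<alpha> k powr (2 + 2 * \<beta>)"
          using alpha_powr_mono[of "2 * \<beta>" "2 + 2 * \<beta>" k] by (simp add: a2_def)
        from mult_right_mono[OF this, of "(lg k s)\<^sup>2"] show ?thesis by (simp add: mult.assoc)
      qed
      finally show ?thesis by simp
    qed
    have "sqn (1 + 2 * \<beta>) (\<phi> s) * (1 / \<alpha> n) \<le> M * defect"
      using M[OF s] defect_ge M_nonneg by (intro mult_mono) auto
    then show "3 * (sqn (1 + 2 * \<beta>) (\<phi> s) * (1 / \<alpha> n) + a2 * defect + a1 * (c_end * defect)) \<le> c_path M * defect"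
      by (simp add: c_path_def algebra_simps)
  qed simp
  then show "\<phi> s - U s \<in> Hs (2 * \<beta>)" "sqn (2 * \<beta>) (\<phi> s - U s) \<le> c_path M * defect"
    using hspaceI[of "2 * \<beta>" "\<phi> s - U s" "c_path M * defect"] by (simp_all add: bounded_sums_bound)
qed

lemma exponents_in_range: "2 * \<beta> \<in> {0..1 + 2 * \<beta>}" "1 + 2 * \<beta> \<in> {0..1 + 2 * \<beta>}"
  using beta by auto

lemma bounded_sums_B_difference:
  assumes s: "s \<in> {0..T}"
  shows "bounded_sums (\<lambda>k. \<alpha> k powr (2 * \<beta>) * (inner (B (\<phi> s) - B (U s)) (e k))\<^sup>2) ((\<gamma> (2 * \<beta>))\<^sup>2 * (c_path M * defect))"
proof -
  have p: "\<phi> s \<in> Hs (2 * \<beta>)" using M[OF s] hspace_mono(1)[of "2 * \<beta>" "1 + 2 * \<beta>"] by auto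
  then have Us: "U s \<in> Hs (2 * \<beta>)" using hspace_diff(1)[OF p phi_minus_U(1)[OF s]] by simp
  have "sqn (2 * \<beta>) (B (\<phi> s) - B (U s)) \<le> (\<gamma> (2 * \<beta>))\<^sup>2 * (c_path M * defect)"
    by (rule order_trans[OF B_sqn[OF exponents_in_range(1) p Us]]) (intro mult_left_mono phi_minus_U(2)[OF s], simp)
  then show ?thesis
    using bounded_sums_sqn[OF hspace_diff(1)[OF B_in[OF exponents_in_range(1) p] B_in[OF exponents_in_range(1) Us]]]
    by (rule bounded_sums_mono[rotated 3]) auto
qed

lemma bounded_sums_B_high_modes:
  assumes s: "s \<in> {0..T}"
  shows "bounded_sums (\<lambda>k. \<alpha> k powr (2 * \<beta>) * (if k < n then 0 else inner (B (\<phi> s)) (e k))\<^sup>2)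
    ((\<gamma> (1 + 2 * \<beta>))\<^sup>2 * M * defect)"
proof (rule bounded_sums_mono[OF bounded_sums_high_modes[OF B_in[OF exponents_in_range(2) conjunct1[OF M[OF s]]], of n]])
  have "sqn (1 + 2 * \<beta>) (B (\<phi> s)) \<le> (\<gamma> (1 + 2 * \<beta>))\<^sup>2 * M"
    using M[OF s] by (intro order_trans[OF B_sqn0[OF exponents_in_range(2)]] mult_left_mono) auto
  then show "sqn (1 + 2 * \<beta>) (B (\<phi> s)) * (1 / \<alpha> n) \<le> (\<gamma> (1 + 2 * \<beta>))\<^sup>2 * M * defect"
    using defect_ge M_nonneg by (intro mult_mono) auto
qed simp_all

text \<open>Four terms, each divided by \<open>lam k\<close>, that is, measured in \<open>H\<^sup>2\<^sup>\<beta>\<close>: the change of \<open>B\<close> caused by passing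
  from \<open>\<phi>\<close> to \<open>U\<close>, the high modes of \<open>B(\<phi>)\<close>, the operator \<open>A\<close> applied to the lag, and the force on
  the oscillators.\<close>

lemma bounded_sums_rho:
  assumes s: "s \<in> {0..T}"
  shows "bounded_sums (\<lambda>k. (\<rho> k s)\<^sup>2) (4 * c\<^sup>2 * (c_drift M * defect + (\<Sum>k. q k s)))"
proof (rule bounded_sums_mono[OF bounded_sums_mult[OF _ bounded_sums_add[OF bounded_sums_add[OF
        bounded_sums_add[OF bounded_sums_B_difference[OF s] bounded_sums_B_high_modes[OF s]] bounded_sums_lag_defect[OF s]] bounded_sums_q_suminf[OF s]]]])
  show "0 \<le> 4 * c\<^sup>2" by simp
  show "4 * c\<^sup>2 * ((\<gamma> (2 * \<beta>))\<^sup>2 * (c_path M * defect) + (\<gamma> (1 + 2 * \<beta>))\<^sup>2 * M * defect + defect + (\<Sum>k. q k s))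
      \<le> 4 * c\<^sup>2 * (c_drift M * defect + (\<Sum>k. q k s))"
    by (simp add: c_drift_def algebra_simps)
  show "(\<rho> k s)\<^sup>2 \<le> 4 * c\<^sup>2 * (\<alpha> k powr (2 * \<beta>) * (inner (B (\<phi> s) - B (U s)) (e k))\<^sup>2 +
      \<alpha> k powr (2 * \<beta>) * (if k < n then 0 else inner (B (\<phi> s)) (e k))\<^sup>2 +
      \<alpha> k powr (2 + 2 * \<beta>) * (lg k s)\<^sup>2 + q k s)" for k
  proof -
    define v1 where "v1 = inner (B (\<phi> s) - B (U s)) (e k)"
    define v2 where "v2 = (if k < n then 0 else inner (B (\<phi> s)) (e k))"
    have "\<rho> k s = 1 / lam k * (v1 + - v2 + - (\<alpha> k * lg k s) + err k * push k s)"
      by (simp add: \<rho>_def v1_def v2_def inner_diff_left)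
    then have "(\<rho> k s)\<^sup>2 = 1 / (lam k)\<^sup>2 * (v1 + - v2 + - (\<alpha> k * lg k s) + err k * push k s)\<^sup>2"
      by (simp add: power_mult_distrib power_divide)
    also have "\<dots> \<le> (c\<^sup>2 * \<alpha> k powr (2 * \<beta>)) *
        (4 * (v1\<^sup>2 + (- v2)\<^sup>2 + (- (\<alpha> k * lg k s))\<^sup>2 + (err k * push k s)\<^sup>2))"
      by (intro mult_mono inverse_lam_sq_le sum4_square_le) auto
    also have "\<dots> = 4 * c\<^sup>2 * (\<alpha> k powr (2 * \<beta>) * v1\<^sup>2 + \<alpha> k powr (2 * \<beta>) * v2\<^sup>2 +
        \<alpha> k powr (2 + 2 * \<beta>) * (lg k s)\<^sup>2 + q k s)"
    proof -
      have "\<alpha> k powr (2 + 2 * \<beta>) = (\<alpha> k)\<^sup>2 * \<alpha> k powr (2 * \<beta>)" by (simp add: powr_add powr_numeral)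
      then show ?thesis by (simp add: q_def power_mult_distrib algebra_simps)
    qed
    finally show ?thesis by (simp only: v1_def v2_def)
  qed
qed simp

lemma summable_rho:
  assumes s: "s \<in> {0..T}"
  shows "summable (\<lambda>k. (\<rho> k s)\<^sup>2)"
  by (rule bounded_sums_summable[OF bounded_sums_rho[OF s]])

definition r where
  "r s = series (\<lambda>k. \<rho> k s)"

lemma r_measurable: "set_borel_measurable lborel {0<..<T} r"
  unfolding r_def[abs_def] by (intro set_borel_measurable_series rho_continuous summable_rho) auto

lemma r_square_le:
  assumes s: "s \<in> {0..T}"
  shows "(norm (r s))\<^sup>2 \<le> 4 * c\<^sup>2 * (c_drift M * defect + (\<Sum>k. q k s))"
  unfolding r_def norm_series[OF summable_rho[OF s]] by (rule bounded_sums_suminf[OF bounded_sums_rho[OF s]])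

lemma constant_integrable: "set_integrable lborel {0<..<T} (\<lambda>s. c_drift M * defect)"
  by (intro set_integrable_continuous_Ioo continuous_on_const)

lemma r_majorant_integrable: "set_integrable lborel {0<..<T} (\<lambda>s. 4 * c\<^sup>2 * (c_drift M * defect + (\<Sum>k. q k s)))"
  by (intro set_integrable_mult_right set_integral_add(1) constant_integrable q_series(1)) auto

lemma r_square_integrable: "set_integrable lborel {0<..<T} (\<lambda>s. (norm (r s))\<^sup>2)"
proof (rule set_integrable_bound[OF r_majorant_integrable set_borel_measurable_square[OF set_borel_measurable_norm[OF r_measurable]]])
  show "AE s in lborel. s \<in> {0<..<T} \<longrightarrow> norm ((norm (r s))\<^sup>2) \<le> norm (4 * c\<^sup>2 * (c_drift M * defect + (\<Sum>k. q k s)))"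
  proof (intro AE_I2 impI)
    fix s assume "s \<in> {0<..<T}"
    then have "(norm (r s))\<^sup>2 \<le> 4 * c\<^sup>2 * (c_drift M * defect + (\<Sum>k. q k s))" by (intro r_square_le) auto
    then show "norm ((norm (r s))\<^sup>2) \<le> norm (4 * c\<^sup>2 * (c_drift M * defect + (\<Sum>k. q k s)))" by simp
  qed
qed

lemma r_cost: "(LINT s:{0<..<T}|lborel. (norm (r s))\<^sup>2) \<le> c_rem M K * defect"
proof -
  have "(LINT s:{0<..<T}|lborel. (norm (r s))\<^sup>2) \<le> (LINT s:{0<..<T}|lborel. 4 * c\<^sup>2 * (c_drift M * defect + (\<Sum>k. q k s)))"
    by (intro set_integral_mono r_square_integrable r_majorant_integrable r_square_le) auto
  also have "\<dots> = 4 * c\<^sup>2 * ((LINT s:{0<..<T}|lborel. c_drift M * defect) + (LINT s:{0<..<T}|lborel. (\<Sum>k. q k s)))"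
    using set_integral_add(2)[OF constant_integrable q_series(1)] by simp
  also have "(LINT s:{0<..<T}|lborel. c_drift M * defect) = c_drift M * defect * T - c_drift M * defect * 0"
    using T by (intro FTC_Ioo) (auto intro!: derivative_eq_intros continuous_intros)
  also have "4 * c\<^sup>2 * (c_drift M * defect * T - c_drift M * defect * 0 + (LINT s:{0<..<T}|lborel. (\<Sum>k. q k s))) \<le>
      4 * c\<^sup>2 * (c_drift M * defect * T - c_drift M * defect * 0 + K * (c_end * defect))"
    using q_series(2) by (intro mult_left_mono add_left_mono) auto
  also have "\<dots> = c_rem M K * defect" by (simp add: c_rem_def algebra_simps)
  finally show ?thesis .
qed

definition p where
  "p s = (\<Sum>k<n. inner (\<psi> s) (e k) *\<^sub>R e k)"

definition \<psi>' where
  "\<psi>' s = p s + r s"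

lemma psi'_coefficient:
  assumes s: "s \<in> {0..T}"
  shows "inner (\<psi>' s) (e k) = (if k < n then inner (\<psi> s) (e k) else 0) + \<rho> k s"
  by (simp add: \<psi>'_def p_def r_def inner_add_left inner_sum_lessThan inner_series summable_rho[OF s])

lemma norm_p_le: "norm (p s) \<le> norm (\<psi> s)"
  unfolding p_def by (rule norm_projection_le)

lemma psi'_square_le:
  assumes theta: "\<theta> > 0"
  shows "(norm (\<psi>' s))\<^sup>2 \<le> (1 + \<theta>) * (norm (\<psi> s))\<^sup>2 + (1 + 1 / \<theta>) * (norm (r s))\<^sup>2"
proof -
  have "norm (\<psi>' s) \<le> norm (\<psi> s) + norm (r s)"
    unfolding \<psi>'_def by (rule order_trans[OF norm_triangle_ineq]) (simp add: norm_p_le)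
  then have "(norm (\<psi>' s))\<^sup>2 \<le> (norm (\<psi> s) + norm (r s))\<^sup>2" by (rule power_mono) simp
  also have "\<dots> \<le> (1 + \<theta>) * (norm (\<psi> s))\<^sup>2 + (1 + 1 / \<theta>) * (norm (r s))\<^sup>2"
    by (rule weighted_add_square_le[OF theta])
  finally show ?thesis .
qed

lemma psi'_measurable: "set_borel_measurable lborel {0<..<T} \<psi>'"
proof -
  define f1 where "f1 s = indicator {0<..<T} s *\<^sub>R \<psi> s" for s
  define f2 where "f2 s = indicator {0<..<T} s *\<^sub>R r s" for s
  have [measurable]: "f1 \<in> borel_measurable borel" "f2 \<in> borel_measurable borel"
    using psi r_measurable by (simp_all add: f1_def[abs_def] f2_def[abs_def] L2_time_def set_borel_measurable_def)
  have "(\<lambda>s. (\<Sum>k<n. inner (f1 s) (e k) *\<^sub>R e k) + f2 s) \<in> borel_measurable borel" by measurable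
  then have "(\<lambda>s. (\<Sum>k<n. inner (indicator {0<..<T} s *\<^sub>R \<psi> s) (e k) *\<^sub>R e k) + indicator {0<..<T} s *\<^sub>R r s) \<in> borel_measurable lborel"
    by (simp add: f1_def f2_def)
  moreover have "(\<Sum>k<n. inner (indicator {0<..<T} s *\<^sub>R \<psi> s) (e k) *\<^sub>R e k) + indicator {0<..<T} s *\<^sub>R r s
      = indicator {0<..<T} s *\<^sub>R \<psi>' s" for s
    by (cases "s \<in> {0<..<T}") (simp_all add: \<psi>'_def p_def)
  ultimately show ?thesis by (simp add: set_borel_measurable_def)
qed

lemma psi'_majorant_integrable: "set_integrable lborel {0<..<T} (\<lambda>s. (1 + \<theta>) * (norm (\<psi> s))\<^sup>2 + (1 + 1 / \<theta>) * (norm (r s))\<^sup>2)"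
  by (intro set_integral_add(1) set_integrable_mult_right psi_sq_integrable r_square_integrable)

lemma psi'_square_integrable: "set_integrable lborel {0<..<T} (\<lambda>s. (norm (\<psi>' s))\<^sup>2)"
proof (rule set_integrable_bound[OF psi'_majorant_integrable[of 1] set_borel_measurable_square[OF set_borel_measurable_norm[OF psi'_measurable]]])
  have "norm ((norm (\<psi>' s))\<^sup>2) \<le> norm ((1 + 1) * (norm (\<psi> s))\<^sup>2 + (1 + 1 / 1) * (norm (r s))\<^sup>2)" for s
    using psi'_square_le[of 1 s] by simp
  then show "AE s in lborel. s \<in> {0<..<T} \<longrightarrow> norm ((norm (\<psi>' s))\<^sup>2) \<le> norm ((1 + 1) * (norm (\<psi> s))\<^sup>2 + (1 + 1 / 1) * (norm (r s))\<^sup>2)"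
    by (intro AE_I2 impI)
qed

lemma psi'_cost:
  assumes theta: "\<theta> > 0"
  shows "(LINT s:{0<..<T}|lborel. (norm (\<psi>' s))\<^sup>2) \<le>
    (1 + \<theta>) * (LINT s:{0<..<T}|lborel. (norm (\<psi> s))\<^sup>2) + (1 + 1 / \<theta>) * (c_rem M K * defect)"
proof -
  have "(LINT s:{0<..<T}|lborel. (norm (\<psi>' s))\<^sup>2) \<le>
      (LINT s:{0<..<T}|lborel. (1 + \<theta>) * (norm (\<psi> s))\<^sup>2 + (1 + 1 / \<theta>) * (norm (r s))\<^sup>2)"
    by (intro set_integral_mono psi'_square_integrable psi'_majorant_integrable psi'_square_le theta)
  also have "\<dots> = (1 + \<theta>) * (LINT s:{0<..<T}|lborel. (norm (\<psi> s))\<^sup>2) +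
      (1 + 1 / \<theta>) * (LINT s:{0<..<T}|lborel. (norm (r s))\<^sup>2)"
    using set_integral_add(2)[OF set_integrable_mult_right[OF psi_sq_integrable, of "1 + \<theta>"]
        set_integrable_mult_right[OF r_square_integrable, of "1 + 1 / \<theta>"]]
    by (simp only: set_integral_mult_right)
  also have "\<dots> \<le> (1 + \<theta>) * (LINT s:{0<..<T}|lborel. (norm (\<psi> s))\<^sup>2) + (1 + 1 / \<theta>) * (c_rem M K * defect)"
    using r_cost theta by (intro add_left_mono mult_left_mono) auto
  finally show ?thesis .
qed

lemma mode_equation:
  assumes inside: "s \<in> {0<..<T}"
  shows "\<mu> * G k s = inner (B (U s)) (e k) + lam k * inner (\<psi>' s) (e k) - inner (V s) (e k) - \<alpha> k * inner (U s) (e k)"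
proof -
  have s: "s \<in> {0..T}" using inside by auto
  have "lam k * \<rho> k s = (if k < n then inner (B (\<phi> s)) (e k) else 0) - \<alpha> k * lg k s
      + err k * push k s - inner (B (U s)) (e k)"
    using lam_pos[of k] by (simp add: \<rho>_def)
  moreover have "\<mu> * G k s = (if k < n then velocity k s else 0) - lg k s / \<mu> + \<mu> * (err k * w2 k s)"
    using mu by (simp add: G_def algebra_simps power2_eq_square)
  ultimately show ?thesis
    unfolding U_coefficient[OF s] V_coefficient[OF s] psi'_coefficient[OF s] distrib_left push_def velocity_def force_def
    by (cases "k < n") (simp_all add: algebra_simps lag_high)
qed

lemma U_V_solve: "solves_wave_modes \<mu> T \<psi>' U V"
  unfolding solves_wave_modes_def
  by (intro conjI U_continuous V_continuous U_V_ends(1,2) exI[of _ G] allI ballI G_integrable V_eq_integral U_eq_integral mode_equation)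

end

context parabolic_path begin

text \<open>The parameter \<open>\<theta>\<close> separates the cost of \<open>\<psi>\<close>, up to a factor close to \<open>1\<close>, from the cost of the
  remainder, which \<open>n\<close> and \<open>\<mu>\<close> make small.\<close>

lemma regularized_control:
  obtains P where "0 \<le> P"
    "\<And>n \<mu>. 0 < \<mu> \<Longrightarrow> \<mu> \<le> 1 \<Longrightarrow> \<exists>\<psi>' U V.
      \<psi>' \<in> L2_time T \<and> solves_wave_modes \<mu> T \<psi>' U V \<and> U T = \<phi> T \<and>
      (\<forall>\<theta>>0. (LINT s:{0<..<T}|lborel. (norm (\<psi>' s))\<^sup>2) \<le>
        (1 + \<theta>) * (LINT s:{0<..<T}|lborel. (norm (\<psi> s))\<^sup>2) +
        (1 + 1 / \<theta>) * (P * (1 / \<alpha> n + endpoint_tail n + \<mu> * lag_bound n)))"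
proof -
  obtain M where M: "\<And>t. t \<in> {0..T} \<Longrightarrow> \<phi> t \<in> Hs (1 + 2 * \<beta>) \<and> sqn (1 + 2 * \<beta>) (\<phi> t) \<le> M"
    using parabolic_regularity by blast
  have M_nonneg: "0 \<le> M" using M[of 0] sqn_nonneg[of "\<phi> 0" "1 + 2 * \<beta>"] T by auto
  obtain K where K_nonneg: "0 \<le> K"
    and K: "\<And>\<mu>. 0 < \<mu> \<Longrightarrow> \<mu> \<le> 1 \<Longrightarrow> \<exists>C\<ge>0. \<forall>a\<ge>\<alpha> 0. \<exists>w w1 w2. steers T \<mu> K C a w w1 w2"
    using oscillator_steering[OF T alpha0] by blast
  show thesis
  proof (rule that[OF c_rem_nonneg[OF M_nonneg K_nonneg]])
    fix n \<mu> assume mu: "0 < \<mu>" "\<mu> \<le> (1 :: real)"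
    obtain C where C_nonneg: "0 \<le> C" and C: "\<forall>a\<ge>\<alpha> 0. \<exists>w w1 w2. steers T \<mu> K C a w w1 w2"
      using K[OF mu] by blast
    have "\<exists>w w1 w2. steers T \<mu> K C (\<alpha> k) w w1 w2" for k using C alpha_ge by blast
    then obtain w w1 w2 where steers_modes: "\<And>k. steers T \<mu> K C (\<alpha> k) (w k) (w1 k) (w2 k)" by metis
    interpret sp: steered_path e \<alpha> Q lam c \<beta> B \<gamma> E T \<psi> \<phi> M K C \<mu> n w w1 w2
      by (rule steered_path.intro[OF parabolic_path_axioms
            steered_path_axioms.intro[OF M K_nonneg C_nonneg mu(1) steers_modes]])
    show "\<exists>\<psi>' U V.
      \<psi>' \<in> L2_time T \<and> solves_wave_modes \<mu> T \<psi>' U V \<and> U T = \<phi> T \<and>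
      (\<forall>\<theta>>0. (LINT s:{0<..<T}|lborel. (norm (\<psi>' s))\<^sup>2) \<le>
        (1 + \<theta>) * (LINT s:{0<..<T}|lborel. (norm (\<psi> s))\<^sup>2) +
        (1 + 1 / \<theta>) * (c_rem M K * (1 / \<alpha> n + endpoint_tail n + \<mu> * lag_bound n)))"
      using sp.psi'_measurable sp.psi'_square_integrable sp.U_V_solve sp.U_V_ends(3) sp.psi'_cost
      unfolding sp.defect_def
      by (intro exI[of _ sp.\<psi>'] exI[of _ sp.U] exI[of _ sp.V]) (simp add: L2_time_def)
  qed
qed

end

section \<open>Comparison of the quasi-potentials\<close>

context parabolic_path begin

text \<open>First \<open>\<theta>\<close> is fixed such that \<open>\<theta>\<close> times the squared norm of \<open>\<psi>\<close> in \<open>L\<^sup>2\<close> is at most \<open>\<epsilon>\<close>, then \<open>n\<close>, which controls the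
  tails of the eigenvalues and of the endpoint, and last \<open>\<mu>\<close>, which has to compensate the
  growth of \<open>lag_bound n\<close>.\<close>

lemma V_mu_eventually_le:
  fixes \<iota> :: "'h \<Rightarrow> 'g::{real_inner, banach, second_countable_topology}"
  assumes iota: "is_H_minus_1 \<alpha> e \<iota>"
    and S: "\<And>\<mu>. \<mu> > 0 \<Longrightarrow> C0_semigroup (S \<mu>)" and S_gen: "\<And>\<mu>. \<mu> > 0 \<Longrightarrow> generator (S \<mu>) = A_mu \<alpha> e \<iota> \<mu>"
    and \<epsilon>: "\<epsilon> > 0"
  shows "eventually (\<lambda>\<mu>. V_mu \<iota> B Q (S \<mu>) \<mu> (\<phi> T) \<le>
           ereal (1 / 2 * (LINT s:{0<..<T}|lborel. (norm (\<psi> s))\<^sup>2) + \<epsilon>)) (at_right 0)"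
proof -
  obtain P where P: "0 \<le> P" and reg: "\<And>n \<mu>. 0 < \<mu> \<Longrightarrow> \<mu> \<le> 1 \<Longrightarrow> \<exists>\<psi>' U V.
      \<psi>' \<in> L2_time T \<and> solves_wave_modes \<mu> T \<psi>' U V \<and> U T = \<phi> T \<and>
      (\<forall>\<theta>>0. (LINT s:{0<..<T}|lborel. (norm (\<psi>' s))\<^sup>2) \<le>
        (1 + \<theta>) * (LINT s:{0<..<T}|lborel. (norm (\<psi> s))\<^sup>2) +
        (1 + 1 / \<theta>) * (P * (1 / \<alpha> n + endpoint_tail n + \<mu> * lag_bound n)))"
    by (rule regularized_control) blast
  define I where "I = (LINT s:{0<..<T}|lborel. (norm (\<psi> s))\<^sup>2)"
  have I0: "0 \<le> I" unfolding I_def set_lebesgue_integral_def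
    by (intro Bochner_Integration.integral_nonneg) auto
  define \<theta> where "\<theta> = \<epsilon> / (I + 1)"
  have th: "\<theta> > 0" using \<epsilon> I0 by (simp add: \<theta>_def)
  have thI: "\<theta> * I \<le> \<epsilon>" using \<epsilon> I0 by (simp add: \<theta>_def field_simps)
  define \<kappa> where "\<kappa> = (1 + 1 / \<theta>) * (P + 1)"
  have kap: "\<kappa> > 0" using th P by (simp add: \<kappa>_def add_pos_nonneg)
  define \<eta> where "\<eta> = \<epsilon> / \<kappa>"
  have eta: "\<eta> > 0" using \<epsilon> kap by (simp add: \<eta>_def)
  have "(\<lambda>n. 1 / \<alpha> n) \<longlonglongrightarrow> 0"
    using tendsto_inverse_0_at_top[OF alpha_top] by (simp add: inverse_eq_divide)
  then have "(\<lambda>n. 1 / \<alpha> n + endpoint_tail n) \<longlonglongrightarrow> 0 + 0" by (intro tendsto_add endpoint_tail_tendsto)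
  then have "eventually (\<lambda>n. 1 / \<alpha> n + endpoint_tail n < \<eta> / 2) sequentially"
    using eta by (intro order_tendstoD) auto
  then obtain n where n: "1 / \<alpha> n + endpoint_tail n < \<eta> / 2"
    by (auto simp: eventually_sequentially)
  define \<mu>1 where "\<mu>1 = min 1 (\<eta> / (2 * (lag_bound n + 1)))"
  have mu1: "\<mu>1 > 0" using eta lag_bound_nonneg[of n] by (simp add: \<mu>1_def)
  have "V_mu \<iota> B Q (S \<mu>) \<mu> (\<phi> T) \<le> ereal (1 / 2 * I + \<epsilon>)" if mu: "0 < \<mu>" "\<mu> < \<mu>1" for \<mu>
  proof -
    interpret w: controlled_wave e \<alpha> Q lam c \<beta> B \<gamma> \<iota> "S \<mu>" \<mu>
      by unfold_locales (use iota mu S S_gen in auto)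
    have "\<mu> * lag_bound n \<le> \<mu> * (lag_bound n + 1)" using mu by (intro mult_left_mono) auto
    also have "\<dots> \<le> \<eta> / (2 * (lag_bound n + 1)) * (lag_bound n + 1)"
      using mu lag_bound_nonneg[of n] by (intro mult_right_mono) (auto simp: \<mu>1_def)
    also have "\<dots> = \<eta> / 2" using lag_bound_nonneg[of n] by (simp add: field_simps)
    finally have small: "1 / \<alpha> n + endpoint_tail n + \<mu> * lag_bound n \<le> \<eta>" using n by linarith
    have small0: "0 \<le> 1 / \<alpha> n + endpoint_tail n + \<mu> * lag_bound n"
      using endpoint_tail_nonneg[of n] lag_bound_nonneg[of n] mu
      by (intro add_nonneg_nonneg mult_nonneg_nonneg) auto
    have mu_le: "\<mu> \<le> 1" using mu by (simp add: \<mu>1_def)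
    obtain \<psi>' U V where psi': "\<psi>' \<in> L2_time T" and modes: "solves_wave_modes \<mu> T \<psi>' U V"
      and UT: "U T = \<phi> T"
      and cost: "(LINT s:{0<..<T}|lborel. (norm (\<psi>' s))\<^sup>2) \<le>
        (1 + \<theta>) * I + (1 + 1 / \<theta>) * (P * (1 / \<alpha> n + endpoint_tail n + \<mu> * lag_bound n))"
      using reg[OF mu(1) mu_le, of n] th unfolding I_def by blast
    have Uc: "continuous_on {0..T} U" and Vc: "continuous_on {0..T} V" and ends: "U 0 = 0" "V 0 = 0"
      using modes by (simp_all add: solves_wave_modes_def)
    define z where "z t = (U t, \<iota> (V t))" for t
    have mild: "mild_solution (S \<mu>) (B_mu \<iota> B \<mu>) (Q_mu \<iota> Q \<mu>) T \<psi>' z"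
      unfolding z_def[abs_def]
      by (rule w.mild_solution_from_modes[OF L2_time_integrable[OF psi'] modes])
    have zc: "continuous_on {0..T} z"
      unfolding z_def[abs_def]
      by (intro continuous_on_Pair Uc bounded_linear.continuous_on[OF w.bounded_linear_iota Vc])
    have z0: "z 0 = 0" by (simp add: z_def ends linear_0[OF bounded_linear.linear[OF w.bounded_linear_iota]] zero_prod_def)
    have zT: "z T = (\<phi> T, \<iota> (V T))" by (simp add: z_def UT)
    have "V_mu \<iota> B Q (S \<mu>) \<mu> (\<phi> T) \<le> V_pair \<iota> B Q (S \<mu>) \<mu> (\<phi> T) (\<iota> (V T))"
      unfolding V_mu_def by (rule INF_lower) simp
    also have "\<dots> \<le> action (S \<mu>) (B_mu \<iota> B \<mu>) (Q_mu \<iota> Q \<mu>) T z"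
      unfolding V_pair_def using T zc z0 zT by (intro Inf_lower) blast
    also have "\<dots> \<le> ereal (1/2 * (LINT s:{0<..<T}|lborel. (norm (\<psi>' s))\<^sup>2))"
      unfolding action_def using psi' mild by (intro Inf_lower) blast
    also have "\<dots> \<le> ereal (1 / 2 * I + \<epsilon>)"
    proof -
      have "(1 + 1 / \<theta>) * (P * (1 / \<alpha> n + endpoint_tail n + \<mu> * lag_bound n)) \<le> (1 + 1 / \<theta>) * ((P + 1) * \<eta>)"
        using small small0 P th eta by (intro mult_left_mono mult_mono) auto
      also have "\<dots> = \<kappa> * \<eta>" by (simp add: \<kappa>_def)
      also have "\<dots> = \<epsilon>" using kap by (simp add: \<eta>_def)
      finally have "(LINT s:{0<..<T}|lborel. (norm (\<psi>' s))\<^sup>2) \<le> (1 + \<theta>) * I + \<epsilon>" using cost by linarith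
      also have "\<dots> \<le> I + 2 * \<epsilon>" using thI by (simp add: distrib_right)
      finally show ?thesis by simp
    qed
    finally show ?thesis .
  qed
  then show ?thesis using mu1 unfolding I_def eventually_at_right_field by blast
qed

lemma Limsup_V_mu_le:
  fixes \<iota> :: "'h \<Rightarrow> 'g::{real_inner, banach, second_countable_topology}"
  assumes "is_H_minus_1 \<alpha> e \<iota>"
    and "\<And>\<mu>. \<mu> > 0 \<Longrightarrow> C0_semigroup (S \<mu>)" and "\<And>\<mu>. \<mu> > 0 \<Longrightarrow> generator (S \<mu>) = A_mu \<alpha> e \<iota> \<mu>"
  shows "Limsup (at_right 0) (\<lambda>\<mu>. V_mu \<iota> B Q (S \<mu>) \<mu> (\<phi> T)) \<le>
           ereal (1 / 2 * (LINT s:{0<..<T}|lborel. (norm (\<psi> s))\<^sup>2))"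
proof (rule ereal_le_epsilon2)
  fix \<epsilon> :: real assume "0 < \<epsilon>"
  from V_mu_eventually_le[OF assms this]
  show "Limsup (at_right 0) (\<lambda>\<mu>. V_mu \<iota> B Q (S \<mu>) \<mu> (\<phi> T)) \<le>
      ereal (1 / 2 * (LINT s:{0<..<T}|lborel. (norm (\<psi> s))\<^sup>2)) + ereal \<epsilon>"
    by (intro Limsup_bounded) simp
qed

end

text \<open>If \<open>\<beta>\<close> were negative, the numbers \<open>lam k\<close> would grow like a positive power of the unbounded sequence
  \<open>\<alpha>\<close>. Hence the space \<open>H\<^sup>2\<^sup>\<beta>\<close>, in which the remainder of the control is measured, is a subspace of \<open>H\<close> on
  which \<open>B\<close> is Lipschitz.\<close>

lemma exponent_nonneg_if_bounded:
  fixes Q :: "'h::real_normed_vector \<Rightarrow> 'h"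
  assumes Q: "bounded_linear Q" and e: "\<And>k. norm (e k) = 1" "\<And>k. Q (e k) = lam k *\<^sub>R e k"
    and lam: "\<And>k. 1 / c * \<alpha> k powr (-\<beta>) \<le> lam k" and c: "c > 0"
    and \<alpha>: "filterlim \<alpha> at_top (sequentially :: nat filter)"
  shows "0 \<le> (\<beta> :: real)"
proof (rule ccontr)
  assume "\<not> 0 \<le> \<beta>"
  then have b: "- \<beta> > 0" by simp
  obtain K where K: "\<And>x. norm (Q x) \<le> norm x * K" using bounded_linear.bounded[OF Q] by blast
  define Z where "Z = c * \<bar>K\<bar> + 1"
  have Z: "Z > 0" using c by (simp add: Z_def add_nonneg_pos)
  have "eventually (\<lambda>k. \<alpha> k \<ge> Z powr (1 / - \<beta>)) sequentially"
    using \<alpha> by (simp add: filterlim_at_top)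
  then obtain k where k: "\<alpha> k \<ge> Z powr (1 / - \<beta>)" by (auto simp: eventually_sequentially)
  have "Z = (Z powr (1 / - \<beta>)) powr (- \<beta>)" using Z b by (simp add: powr_powr)
  also have "\<dots> \<le> \<alpha> k powr (- \<beta>)" using k b by (intro powr_mono2) auto
  finally have 1: "Z \<le> \<alpha> k powr (- \<beta>)" .
  have "lam k \<le> \<bar>K\<bar>" using K[of "e k"] e by simp
  then have "1 / c * \<alpha> k powr (- \<beta>) \<le> \<bar>K\<bar>" using lam[of k] by linarith
  then have "\<alpha> k powr (- \<beta>) \<le> c * \<bar>K\<bar>" using c by (simp add: field_simps)
  then show False using 1 by (simp add: Z_def)
qed

lemma filterlim_at_top_if_bigtheta_powr:
  assumes \<alpha>: "\<alpha> \<in> \<Theta>(\<lambda>k. real k powr p)" and p: "p > 0" and pos: "\<And>k. 0 < \<alpha> k"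
  shows "filterlim \<alpha> at_top (sequentially :: nat filter)"
proof -
  have "\<alpha> \<in> \<Omega>(\<lambda>k. real k powr p)" using \<alpha> by (rule bigthetaD2)
  then obtain C where C: "C > 0" "eventually (\<lambda>k. norm (\<alpha> k) \<ge> C * norm (real k powr p)) sequentially"
    by (rule landau_omega.bigE)
  have "filterlim (\<lambda>k. C * real k powr p) at_top sequentially"
    unfolding filterlim_at_top_ge[where c = 1]
  proof (intro allI impI)
    fix Z :: real assume Z: "1 \<le> Z"
    have "Z \<le> C * real k powr p" if "real k \<ge> (Z / C) powr (1 / p)" for k
    proof -
      have "Z / C = ((Z / C) powr (1 / p)) powr p" using Z C p by (simp add: powr_powr)
      also have "\<dots> \<le> real k powr p" using that p by (intro powr_mono2) auto
      finally show ?thesis using C by (simp add: field_simps)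
    qed
    moreover have "eventually (\<lambda>k. real k \<ge> (Z / C) powr (1 / p)) sequentially"
      using filterlim_real_sequentially by (simp add: filterlim_at_top)
    ultimately show "eventually (\<lambda>k. Z \<le> C * real k powr p) sequentially"
      by (auto elim: eventually_mono)
  qed
  moreover have "eventually (\<lambda>k. C * real k powr p \<le> \<alpha> k) sequentially"
    using C(2) by eventually_elim (use pos in \<open>simp add: less_imp_le\<close>)
  ultimately show ?thesis by (rule filterlim_at_top_mono)
qed

theorem corollary7p4:
  fixes D :: "(real ^ 'd) set"
    and J :: "(real ^ 'd \<Rightarrow> real) \<Rightarrow> 'h::{real_inner, banach, second_countable_topology}"
    and e :: "nat \<Rightarrow> 'h" and \<alpha> :: "nat \<Rightarrow> real"
    and \<iota> :: "'h \<Rightarrow> 'g::{real_inner, banach, second_countable_topology}"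
    and Q :: "'h \<Rightarrow> 'h" and lam :: "nat \<Rightarrow> real" and c \<beta> :: real
    and B :: "'h \<Rightarrow> 'h" and \<gamma> :: "real \<Rightarrow> real" and DB :: "'h \<Rightarrow> 'h \<Rightarrow> 'h"
    and E :: "real \<Rightarrow> 'h \<Rightarrow> 'h" and S :: "real \<Rightarrow> real \<Rightarrow> 'h \<times> 'g \<Rightarrow> 'h \<times> 'g"
    and N :: "'h set"
  assumes "open D" and "connected D" and "bounded D"
    and "is_L2 D J"
    and "orthonormal_basis e"
    and "\<And>k. (e k, - \<alpha> k *\<^sub>R e k) \<in> dirichlet_laplacian D J"
    and "0 < \<alpha> 0" and "mono \<alpha>"
    and "\<alpha> \<in> \<Theta>(\<lambda>k. real k powr (2 / real CARD('d)))"
    and "is_H_minus_1 \<alpha> e \<iota>"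
    and "bounded_linear Q" and "\<And>k. Q (e k) = lam k *\<^sub>R e k"
    and "c > 0" and "\<And>k. 1 / c * \<alpha> k powr (-\<beta>) \<le> lam k \<and> lam k \<le> c * \<alpha> k powr (-\<beta>)"
    and "\<beta> > (real CARD('d) - 2) / 4"
    and "\<And>\<delta>. \<delta> \<in> {0..1 + 2 * \<beta>} \<Longrightarrow> B ` hspace \<alpha> e \<delta> \<subseteq> hspace \<alpha> e \<delta>"
    and "\<And>\<delta> x y. \<delta> \<in> {0..1 + 2 * \<beta>} \<Longrightarrow> x \<in> hspace \<alpha> e \<delta> \<Longrightarrow> y \<in> hspace \<alpha> e \<delta> \<Longrightarrow>
           hnorm \<alpha> e \<delta> (B x - B y) \<le> \<gamma> \<delta> * hnorm \<alpha> e \<delta> (x - y)"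
    and "\<And>\<delta>. \<delta> \<in> {0..1 + 2 * \<beta>} \<Longrightarrow> \<gamma> \<delta> < \<alpha> 0"
    and "B 0 = 0"
    and "\<And>x. x \<in> hspace \<alpha> e (2 * \<beta>) \<Longrightarrow> has_derivative_in \<alpha> e (2 * \<beta>) B (DB x) x"
    and "(SUP x\<in>hspace \<alpha> e (2 * \<beta>). op_norm_in \<alpha> e (2 * \<beta>) (DB x)) = \<gamma> (2 * \<beta>)"
    and "C0_semigroup E" and "generator E = dirichlet_laplacian D J"
    and "\<And>\<mu>. \<mu> > 0 \<Longrightarrow> C0_semigroup (S \<mu>)"
    and "\<And>\<mu>. \<mu> > 0 \<Longrightarrow> generator (S \<mu>) = A_mu \<alpha> e \<iota> \<mu>"
    and "closed N"
  shows "Limsup (at_right 0) (\<lambda>\<mu>. INF x\<in>N. V_mu \<iota> B Q (S \<mu>) \<mu> x) \<le> (INF x\<in>N. V_limit B Q E x)"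
proof (rule INF_greatest)
  fix x assume xN: "x \<in> N"
  note D_eigen = assms(6) and iota = assms(10) and S = assms(24) and S_gen = assms(25)
  interpret orthonormal_system e by unfold_locales (rule assms(5))
  have pos: "0 < \<alpha> k" for k using assms(7) monoD[OF assms(8), of 0 k] by simp
  have top: "filterlim \<alpha> at_top sequentially"
    by (rule filterlim_at_top_if_bigtheta_powr[OF assms(9) _ pos]) simp
  have norm_e: "norm (e k) = 1" for k using inner_basis[of k k] by (simp add: norm_eq_sqrt_inner)
  have beta: "0 \<le> \<beta>"
  proof (rule exponent_nonneg_if_bounded[OF assms(11) norm_e assms(12) _ assms(13) top])
    show "1 / c * \<alpha> k powr (- \<beta>) \<le> lam k" for k using assms(14)[of k] by simp
  qed
  interpret eigenvalue_scale e \<alpha> by unfold_locales (rule assms(7) assms(8) top)+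
  interpret controlled_equation e \<alpha> Q lam c \<beta> B \<gamma>
    by (rule controlled_equation.intro[OF eigenvalue_scale_axioms
          controlled_equation_axioms.intro[OF assms(11,12,13,14) beta assms(16,17,19)]])
  have E_gen: "(e k, - \<alpha> k *\<^sub>R e k) \<in> generator E" for k unfolding assms(23) by (rule D_eigen)
  have E: "C0_semigroup E" by (rule assms(22))
  have "Limsup (at_right 0) (\<lambda>\<mu>. V_mu \<iota> B Q (S \<mu>) \<mu> x) \<le> V_limit B Q E x"
    unfolding V_limit_def
  proof (rule Inf_greatest, clarify)
    fix T :: real and \<phi> :: "real \<Rightarrow> 'h" assume T: "0 \<le> T" and phi: "continuous_on {0..T} \<phi>" "\<phi> 0 = 0"
    show "Limsup (at_right 0) (\<lambda>\<mu>. V_mu \<iota> B Q (S \<mu>) \<mu> (\<phi> T)) \<le> action E B Q T \<phi>"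
      unfolding action_def
    proof (rule Inf_greatest, clarify)
      fix \<psi> :: "real \<Rightarrow> 'h" assume psi: "\<psi> \<in> L2_time T" "mild_solution E B Q T \<psi> \<phi>"
      show "Limsup (at_right 0) (\<lambda>\<mu>. V_mu \<iota> B Q (S \<mu>) \<mu> (\<phi> T)) \<le>
          ereal (1/2 * (LINT s:{0<..<T}|lborel. (norm (\<psi> s))\<^sup>2))"
      \<comment> \<open>a path of duration \<open>0\<close> ends at \<open>0\<close>, which is reached at no cost by resting for one unit of time\<close>
      proof (cases "T = 0")
        case False
        interpret parabolic_path e \<alpha> Q lam c \<beta> B \<gamma> E T \<psi> \<phi>
          by (rule parabolic_path.intro[OF controlled_equation_axioms
                parabolic_path_axioms.intro[OF E E_gen _ psi(1) phi psi(2)]]) (use T False in simp)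
        show ?thesis by (rule Limsup_V_mu_le[OF iota S S_gen])
      next
        case True
        interpret rest: parabolic_path e \<alpha> Q lam c \<beta> B \<gamma> E 1 "\<lambda>_. 0" "\<lambda>_. 0"
        proof (rule parabolic_path.intro[OF controlled_equation_axioms parabolic_path_axioms.intro[OF E E_gen]])
          have "E t 0 = 0" if "0 \<le> t" for t
            by (rule linear_0[OF bounded_linear.linear[OF C0_bounded_linear[OF E that]]])
          then have "(LINT s:{0<..<t}|lborel. E (t - s) 0) = 0" for t
            by (intro trans[OF set_lebesgue_integral_cong[where g = "\<lambda>_. 0"] set_lebesgue_integral_zero]) auto
          then show "mild_solution E B Q 1 (\<lambda>_. 0) (\<lambda>_. 0)"
            using \<open>\<And>t. 0 \<le> t \<Longrightarrow> E t 0 = 0\<close>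
            by (simp add: mild_solution_def B_zero linear_0[OF bounded_linear.linear[OF Q]])
        qed (simp_all add: L2_time_def set_borel_measurable_def set_integrable_def)
        show ?thesis using rest.Limsup_V_mu_le[OF iota S S_gen] True phi(2)
          by (simp add: set_lebesgue_integral_def)
      qed
    qed
  qed
  moreover have "Limsup (at_right 0) (\<lambda>\<mu>. INF x\<in>N. V_mu \<iota> B Q (S \<mu>) \<mu> x)
      \<le> Limsup (at_right 0) (\<lambda>\<mu>. V_mu \<iota> B Q (S \<mu>) \<mu> x)"
    by (intro Limsup_mono always_eventually allI INF_lower xN)
  ultimately show "Limsup (at_right 0) (\<lambda>\<mu>. INF x\<in>N. V_mu \<iota> B Q (S \<mu>) \<mu> x) \<le> V_limit B Q E x"
    by (rule order_trans[rotated])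
qed

end
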